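(* Let $G$ be a standard reductive group over $\Bbbk$ with Lie algebra $\mathfrak g$, and let $m>0$. Every semisimple element of $\mathfrak g_m$ is conjugate, under the adjoint action of $G_m$, to a semisimple element of $\mathfrak g_m^{(0)}$.
   Context: $\Bbbk$ is an algebraically closed field of characteristic $p>0$. A standard reductive group $G$ is a connected reductive algebraic group over $\Bbbk$ such that (H1) the derived subgroup of $G$ is simply connected, (H2) $p$ is good for the root system of $G$, (H3) there is a non-degenerate $G$-invariant bilinear form $\kappa$ on $\mathfrak g=\operatorname{Lie}(G)$. The truncated current algebra $\mathfrak g_m=\mathfrak g\otimes\Bbbk[t]/(t^{m+1})$ is a Lie algebra over $\Bbbk$ with bracket $[xt^i,yt^j]=[x,y]t^{i+j}$ where $xt^i:=x\otimes t^i$; it is restricted, with $p$-map determined by $(xt^i)^{[p]}=x^{[p]}t^{pi}$. It is graded by $\mathfrak g_m^{(i)}=\mathfrak g t^i$, $0\le i\le m$; $\mathfrak g_m^{(0)}$ is identified with $\mathfrak g$. $G_m:=G(\Bbbk[t]/(t^{m+1}))$ is the truncated current group, an algebraic group over $\Bbbk$ (the $\Bbbk$-points of the $m$-jet scheme of $G$) with Lie algebra $\mathfrak g_m$, acting on $\mathfrak g_m$ by the adjoint action. An element $x$ of a restricted Lie algebra is semisimple if $x$ lies in the span of $\{x^{[p]^i}\mid i>0\}$. *)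

theory Defs
  imports
    "HOL-Analysis.Analysis"
    "HOL-Algebra.Generated_Groups"
    "HOL-Computational_Algebra.Polynomial"
    "HOL-Library.Poly_Mapping"
    "HOL-Library.FuncSet"
begin

section \<open>Matrices over a field and over its truncated polynomial rings\<close>

definition Mat :: "('a::semiring_1^'n^'n) monoid" where
  "Mat = \<lparr>carrier = UNIV, mult = (**), one = mat 1\<rparr>"

definition GL :: "('a::semiring_1^'n^'n) monoid" where
  "GL = units_of Mat"

text \<open>The ring \<open>k[t]/(t^(m+1))\<close> is represented by the polynomials of degree at most \<open>m\<close>,
  multiplied modulo \<open>t^(m+1)\<close>; \<open>TMat m\<close> is the multiplicative monoid of the square matrices
  over it.\<close>

definition TMat :: "nat \<Rightarrow> ('k::field poly^'n^'n) monoid" where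
  "TMat m = \<lparr>carrier = {A. \<forall>i j. degree (A $ i $ j) \<le> m},
             mult = (\<lambda>A B. \<chi> i j. (A ** B) $ i $ j mod monom 1 (Suc m)),
             one = mat 1\<rparr>"

definition tensor_t :: "'k::field^'n^'n \<Rightarrow> nat \<Rightarrow> 'k poly^'n^'n"  (infix \<open>\<otimes>t\<close> 75) where
  "x \<otimes>t i = (\<chi> a b. monom (x $ a $ b) i)"

definition mscale :: "'a::semiring_1 \<Rightarrow> 'a^'n^'n \<Rightarrow> 'a^'n^'n" where
  "mscale c A = (\<chi> i j. c * A $ i $ j)"

definition tscale :: "'k::field \<Rightarrow> 'k poly^'n^'n \<Rightarrow> 'k poly^'n^'n" where
  "tscale c = mscale [:c:]"

lemma module_tscale: "module (tscale :: 'k::field \<Rightarrow> 'k poly^'n^'n \<Rightarrow> _)"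
  by unfold_locales
    (simp_all add: tscale_def mscale_def vec_eq_iff algebra_simps smult_add_left smult_add_right)

definition Ad :: "'a monoid \<Rightarrow> 'a \<Rightarrow> 'a \<Rightarrow> 'a" where
  "Ad M g x = g \<otimes>\<^bsub>M\<^esub> x \<otimes>\<^bsub>M\<^esub> inv\<^bsub>M\<^esub> g"


section \<open>Linear algebraic groups\<close>

text \<open>An affine algebraic group over the algebraically closed field \<open>k\<close> is given by its group of
  \<open>k\<close>-points, embedded as a Zariski closed subgroup of some general linear group.\<close>

type_synonym ('k, 'n) coord_poly = "(('n \<times> 'n) \<Rightarrow>\<^sub>0 nat) \<Rightarrow>\<^sub>0 'k"

text \<open>Value of a polynomial in the matrix coordinates at a matrix over a \<open>k\<close>-algebra with
  structure map \<open>\<phi>\<close>.\<close>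

definition eval_at ::
    "('k::comm_ring_1 \<Rightarrow> 'r::comm_ring_1) \<Rightarrow> ('k, 'n::finite) coord_poly \<Rightarrow> 'r^'n^'n \<Rightarrow> 'r" where
  "eval_at \<phi> f A =
     (\<Sum>u\<in>Poly_Mapping.keys f. \<phi> (Poly_Mapping.lookup f u) *
        (\<Prod>v\<in>Poly_Mapping.keys u. (A $ fst v $ snd v) ^ Poly_Mapping.lookup u v))"

definition zariski :: "('k::field^'n^'n) topology" where
  "zariski = topology_generated_by (range (\<lambda>f. {A. eval_at (\<lambda>c. c) f A \<noteq> 0}))"

definition alg_group :: "('k::field^'n^'n) set \<Rightarrow> bool" where
  "alg_group G \<longleftrightarrow> subgroup G GL \<and> closedin (subtopology zariski (carrier GL)) G"

definition connected_alg_group :: "('k::field^'n^'n) set \<Rightarrow> bool" where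
  "connected_alg_group G \<longleftrightarrow> alg_group G \<and> connectedin zariski G"

definition identity_component :: "('k::field^'n^'n) set \<Rightarrow> ('k^'n^'n) set" where
  "identity_component G = connected_component_of_set (subtopology zariski G) (mat 1)"

definition unipotent :: "'k::field^'n^'n \<Rightarrow> bool" where
  "unipotent A \<longleftrightarrow> (\<exists>r::nat. (A - mat 1) [^]\<^bsub>Mat\<^esub> r = 0)"

text \<open>Trivial unipotent radical: the unipotent radical is the largest connected closed normal
  unipotent subgroup.\<close>

definition connected_reductive :: "('k::field^'n^'n) set \<Rightarrow> bool" where
  "connected_reductive G \<longleftrightarrow> connected_alg_group G \<and>
     (\<forall>U. connected_alg_group U \<and> U \<lhd> (GL\<lparr>carrier := G\<rparr>) \<and> (\<forall>u\<in>U. unipotent u)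
        \<longrightarrow> U = {mat 1})"

text \<open>Points over \<open>k[t]/(t^(m+1))\<close>. Since \<open>G\<close> is closed in the general linear group, the
  polynomials in the matrix coordinates vanishing on \<open>G\<close> define \<open>G\<close> as an affine scheme
  inside it.\<close>

definition vanishing_ideal :: "('k::field^'n^'n) set \<Rightarrow> ('k, 'n) coord_poly set" where
  "vanishing_ideal G = {f. \<forall>A\<in>G. eval_at (\<lambda>c. c) f A = 0}"

definition trunc_current_group :: "nat \<Rightarrow> ('k::field^'n^'n) set \<Rightarrow> ('k poly^'n^'n) set" where
  "trunc_current_group m G =
     {A \<in> Units (TMat m). \<forall>f\<in>vanishing_ideal G.
        eval_at (\<lambda>c. [:c:]) f A mod monom 1 (Suc m) = 0}"

text \<open>The Lie algebra is the kernel of \<open>G(k[t]/(t^2)) \<rightarrow> G(k)\<close>; its bracket is the matrix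
  commutator and its \<open>p\<close>-map the matrix \<open>p\<close>-th power.\<close>

definition Lie :: "('k::field^'n^'n) set \<Rightarrow> ('k^'n^'n) set" where
  "Lie G = {x. mat 1 \<otimes>t 0 + x \<otimes>t 1 \<in> trunc_current_group 1 G}"


section \<open>Tori, roots and coroots\<close>

definition regular_on :: "('k::field^'n^'n) set \<Rightarrow> ('k^'n^'n \<Rightarrow> 'k) \<Rightarrow> bool" where
  "regular_on G h \<longleftrightarrow> (\<exists>f d. \<forall>A\<in>G. h A = eval_at (\<lambda>c. c) f A / det A ^ d)"

definition alg_hom ::
    "('k::field^'n^'n) set \<Rightarrow> ('k^'n^'n) set \<Rightarrow> ('k^'n^'n \<Rightarrow> 'k^'n^'n) \<Rightarrow> bool" where
  "alg_hom G H \<phi> \<longleftrightarrow> \<phi> \<in> hom (GL\<lparr>carrier := G\<rparr>) (GL\<lparr>carrier := H\<rparr>) \<and>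
     (\<forall>i j. regular_on G (\<lambda>A. \<phi> A $ i $ j))"

definition alg_isomorphic :: "('k::field^'n^'n) set \<Rightarrow> ('k^'n^'n) set \<Rightarrow> bool" where
  "alg_isomorphic G H \<longleftrightarrow>
     (\<exists>\<phi> \<psi>. alg_hom G H \<phi> \<and> alg_hom H G \<psi> \<and>
        (\<forall>A\<in>G. \<psi> (\<phi> A) = A) \<and> (\<forall>B\<in>H. \<phi> (\<psi> B) = B))"

text \<open>The group of diagonal matrices with diagonal entry 1 outside of \<open>S\<close>, that is, the product
  of \<open>card S\<close> copies of the multiplicative group.\<close>

definition diag_torus :: "'n set \<Rightarrow> ('k::field^'n^'n) set" where
  "diag_torus S = {A \<in> carrier GL. (\<forall>i j. i \<noteq> j \<longrightarrow> A $ i $ j = 0) \<and> (\<forall>i. i \<notin> S \<longrightarrow> A $ i $ i = 1)}"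

text \<open>A torus consisting of \<open>n \<times> n\<close> matrices has rank at most \<open>n\<close>, so that the groups
  \<open>diag_torus S\<close> are enough to express being isomorphic to some power of the multiplicative
  group.\<close>

definition torus :: "('k::field^'n^'n) set \<Rightarrow> bool" where
  "torus T \<longleftrightarrow> alg_group T \<and> (\<exists>S. alg_isomorphic T (diag_torus S))"

definition maximal_torus :: "('k::field^'n^'n) set \<Rightarrow> ('k^'n^'n) set \<Rightarrow> bool" where
  "maximal_torus G T \<longleftrightarrow> torus T \<and> T \<subseteq> G \<and> (\<forall>T'. torus T' \<and> T \<subseteq> T' \<and> T' \<subseteq> G \<longrightarrow> T' = T)"

text \<open>Characters and cocharacters are extensional functions, so that equality of functions is
  equality of (co)characters. The character group is written multiplicatively.\<close>

definition characters :: "('k::field^'n^'n) set \<Rightarrow> ('k^'n^'n \<Rightarrow> 'k) set" where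
  "characters T = {\<alpha> \<in> extensional T. regular_on T \<alpha> \<and> (\<forall>s\<in>T. \<alpha> s \<noteq> 0) \<and>
     (\<forall>s\<in>T. \<forall>t\<in>T. \<alpha> (s ** t) = \<alpha> s * \<alpha> t)}"

definition cocharacters :: "('k::field^'n^'n) set \<Rightarrow> ('k \<Rightarrow> 'k^'n^'n) set" where
  "cocharacters T = {l \<in> extensional (- {0}). (\<forall>c. c \<noteq> 0 \<longrightarrow> l c \<in> T) \<and>
     (\<forall>c d. c \<noteq> 0 \<longrightarrow> d \<noteq> 0 \<longrightarrow> l (c * d) = l c ** l d) \<and>
     (\<forall>i j. \<exists>q d. \<forall>c. c \<noteq> 0 \<longrightarrow> l c $ i $ j = poly q c / c ^ d)}"

definition cocharacter_group :: "('k::field^'n^'n) set \<Rightarrow> ('k \<Rightarrow> 'k^'n^'n) monoid" where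
  "cocharacter_group T = \<lparr>carrier = cocharacters T,
     mult = (\<lambda>l l'. restrict (\<lambda>c. l c ** l' c) (- {0})),
     one = restrict (\<lambda>c. mat 1) (- {0})\<rparr>"

definition roots :: "('k::field^'n^'n) set \<Rightarrow> ('k^'n^'n) set \<Rightarrow> ('k^'n^'n \<Rightarrow> 'k) set" where
  "roots G T = {\<alpha> \<in> characters T. (\<exists>t\<in>T. \<alpha> t \<noteq> 1) \<and>
     (\<exists>x\<in>Lie G. x \<noteq> 0 \<and> (\<forall>t\<in>T. Ad Mat t x = mscale (\<alpha> t) x))}"

definition centralizer_in :: "('k::field^'n^'n) set \<Rightarrow> ('k^'n^'n) set \<Rightarrow> ('k^'n^'n) set" where
  "centralizer_in G S = {g \<in> G. \<forall>s\<in>S. g ** s = s ** g}"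

text \<open>The coroot of \<open>\<alpha>\<close> is the cocharacter that takes values in the derived subgroup of the
  centralizer of the identity component of the kernel of \<open>\<alpha>\<close>, a group of semisimple rank one,
  and pairs with \<open>\<alpha>\<close> to 2.\<close>

definition is_coroot ::
    "('k::field^'n^'n) set \<Rightarrow> ('k^'n^'n) set \<Rightarrow> ('k^'n^'n \<Rightarrow> 'k) \<Rightarrow> ('k \<Rightarrow> 'k^'n^'n) \<Rightarrow> bool" where
  "is_coroot G T \<alpha> l \<longleftrightarrow> l \<in> cocharacters T \<and>
     (\<forall>c. c \<noteq> 0 \<longrightarrow> \<alpha> (l c) = c ^ 2) \<and>
     (\<forall>c. c \<noteq> 0 \<longrightarrow>
        l c \<in> derived GL (centralizer_in G (identity_component {t \<in> T. \<alpha> t = 1})))"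

definition coroots :: "('k::field^'n^'n) set \<Rightarrow> ('k^'n^'n) set \<Rightarrow> ('k \<Rightarrow> 'k^'n^'n) set" where
  "coroots G T = {l. \<exists>\<alpha>\<in>roots G T. is_coroot G T \<alpha> l}"


section \<open>Standard reductive groups\<close>

text \<open>For a semisimple group: the coroots generate the cocharacter group of a maximal torus,
  equivalently its character group is the full weight lattice. Maximal tori being conjugate,
  the choice of the torus does not matter.\<close>

definition simply_connected_group :: "('k::field^'n^'n) set \<Rightarrow> bool" where
  "simply_connected_group H \<longleftrightarrow> (\<forall>T. maximal_torus H T \<longrightarrow>
     generate (cocharacter_group T) (coroots H T) = cocharacters T)"

definition int_comb ::
    "('k::field^'n^'n) set \<Rightarrow> ('k^'n^'n \<Rightarrow> 'k) set \<Rightarrow> (('k^'n^'n \<Rightarrow> 'k) \<Rightarrow> int)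
      \<Rightarrow> ('k^'n^'n \<Rightarrow> 'k)" where
  "int_comb T B n = restrict (\<lambda>t. \<Prod>\<beta>\<in>B. \<beta> t powi n \<beta>) T"

definition root_base ::
    "('k::field^'n^'n) set \<Rightarrow> ('k^'n^'n \<Rightarrow> 'k) set \<Rightarrow> ('k^'n^'n \<Rightarrow> 'k) set \<Rightarrow> bool" where
  "root_base T \<Phi> B \<longleftrightarrow> B \<subseteq> \<Phi> \<and> finite B \<and>
     (\<forall>n. int_comb T B n = restrict (\<lambda>t. 1) T \<longrightarrow> (\<forall>\<beta>\<in>B. n \<beta> = 0)) \<and>
     (\<forall>\<alpha>\<in>\<Phi>. \<exists>n. \<alpha> = int_comb T B n \<and> ((\<forall>\<beta>\<in>B. n \<beta> \<ge> 0) \<or> (\<forall>\<beta>\<in>B. n \<beta> \<le> 0)))"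

text \<open>The roots that are maximal for the dominance order of \<open>B\<close> are the highest roots of the
  irreducible components.\<close>

definition highest_root ::
    "('k::field^'n^'n) set \<Rightarrow> ('k^'n^'n \<Rightarrow> 'k) set \<Rightarrow> ('k^'n^'n \<Rightarrow> 'k) set \<Rightarrow> ('k^'n^'n \<Rightarrow> 'k)
      \<Rightarrow> bool" where
  "highest_root T \<Phi> B \<alpha> \<longleftrightarrow> \<alpha> \<in> \<Phi> \<and>
     (\<forall>\<gamma>\<in>\<Phi>. \<forall>n. (\<forall>\<beta>\<in>B. n \<beta> \<ge> 0) \<and> (\<forall>t\<in>T. \<gamma> t = \<alpha> t * int_comb T B n t) \<longrightarrow> \<gamma> = \<alpha>)"

text \<open>A prime is good if it divides no coefficient of the highest root of an irreducible component
  with respect to the simple roots of that component. These are exactly the simple roots of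
  nonzero coefficient.\<close>

definition good_prime ::
    "nat \<Rightarrow> ('k::field^'n^'n) set \<Rightarrow> ('k^'n^'n \<Rightarrow> 'k) set \<Rightarrow> bool" where
  "good_prime p T \<Phi> \<longleftrightarrow> (\<forall>B \<alpha> n. root_base T \<Phi> B \<and> highest_root T \<Phi> B \<alpha> \<and> \<alpha> = int_comb T B n
     \<longrightarrow> (\<forall>\<beta>\<in>B. n \<beta> \<noteq> 0 \<longrightarrow> \<not> int p dvd n \<beta>))"

definition bilinear_form_on ::
    "('k::field^'n^'n) set \<Rightarrow> ('k^'n^'n \<Rightarrow> 'k^'n^'n \<Rightarrow> 'k) \<Rightarrow> bool" where
  "bilinear_form_on V \<kappa> \<longleftrightarrow>
     (\<forall>x\<in>V. \<forall>y\<in>V. \<forall>z\<in>V. \<forall>c. \<kappa> (x + y) z = \<kappa> x z + \<kappa> y z \<and> \<kappa> (mscale c x) z = c * \<kappa> x z \<and>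
        \<kappa> z (x + y) = \<kappa> z x + \<kappa> z y \<and> \<kappa> z (mscale c x) = c * \<kappa> z x)"

definition nondegenerate_on ::
    "('k::field^'n^'n) set \<Rightarrow> ('k^'n^'n \<Rightarrow> 'k^'n^'n \<Rightarrow> 'k) \<Rightarrow> bool" where
  "nondegenerate_on V \<kappa> \<longleftrightarrow>
     (\<forall>x\<in>V. (\<forall>y\<in>V. \<kappa> x y = 0) \<longrightarrow> x = 0) \<and> (\<forall>y\<in>V. (\<forall>x\<in>V. \<kappa> x y = 0) \<longrightarrow> y = 0)"

definition standard_reductive :: "('k::field^'n^'n) set \<Rightarrow> bool" where
  "standard_reductive G \<longleftrightarrow> connected_reductive G \<and>
     simply_connected_group (derived GL G) \<and>
     (\<forall>T. maximal_torus G T \<longrightarrow> good_prime CHAR('k) T (roots G T)) \<and>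
     (\<exists>\<kappa>. bilinear_form_on (Lie G) \<kappa> \<and> nondegenerate_on (Lie G) \<kappa> \<and>
        (\<forall>g\<in>G. \<forall>x\<in>Lie G. \<forall>y\<in>Lie G. \<kappa> (Ad Mat g x) (Ad Mat g y) = \<kappa> x y))"


section \<open>Truncated current algebras\<close>

definition trunc_current_algebra :: "nat \<Rightarrow> ('k::field^'n^'n) set \<Rightarrow> ('k poly^'n^'n) set" where
  "trunc_current_algebra m L = {(\<Sum>i\<le>m. x i \<otimes>t i) | x. \<forall>i\<le>m. x i \<in> L}"

definition graded_piece :: "('k::field^'n^'n) set \<Rightarrow> nat \<Rightarrow> ('k poly^'n^'n) set" where
  "graded_piece L i = (\<lambda>x. x \<otimes>t i) ` L"

text \<open>The truncated current algebra is a restricted Lie subalgebra of the matrix algebra over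
  \<open>k[t]/(t^(m+1))\<close> with the commutator bracket, and the \<open>p\<close>-map of the latter is the associative
  \<open>p\<close>-th power. The lemmas \<open>tensor_t_mult\<close> and \<open>p_map_tensor_t\<close> show that bracket and \<open>p\<close>-map
  have the prescribed values on the elements \<open>x t^i\<close>.\<close>

definition p_map :: "nat \<Rightarrow> 'k::field poly^'n^'n \<Rightarrow> 'k poly^'n^'n" where
  "p_map m X = X [^]\<^bsub>TMat m\<^esub> CHAR('k)"

lemma tensor_t_mult:
  "(x \<otimes>t i) \<otimes>\<^bsub>TMat m\<^esub> (y \<otimes>t j) = (if i + j \<le> m then (x ** y) \<otimes>t (i + j) else 0)"
proof -
  have "monom c r mod monom 1 (Suc m) = (if r \<le> m then monom c r else 0)" for c :: 'a and r
  proof (cases "r \<le> m")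
    case True
    then show ?thesis
      by (cases "c = 0") (auto intro!: mod_poly_less simp: degree_monom_eq)
  next
    case False
    then have "monom c r = monom 1 (Suc m) * monom c (r - Suc m)"
      by (simp add: mult_monom)
    then show ?thesis using False by simp
  qed
  moreover have "((x \<otimes>t i) ** (y \<otimes>t j)) $ a $ b = monom ((x ** y) $ a $ b) (i + j)" for a b
    by (simp add: tensor_t_def matrix_matrix_mult_def mult_monom monom_sum)
  ultimately show ?thesis
    by (simp add: TMat_def tensor_t_def vec_eq_iff)
qed

lemma nat_pow_tensor_t:
  "(x \<otimes>t i) [^]\<^bsub>TMat m\<^esub> (r::nat) = (if i * r \<le> m then (x [^]\<^bsub>Mat\<^esub> r) \<otimes>t (i * r) else 0)"
proof (induction r)
  case 0
  show ?case
    by (simp add: nat_pow_def TMat_def Mat_def tensor_t_def mat_def vec_eq_iff monom_0)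
next
  case (Suc r)
  have "(0 :: 'a poly^'b^'b) \<otimes>\<^bsub>TMat m\<^esub> Z = 0" for Z
    by (simp add: TMat_def vec_eq_iff matrix_matrix_mult_def)
  then show ?case
    using Suc tensor_t_mult[where x = "x [^]\<^bsub>Mat\<^esub> r" and i = "i * r" and m = m and y = x and j = i]
    by (auto simp: nat_pow_def Mat_def add.commute)
qed

lemma p_map_tensor_t:
  fixes x :: "'k::field^'n^'n"
  shows "p_map m (x \<otimes>t i) =
    (if CHAR('k) * i \<le> m then (x [^]\<^bsub>Mat\<^esub> CHAR('k)) \<otimes>t (CHAR('k) * i) else 0)"
  by (simp add: p_map_def nat_pow_tensor_t mult.commute)

definition restricted_semisimple ::
    "('k::comm_ring_1 \<Rightarrow> 'v::ab_group_add \<Rightarrow> 'v) \<Rightarrow> ('v \<Rightarrow> 'v) \<Rightarrow> 'v \<Rightarrow> bool" where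
  "restricted_semisimple smul pm x \<longleftrightarrow> x \<in> module.span smul {(pm ^^ i) x | i. i > 0}"

end

theory Submission
  imports Defs
begin

text \<open>The conjugating element is built one power of \<open>t\<close> at a time. Write
  \<open>x = x\<^sub>0 + x\<^sub>1 t + \<dots>\<close>. Semisimplicity gives \<open>x = \<Sum> a\<^sub>i x\<^bsup>p^i\<^esup>\<close> with \<open>i > 0\<close>, hence the same
  equation for \<open>x\<^sub>0\<close>. Since \<open>ad (x\<^sub>0\<^bsup>p^i\<^esup>) = (ad x\<^sub>0)\<^bsup>p^i\<^esup>\<close>, the operator \<open>ad x\<^sub>0\<close> satisfies the separable
  equation \<open>T = \<Sum> a\<^sub>i T\<^bsup>p^i\<^esup>\<close>, so the Lie algebra is the sum of the image and the kernel of \<open>ad x\<^sub>0\<close>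
  (lemma \<open>ad_decomposition\<close>). Suppose \<open>x\<close> is already conjugated to
  \<open>x\<^sub>0 + v t\<^sup>k\<close> modulo \<open>t\<^bsup>k+1\<^esup>\<close>, and split \<open>v = [x\<^sub>0, y] + w\<close> with \<open>[x\<^sub>0, w] = 0\<close>. Conjugation by an
  element \<open>1 + y t\<^sup>k + \<dots>\<close> of the group of \<open>k[t]/(t\<^bsup>m+1\<^esup>)\<close>-points removes \<open>[x\<^sub>0, y]\<close>. The remaining
  \<open>x\<^sub>0 + w t\<^sup>k\<close> has commuting summands, so its \<open>p\<close>-th powers do not see \<open>w t\<^sup>k\<close> modulo \<open>t\<^bsup>k+1\<^esup>\<close>, and
  semisimplicity forces \<open>w = 0\<close> (lemmas \<open>semisimple_no_commuting_perturbation\<close> and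
  \<open>conjugation_step\<close>).

  The geometric input is the existence of these elements \<open>1 + y t\<^sup>k + \<dots>\<close>, which expresses the
  smoothness of \<open>G\<close>. By translation it suffices to find, for some point \<open>g\<close> of \<open>G\<close> and every tangent
  vector at \<open>g\<close>, an arc modulo \<open>t\<^sup>N\<close> in that direction. This holds at a generic point of any nonempty set \<open>V\<close> of
  points over an algebraically closed field of characteristic \<open>p\<close> (theorem \<open>generic_arcs\<close>), where \<open>V\<close>
  is considered with the ideal of all polynomials vanishing on it. To see this, fix \<open>q = p\<^sup>s \<ge> N\<close>. On
  an open part of \<open>V\<close> a set \<open>B\<close> of coordinates restricts to a basis of each cotangent space
  (\<open>generic_chart\<close>). Differentiating along tangent vectors shows that the monomials in these
  coordinates with exponents below \<open>q\<close> are independent over the \<open>q\<close>-th powers of functions on \<open>V\<close>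
  (\<open>independence_exponent\<close>); this is where it matters that a function on \<open>V\<close> with zero \<open>p\<close>-th
  power is zero. At a generic point \<open>a\<close> the independence survives reduction modulo the ideal generated by the
  \<open>q\<close>-th powers of the functions vanishing at \<open>a\<close> (\<open>generic_elimination\<close>), while by Nakayama's lemma the
  same monomials span. So the functions on \<open>V\<close> modulo this ideal form the truncated polynomial
  ring \<open>k[z\<^sub>b, b \<in> B]/(z\<^sub>b\<^sup>q)\<close>, and this ring has a homomorphism to \<open>k[t]/(t\<^sup>N)\<close> with arbitrary values \<open>z\<^sub>b \<mapsto> y\<^sub>b t\<close>.\<close>

section \<open>Polynomials, evaluation and differentials\<close>

definition ring_map :: "('a::comm_ring_1 \<Rightarrow> 'b::comm_ring_1) \<Rightarrow> bool" where
  "ring_map \<phi> \<longleftrightarrow> \<phi> 1 = 1 \<and> (\<forall>x y. \<phi> (x + y) = \<phi> x + \<phi> y) \<and> (\<forall>x y. \<phi> (x * y) = \<phi> x * \<phi> y)"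

lemma ring_mapD:
  assumes "ring_map \<phi>"
  shows ring_map_one: "\<phi> 1 = 1" and ring_map_add: "\<phi> (x + y) = \<phi> x + \<phi> y"
    and ring_map_mult: "\<phi> (x * y) = \<phi> x * \<phi> y" and ring_map_zero: "\<phi> 0 = 0"
    and ring_map_minus: "\<phi> (- x) = - \<phi> x" and ring_map_diff: "\<phi> (x - y) = \<phi> x - \<phi> y"
    and ring_map_power: "\<phi> (x ^ k) = \<phi> x ^ k"
    and ring_map_sum: "\<phi> (sum f A) = (\<Sum>i\<in>A. \<phi> (f i))"
    and ring_map_prod: "\<phi> (prod f A) = (\<Prod>i\<in>A. \<phi> (f i))"
proof -
  show a: "\<phi> (x + y) = \<phi> x + \<phi> y" and o: "\<phi> 1 = 1" and m: "\<phi> (x * y) = \<phi> x * \<phi> y" for x y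
    using assms by (auto simp: ring_map_def)
  show z: "\<phi> 0 = 0" using a[of 0 0] by simp
  show n: "\<phi> (- x) = - \<phi> x" for x
    using a[of "- x" x] z by (simp add: eq_neg_iff_add_eq_0)
  show "\<phi> (x - y) = \<phi> x - \<phi> y" using a[of x "- y"] n[of y] by simp
  show "\<phi> (x ^ k) = \<phi> x ^ k" by (induction k) (auto simp: o m)
  show "\<phi> (sum f A) = (\<Sum>i\<in>A. \<phi> (f i))"
    by (induction A rule: infinite_finite_induct) (auto simp: z a)
  show "\<phi> (prod f A) = (\<Prod>i\<in>A. \<phi> (f i))"
    by (induction A rule: infinite_finite_induct) (auto simp: o m)
qed

type_synonym ('v, 'k) mpoly = "('v \<Rightarrow>\<^sub>0 nat) \<Rightarrow>\<^sub>0 'k"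

definition peval :: "('k::comm_ring_1 \<Rightarrow> 'r::comm_ring_1) \<Rightarrow> ('v, 'k) mpoly \<Rightarrow> ('v \<Rightarrow> 'r) \<Rightarrow> 'r" where
  "peval \<phi> f a =
     (\<Sum>u\<in>Poly_Mapping.keys f. \<phi> (Poly_Mapping.lookup f u) *
        (\<Prod>v\<in>Poly_Mapping.keys u. a v ^ Poly_Mapping.lookup u v))"

definition Const :: "'k::comm_ring_1 \<Rightarrow> ('v, 'k) mpoly" where
  "Const c = Poly_Mapping.single 0 c"

definition Var :: "'v \<Rightarrow> ('v, 'k::comm_ring_1) mpoly" where
  "Var v = Poly_Mapping.single (Poly_Mapping.single v 1) 1"

lemma ring_map_Const: "ring_map Const"
  by (auto simp: ring_map_def Const_def single_add mult_single)

lemma poly_mapping_as_sum: "f = (\<Sum>u\<in>Poly_Mapping.keys f. Poly_Mapping.single u (Poly_Mapping.lookup f u))"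
proof (rule poly_mapping_eqI)
  fix k
  show "Poly_Mapping.lookup f k =
      Poly_Mapping.lookup (\<Sum>u\<in>Poly_Mapping.keys f. Poly_Mapping.single u (Poly_Mapping.lookup f u)) k"
    by (cases "k \<in> Poly_Mapping.keys f")
       (auto simp: lookup_sum lookup_single when_def sum.delta in_keys_iff)
qed

lemma single_exponent_as_prod:
  fixes u :: "'v \<Rightarrow>\<^sub>0 nat"
  shows "(Poly_Mapping.single u 1 :: ('v, 'k::comm_ring_1) mpoly) =
    (\<Prod>v\<in>Poly_Mapping.keys u. Var v ^ Poly_Mapping.lookup u v)"
proof -
  have pow: "(Var v :: ('v, 'k) mpoly) ^ n = Poly_Mapping.single (Poly_Mapping.single v n) 1" for v n
    by (induction n) (auto simp: Var_def mult_single simp flip: single_add)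
  have "(\<Prod>v\<in>A. Poly_Mapping.single (h v) (1::'k)) = Poly_Mapping.single (\<Sum>v\<in>A. h v) 1"
    if "finite A" for A and h :: "'v \<Rightarrow> 'v \<Rightarrow>\<^sub>0 nat"
    using that by (induction A rule: finite_induct) (auto simp: mult_single)
  then show ?thesis
    by (simp add: pow poly_mapping_as_sum[symmetric])
qed

text \<open>The polynomials in the variables from \<open>B\<close>. For \<open>B = UNIV\<close> these are all polynomials, which
  turns the induction rule of this set into the structural induction \<open>mpoly_induct\<close>. Multiplication
  is only by single variables so that inductive proofs have to deal with just one new factor.\<close>

inductive_set polys_in :: "'v set \<Rightarrow> ('v, 'k::comm_ring_1) mpoly set" for B where
  Const: "Const c \<in> polys_in B"
| add: "f \<in> polys_in B \<Longrightarrow> g \<in> polys_in B \<Longrightarrow> f + g \<in> polys_in B"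
| mult_Var: "f \<in> polys_in B \<Longrightarrow> v \<in> B \<Longrightarrow> f * Var v \<in> polys_in B"

lemma polys_in_mult:
  assumes "f \<in> polys_in B" "g \<in> polys_in B"
  shows "f * g \<in> polys_in B"
  using assms(2)
proof induction
  case (Const c)
  show ?case using assms(1)
  proof induction
    case (Const d)
    then show ?case
      using polys_in.Const[of "d * c"] by (simp add: ring_mapD[OF ring_map_Const])
  next
    case (add f g)
    then show ?case by (simp add: distrib_right polys_in.add)
  next
    case (mult_Var f v)
    then have "(f * Const c) * Var v \<in> polys_in B" by (intro polys_in.mult_Var)
    then show ?case by (simp add: mult_ac)
  qed
next
  case (add g h)
  then show ?case by (simp add: distrib_left polys_in.add)
next
  case (mult_Var g v)
  then have "(f * g) * Var v \<in> polys_in B" by (intro polys_in.mult_Var)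
  then show ?case by (simp add: mult_ac)
qed

lemma polys_in_Var: "v \<in> B \<Longrightarrow> Var v \<in> polys_in B"
  using polys_in.mult_Var[OF polys_in.Const[of 1]] by (simp add: ring_map_one[OF ring_map_Const])

lemma polys_in_UNIV: "(f :: ('v, 'k::comm_ring_1) mpoly) \<in> polys_in UNIV"
proof -
  have one: "(1 :: ('v, 'k) mpoly) \<in> polys_in UNIV" and zero: "(0 :: ('v, 'k) mpoly) \<in> polys_in UNIV"
    using polys_in.Const[of 1] polys_in.Const[of 0] by (simp_all add: ring_mapD[OF ring_map_Const])
  have pow: "(Var v :: ('v, 'k) mpoly) ^ n \<in> polys_in UNIV" for v n
    by (induction n) (auto intro: one polys_in_mult polys_in_Var)
  have "(Poly_Mapping.single u 1 :: ('v, 'k) mpoly) \<in> polys_in UNIV" for u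
    unfolding single_exponent_as_prod
    by (rule finite_induct[OF finite_keys]) (auto intro: one polys_in_mult pow)
  then have "Const c * Poly_Mapping.single u 1 \<in> polys_in UNIV" for u :: "'v \<Rightarrow>\<^sub>0 nat" and c :: 'k
    by (intro polys_in_mult polys_in.Const)
  then have "Poly_Mapping.single u c \<in> polys_in UNIV" for u :: "'v \<Rightarrow>\<^sub>0 nat" and c :: 'k
    by (simp add: Const_def mult_single)
  then have "(\<Sum>u\<in>A. Poly_Mapping.single u (Poly_Mapping.lookup f u)) \<in> polys_in UNIV" for A
    by (induction A rule: infinite_finite_induct) (auto intro: zero polys_in.add)
  then show ?thesis
    by (subst poly_mapping_as_sum) auto
qed

lemma mpoly_induct [case_names Const add mult_Var]:
  fixes f :: "('v, 'k::comm_ring_1) mpoly"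
  assumes "\<And>c. P (Const c)"
    and "\<And>f g. P f \<Longrightarrow> P g \<Longrightarrow> P (f + g)"
    and "\<And>f v. P f \<Longrightarrow> P (f * Var v)"
  shows "P f"
  using polys_in_UNIV[of f] by induction (auto intro: assms)

lemma peval_superset:
  assumes "ring_map \<phi>" "finite A" "Poly_Mapping.keys f \<subseteq> A"
  shows "peval \<phi> f a = (\<Sum>u\<in>A. \<phi> (Poly_Mapping.lookup f u) *
        (\<Prod>v\<in>Poly_Mapping.keys u. a v ^ Poly_Mapping.lookup u v))"
  unfolding peval_def using assms
  by (intro sum.mono_neutral_left) (auto simp: in_keys_iff ring_map_zero)

lemma peval_add:
  assumes "ring_map \<phi>"
  shows "peval \<phi> (f + g) a = peval \<phi> f a + peval \<phi> g a"
proof -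
  let ?A = "Poly_Mapping.keys f \<union> Poly_Mapping.keys g"
  show ?thesis
    using peval_superset[OF assms, of ?A f] peval_superset[OF assms, of ?A g]
      peval_superset[OF assms, of ?A "f + g"] keys_add[of f g]
    by (simp add: lookup_add ring_map_add[OF assms] distrib_right sum.distrib)
qed

lemma peval_Const: "ring_map \<phi> \<Longrightarrow> peval \<phi> (Const c) a = \<phi> c"
  by (subst peval_superset[where A = "{0}"]) (auto simp: Const_def)

lemma peval_zero: "peval \<phi> 0 a = 0"
  by (simp add: peval_def)

lemma peval_sum: "ring_map \<phi> \<Longrightarrow> peval \<phi> (sum h A) a = (\<Sum>i\<in>A. peval \<phi> (h i) a)"
  by (induction A rule: infinite_finite_induct) (auto simp: peval_add peval_zero)

lemma peval_mult_Var:
  fixes f :: "('v, 'k::comm_ring_1) mpoly"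
  assumes "ring_map \<phi>"
  shows "peval \<phi> (f * Var w) a = peval \<phi> f a * a w"
proof -
  define m where "m u = (\<Prod>v\<in>Poly_Mapping.keys u. a v ^ Poly_Mapping.lookup u v)" for u
  have m_sup: "m u = (\<Prod>v\<in>A. a v ^ Poly_Mapping.lookup u v)"
    if "finite A" "Poly_Mapping.keys u \<subseteq> A" for u A
    unfolding m_def using that by (intro prod.mono_neutral_left) (auto simp: in_keys_iff)
  have m_single: "m (u + Poly_Mapping.single w 1) = m u * a w" for u
  proof -
    let ?A = "insert w (Poly_Mapping.keys u)"
    have "Poly_Mapping.keys (u + Poly_Mapping.single w 1) \<subseteq> ?A"
      using keys_add[of u "Poly_Mapping.single w (1::nat)"] by auto
    then have "m (u + Poly_Mapping.single w 1)
        = (\<Prod>v\<in>?A. a v ^ Poly_Mapping.lookup u v * a v ^ (1 when w = v))"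
      by (subst m_sup[of ?A]) (auto simp: lookup_add lookup_single power_add)
    also have "\<dots> = m u * (\<Prod>v\<in>?A. a v ^ (1 when w = v))"
      by (subst m_sup[of ?A]) (auto simp: prod.distrib)
    also have "(\<Prod>v\<in>?A. a v ^ (1 when w = v)) = (\<Prod>v\<in>?A. if w = v then a v else 1)"
      by (intro prod.cong) (auto simp: when_def)
    also have "\<dots> = a w"
      by (subst prod.delta') auto
    finally show ?thesis .
  qed
  have single: "peval \<phi> (Poly_Mapping.single u c) a = \<phi> c * m u" for u c
    by (subst peval_superset[OF assms, where A = "{u}"]) (auto simp: m_def)
  have "peval \<phi> (Poly_Mapping.single u c * Var w) a = peval \<phi> (Poly_Mapping.single u c) a * a w" for u c
    by (simp add: Var_def mult_single single m_single mult_ac flip: One_nat_def)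
  then have "peval \<phi> ((\<Sum>u\<in>A. Poly_Mapping.single u (h u)) * Var w) a
      = peval \<phi> (\<Sum>u\<in>A. Poly_Mapping.single u (h u)) a * a w"
      for h and A :: "('v \<Rightarrow>\<^sub>0 nat) set"
    by (simp add: sum_distrib_right peval_sum[OF assms])
  from this[of "Poly_Mapping.lookup f" "Poly_Mapping.keys f"] show ?thesis
    unfolding poly_mapping_as_sum[of f, symmetric] .
qed

lemma peval_mult:
  assumes "ring_map \<phi>"
  shows "peval \<phi> (f * g) a = peval \<phi> f a * peval \<phi> g a"
proof (induction g rule: mpoly_induct)
  case (Const c)
  show ?case
  proof (induction f rule: mpoly_induct)
    case (Const d)
    show ?case
      using peval_Const[OF assms, of "d * c" a]
      by (simp add: ring_mapD[OF ring_map_Const] peval_Const[OF assms] ring_map_mult[OF assms])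
  next
    case (mult_Var f v)
    have "peval \<phi> (f * Var v * Const c) a = peval \<phi> (f * Const c * Var v) a" by (simp add: mult_ac)
    also have "\<dots> = peval \<phi> (f * Var v) a * peval \<phi> (Const c) a"
      unfolding peval_mult_Var[OF assms] mult_Var by (simp add: mult_ac)
    finally show ?case .
  qed (simp add: peval_add[OF assms] distrib_right)
next
  case (mult_Var g v)
  have "peval \<phi> (f * (g * Var v)) a = peval \<phi> (f * g * Var v) a" by (simp add: mult_ac)
  also have "\<dots> = peval \<phi> f a * peval \<phi> (g * Var v) a"
    unfolding peval_mult_Var[OF assms] mult_Var by (simp add: mult_ac)
  finally show ?case .
qed (simp add: peval_add[OF assms] distrib_left)

lemma ring_map_peval: "ring_map \<phi> \<Longrightarrow> ring_map (\<lambda>f. peval \<phi> f a)"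
  using peval_Const[of \<phi> 1 a]
  by (auto simp: ring_map_def[of "\<lambda>f. peval \<phi> f a"] peval_add peval_mult
      ring_map_one[OF ring_map_Const] ring_map_one)

lemma peval_one: "ring_map \<phi> \<Longrightarrow> peval \<phi> 1 a = 1"
  by (rule ring_map_one[OF ring_map_peval])

lemma peval_minus: "ring_map \<phi> \<Longrightarrow> peval \<phi> (- f) a = - peval \<phi> f a"
  by (rule ring_map_minus[OF ring_map_peval])

lemma peval_diff: "ring_map \<phi> \<Longrightarrow> peval \<phi> (f - g) a = peval \<phi> f a - peval \<phi> g a"
  by (rule ring_map_diff[OF ring_map_peval])

lemma peval_power: "ring_map \<phi> \<Longrightarrow> peval \<phi> (f ^ n) a = peval \<phi> f a ^ n"
  by (rule ring_map_power[OF ring_map_peval])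

lemma peval_prod: "ring_map \<phi> \<Longrightarrow> peval \<phi> (prod h A) a = (\<Prod>i\<in>A. peval \<phi> (h i) a)"
  by (rule ring_map_prod[OF ring_map_peval])

lemma peval_Var: "ring_map \<phi> \<Longrightarrow> peval \<phi> (Var v) a = a v"
  using peval_mult_Var[of \<phi> 1 v a] ring_map_one[OF ring_map_peval, of \<phi> a] by simp

text \<open>Evaluation commutes with change of the target ring. Applied to \<open>\<psi> = peval \<dots>\<close> this is the rule
  for substitution, and applied to the coefficient maps of polynomial rings it extracts coefficients.\<close>

lemma ring_map_comp_peval:
  "ring_map \<psi> \<Longrightarrow> \<psi> (peval \<phi> f a) = peval (\<lambda>c. \<psi> (\<phi> c)) f (\<lambda>v. \<psi> (a v))"
  by (simp add: peval_def ring_mapD)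

lemma ring_map_id: "ring_map (\<lambda>c. c)"
  by (simp add: ring_map_def)

lemma ring_map_const_poly: "ring_map (\<lambda>c. [:c:])"
  by (simp add: ring_map_def)

lemma ring_map_compose: "ring_map \<psi> \<Longrightarrow> ring_map \<phi> \<Longrightarrow> ring_map (\<lambda>c. \<psi> (\<phi> c))"
  by (simp add: ring_map_def)

lemma peval_Const_Var: "peval Const f Var = f"
  by (induction f rule: mpoly_induct)
     (auto simp: peval_Const peval_add peval_mult_Var ring_map_Const)

lemma peval_subst:
  "ring_map \<phi> \<Longrightarrow> peval \<phi> (peval Const f P) a = peval \<phi> f (\<lambda>v. peval \<phi> (P v) a)"
  using ring_map_comp_peval[OF ring_map_peval, of \<phi> Const f P a]
  by (simp add: peval_Const)

text \<open>The coefficient of \<open>\<epsilon>\<close> when the variable \<open>w\<close> is replaced by \<open>w + \<epsilon>\<close>.\<close>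

definition pd :: "'v \<Rightarrow> ('v, 'k::comm_ring_1) mpoly \<Rightarrow> ('v, 'k) mpoly" where
  "pd w f = coeff (peval (\<lambda>c. [:Const c:]) f (\<lambda>v. [:Var v, if v = w then 1 else 0:])) 1"

lemma ring_map_coeff_0: "ring_map (\<lambda>p. coeff p 0)"
  by (simp add: ring_map_def coeff_mult_0)

lemma coeff_mult_1: "coeff (p * q) 1 = coeff p 0 * coeff q 1 + coeff p 1 * coeff q (0::nat)"
  by (simp add: coeff_mult)

lemma ring_map_Const_poly: "ring_map (\<lambda>c. [:Const c:])"
  by (rule ring_map_compose[OF ring_map_const_poly ring_map_Const])

lemma pd_Const: "pd w (Const c) = 0"
  by (simp add: pd_def peval_Const ring_map_Const_poly)

lemma pd_add: "pd w (f + g) = pd w f + pd w g"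
  by (simp add: pd_def peval_add ring_map_Const_poly)

lemma pd_mult:
  fixes f g :: "('v, 'k::comm_ring_1) mpoly"
  shows "pd w (f * g) = f * pd w g + pd w f * g"
proof -
  have "coeff (peval (\<lambda>c. [:Const c:]) f (\<lambda>v. [:Var v, if v = w then 1 else 0:])) 0 = f"
    for f :: "('v, 'k) mpoly"
    by (simp add: ring_map_comp_peval[OF ring_map_coeff_0] peval_Const_Var flip: One_nat_def)
  then show ?thesis
    by (simp add: pd_def peval_mult ring_map_Const_poly coeff_mult_1 del: One_nat_def)
qed

lemma pd_Var: "pd w (Var v) = (if v = w then 1 else 0)"
  by (simp add: pd_def peval_Var ring_map_Const_poly)

definition differential ::
    "('k::comm_ring_1 \<Rightarrow> 'r::comm_ring_1) \<Rightarrow> ('v::finite, 'k) mpoly \<Rightarrow> ('v \<Rightarrow> 'r) \<Rightarrow> ('v \<Rightarrow> 'r) \<Rightarrow> 'r" where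
  "differential \<phi> f a x = (\<Sum>v\<in>UNIV. peval \<phi> (pd v f) a * x v)"

context
  fixes \<phi> :: "'k::comm_ring_1 \<Rightarrow> 'r::comm_ring_1"
  assumes \<phi>: "ring_map \<phi>"
begin

lemma differential_Const: "differential \<phi> (Const c) a x = 0"
  by (simp add: differential_def pd_Const peval_zero)

lemma differential_add: "differential \<phi> (f + g) a x = differential \<phi> f a x + differential \<phi> g a x"
  by (simp add: differential_def pd_add peval_add \<phi> distrib_right sum.distrib)

lemma differential_mult:
  "differential \<phi> (f * g) a x = peval \<phi> f a * differential \<phi> g a x + differential \<phi> f a x * peval \<phi> g a"
  by (simp add: differential_def pd_mult peval_add peval_mult \<phi> distrib_left distrib_right sum.distrib
      sum_distrib_left sum_distrib_right mult_ac)

lemma differential_Var: "differential \<phi> (Var v) a x = x v"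
proof -
  have "peval \<phi> (pd w (Var v)) a * x w = (if v = w then x w else 0)" for w
    by (auto simp: pd_Var peval_one \<phi> peval_zero)
  then show ?thesis by (simp add: differential_def)
qed

end

lemma differential_linear_add: "differential \<phi> f a (\<lambda>v. x v + y v) = differential \<phi> f a x + differential \<phi> f a y"
  by (simp add: differential_def distrib_left sum.distrib)

lemma differential_linear_mult: "differential \<phi> f a (\<lambda>v. c * x v) = c * differential \<phi> f a x"
  by (simp add: differential_def sum_distrib_left mult_ac)

lemma differential_linear_sum:
  "differential \<phi> f a (\<lambda>v. \<Sum>i\<in>A. x i v) = (\<Sum>i\<in>A. differential \<phi> f a (x i))"
  unfolding differential_def sum_distrib_left by (rule sum.swap)

definition is_ideal :: "'r::comm_ring_1 set \<Rightarrow> bool" where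
  "is_ideal J \<longleftrightarrow> 0 \<in> J \<and> (\<forall>x\<in>J. \<forall>y\<in>J. x + y \<in> J) \<and> (\<forall>x\<in>J. \<forall>r. r * x \<in> J)"

lemma is_idealD:
  assumes "is_ideal J"
  shows is_ideal_0: "0 \<in> J" and is_ideal_add: "\<And>x y. x \<in> J \<Longrightarrow> y \<in> J \<Longrightarrow> x + y \<in> J"
    and is_ideal_mult_left: "\<And>x r. x \<in> J \<Longrightarrow> r * x \<in> J" and is_ideal_mult_right: "\<And>x r. x \<in> J \<Longrightarrow> x * r \<in> J"
    and is_ideal_minus: "\<And>x. x \<in> J \<Longrightarrow> - x \<in> J" and is_ideal_diff: "\<And>x y. x \<in> J \<Longrightarrow> y \<in> J \<Longrightarrow> x - y \<in> J"
    and is_ideal_sum: "\<And>f A. (\<And>i. i \<in> A \<Longrightarrow> f i \<in> J) \<Longrightarrow> sum f A \<in> J"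
proof -
  show z: "0 \<in> J" and a: "\<And>x y. x \<in> J \<Longrightarrow> y \<in> J \<Longrightarrow> x + y \<in> J"
    and m: "\<And>x r. x \<in> J \<Longrightarrow> r * x \<in> J"
    using assms by (auto simp: is_ideal_def)
  show "\<And>x r. x \<in> J \<Longrightarrow> x * r \<in> J" using m by (simp add: mult.commute)
  show n: "\<And>x. x \<in> J \<Longrightarrow> - x \<in> J" using m[of _ "-1"] by simp
  show "\<And>x y. x \<in> J \<Longrightarrow> y \<in> J \<Longrightarrow> x - y \<in> J" using a n by (metis add_uminus_conv_diff)
  show "sum f A \<in> J" if "\<And>i. i \<in> A \<Longrightarrow> f i \<in> J" for f :: "'x \<Rightarrow> 'a" and A
    using that by (induction A rule: infinite_finite_induct) (auto intro: z a)
qed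

lemma is_ideal_multiples: "is_ideal {x. (d::'r::comm_ring_1) dvd x}"
  by (auto simp: is_ideal_def)

text \<open>The error of the linear approximation is a combination of products of two entries of the
  increment. The ideal is arbitrary, as the lemma serves both for the multiples of \<open>t\<^sup>2\<close> and for the
  square of a maximal ideal.\<close>

lemma taylor_mod_ideal:
  fixes a x :: "'v::finite \<Rightarrow> 'r::comm_ring_1"
  assumes \<phi>: "ring_map \<phi>" and J: "is_ideal J" and sq: "\<And>v w. x v * x w \<in> J"
  shows "peval \<phi> f (\<lambda>v. a v + x v) - peval \<phi> f a - differential \<phi> f a x \<in> J"
proof (induction f rule: mpoly_induct)
  case (Const c)
  then show ?case by (simp add: peval_Const differential_Const \<phi> is_ideal_0[OF J])
next
  case (add f g)
  show ?case using is_ideal_add[OF J add]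
    by (simp add: peval_add differential_add \<phi> algebra_simps)
next
  case (mult_Var f w)
  let ?b = "\<lambda>v. a v + x v"
  let ?e = "peval \<phi> f ?b - peval \<phi> f a - differential \<phi> f a x"
  have "differential \<phi> f a x * x w \<in> J"
    unfolding differential_def sum_distrib_right mult.assoc
    by (intro is_ideal_sum[OF J] is_ideal_mult_left[OF J] sq)
  with is_ideal_mult_right[OF J mult_Var] have "?e * (a w + x w) + differential \<phi> f a x * x w \<in> J"
    by (intro is_ideal_add[OF J])
  then show ?case
    by (simp add: peval_mult_Var differential_mult peval_Var differential_Var \<phi> algebra_simps)
qed

lemma peval_cong_mod_ideal:
  assumes \<phi>: "ring_map \<phi>" and J: "is_ideal J" and "\<And>v. a v - b v \<in> J"
  shows "peval \<phi> f a - peval \<phi> f b \<in> J"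
proof (induction f rule: mpoly_induct)
  case (Const c)
  then show ?case by (simp add: peval_Const \<phi> is_ideal_0[OF J])
next
  case (add f g)
  show ?case using is_ideal_add[OF J add]
    by (simp add: peval_add \<phi> algebra_simps)
next
  case (mult_Var f w)
  have "(peval \<phi> f a - peval \<phi> f b) * a w + peval \<phi> f b * (a w - b w) \<in> J"
    using assms mult_Var by (intro is_ideal_add[OF J] is_ideal_mult_right[OF J mult_Var] is_ideal_mult_left[OF J]) auto
  then show ?case
    by (simp add: peval_mult_Var \<phi> algebra_simps)
qed

lemma CHAR_mpoly: "CHAR(('v, 'k::comm_ring_1) mpoly) = CHAR('k)"
proof (rule CHAR_eqI)
  have "of_nat n = (0 :: ('v, 'k) mpoly) \<longleftrightarrow> of_nat n = (0 :: 'k)" for n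
  proof
    assume "of_nat n = (0 :: ('v, 'k) mpoly)"
    then have "Poly_Mapping.lookup (of_nat n :: ('v, 'k) mpoly) 0 = 0" by simp
    then show "of_nat n = (0 :: 'k)" by (simp add: lookup_of_nat)
  next
    assume "of_nat n = (0 :: 'k)"
    then have "Poly_Mapping.single (0 :: 'v \<Rightarrow>\<^sub>0 nat) (of_nat n :: 'k) = 0" by simp
    then show "of_nat n = (0 :: ('v, 'k) mpoly)" by (simp only: single_of_nat)
  qed
  then show "of_nat CHAR('k) = (0 :: ('v, 'k) mpoly)" "\<And>n. of_nat n = (0 :: ('v, 'k) mpoly) \<Longrightarrow> CHAR('k) dvd n"
    by (simp_all add: of_nat_eq_0_iff_char_dvd)
qed

section \<open>Tangent spaces at generic points\<close>

abbreviation pev :: "('v, 'k::comm_ring_1) mpoly \<Rightarrow> ('v \<Rightarrow> 'k) \<Rightarrow> 'k" where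
  "pev \<equiv> peval (\<lambda>c. c)"

abbreviation pev_t :: "('v, 'k::comm_ring_1) mpoly \<Rightarrow> ('v \<Rightarrow> 'k poly) \<Rightarrow> 'k poly" where
  "pev_t \<equiv> peval (\<lambda>c. [:c:])"

abbreviation diff_at :: "('v::finite, 'k::comm_ring_1) mpoly \<Rightarrow> ('v \<Rightarrow> 'k) \<Rightarrow> ('v \<Rightarrow> 'k) \<Rightarrow> 'k" where
  "diff_at \<equiv> differential (\<lambda>c. c)"

lemmas pev_simps = peval_Const[OF ring_map_id] peval_add[OF ring_map_id] peval_mult[OF ring_map_id]
  peval_zero peval_one[OF ring_map_id] peval_minus[OF ring_map_id] peval_diff[OF ring_map_id]
  peval_power[OF ring_map_id] peval_sum[OF ring_map_id] peval_prod[OF ring_map_id] peval_Var[OF ring_map_id]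

lemmas diff_at_simps = differential_Const[OF ring_map_id] differential_add[OF ring_map_id]
  differential_mult[OF ring_map_id] differential_Var[OF ring_map_id]

definition ideal_of :: "('v \<Rightarrow> 'k::field) set \<Rightarrow> ('v, 'k) mpoly set" where
  "ideal_of V = {f. \<forall>a\<in>V. pev f a = 0}"

lemma is_ideal_ideal_of: "is_ideal (ideal_of V)"
  by (auto simp: is_ideal_def ideal_of_def pev_simps)

text \<open>The Zariski tangent space of the closure of \<open>V\<close> with its reduced structure.\<close>

definition tangent :: "('v::finite \<Rightarrow> 'k::field) set \<Rightarrow> ('v \<Rightarrow> 'k) \<Rightarrow> ('v \<Rightarrow> 'k) set" where
  "tangent V a = {x. \<forall>f\<in>ideal_of V. diff_at f a x = 0}"

lemma pd_zero: "pd w 0 = 0"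
  using pd_Const[of w 0] by (simp add: ring_map_zero[OF ring_map_Const])

lemma pd_sum: "pd w (sum f A) = (\<Sum>i\<in>A. pd w (f i))"
  by (induction A rule: infinite_finite_induct) (auto simp: pd_add pd_zero)

lemma pd_Const_mult: "pd w (Const c * f) = Const c * pd w f"
  by (simp add: pd_mult pd_Const)

lemma pd_diff: "pd w (f - g) = pd w f - pd w g"
  using pd_add[of w "f - g" g] by simp

lemma pev_det:
  fixes M :: "('v::finite, 'k::comm_ring_1) mpoly^'m^'m"
  shows "pev (det M) a = det (\<chi> i j. pev (M $ i $ j) a)"
proof -
  have "pev (of_int (sign p)) a = of_int (sign p)" for p :: "'m \<Rightarrow> 'm"
    by (cases p rule: sign_cases) (simp_all add: pev_simps)
  then show ?thesis
    by (simp add: det_def pev_simps)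
qed

definition jacobian_unit :: "('v::finite \<Rightarrow> 'k::field) set \<Rightarrow> ('v \<Rightarrow> ('v, 'k) mpoly) \<Rightarrow> 'v set \<Rightarrow> ('v \<Rightarrow> 'k) \<Rightarrow> bool" where
  "jacobian_unit V F C a \<longleftrightarrow>
     (\<forall>c\<in>C. F c \<in> ideal_of V \<and> (\<forall>c'\<in>C. pev (pd c' (F c)) a = (if c' = c then 1 else 0)))"

text \<open>On an open part \<open>D \<noteq> 0\<close> of \<open>V\<close> the variables in \<open>B\<close> are coordinates of all tangent spaces, and
  every other variable is, to first order, a function of them modulo the ideal of \<open>V\<close>. The complement
  \<open>C\<close> of \<open>B\<close> is a largest set of variables for which some Jacobian matrix of polynomials vanishing on
  \<open>V\<close> is invertible at some point of \<open>V\<close>; the determinant \<open>D\<close> of this Jacobian keeps it invertible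
  nearby. By maximality, wherever it is invertible the differential of a polynomial vanishing on \<open>V\<close> is
  determined by its entries in \<open>C\<close>, and this makes the tangent space a graph over the variables in
  \<open>B\<close>.\<close>

lemma generic_chart:
  fixes V :: "('v::finite \<Rightarrow> 'k::field) set"
  assumes "V \<noteq> {}"
  obtains B D a0 where "a0 \<in> V" "pev D a0 \<noteq> 0"
    "\<And>a b. a \<in> V \<Longrightarrow> pev D a \<noteq> 0 \<Longrightarrow> b \<in> B \<Longrightarrow>
       \<exists>x\<in>tangent V a. \<forall>b'\<in>B. x b' = (if b' = b then 1 else 0)"
    "\<And>a c. a \<in> V \<Longrightarrow> pev D a \<noteq> 0 \<Longrightarrow> c \<notin> B \<Longrightarrow>
       \<exists>f\<in>ideal_of V. \<forall>v. v \<notin> B \<longrightarrow> pev (pd v f) a = (if v = c then 1 else 0)"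
proof -
  note I = is_idealD[OF is_ideal_ideal_of[of V]]
  define P where "P = (\<lambda>(a, C). a \<in> V \<and> (\<exists>F. jacobian_unit V F C a))"
  obtain a1 where "a1 \<in> V" using assms by auto
  then have "P (a1, {})" by (auto simp: P_def jacobian_unit_def)
  moreover have "card (snd y) < Suc CARD('v)" for y :: "('v \<Rightarrow> 'k) \<times> 'v set"
    by (simp add: less_Suc_eq_le card_mono)
  ultimately obtain y where y: "P y" "\<And>z. P z \<Longrightarrow> card (snd z) \<le> card (snd y)"
    using ex_has_greatest_nat[of P "(a1, {})" "\<lambda>y. card (snd y)" "Suc CARD('v)"] by (metis less_imp_le)
  obtain a0 C where "y = (a0, C)" by (cases y)
  with y have a0: "a0 \<in> V" and "\<exists>F. jacobian_unit V F C a0"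
    and C_max: "\<And>a C' F. a \<in> V \<Longrightarrow> jacobian_unit V F C' a \<Longrightarrow> card C' \<le> card C"
    by (force simp: P_def)+
  then obtain F where F: "jacobian_unit V F C a0" by blast
  \<comment> \<open>The Jacobian minor for \<open>C\<close>, padded by an identity block to a matrix indexed by all variables.\<close>
  define M where "M = (\<chi> v w. if v \<in> C \<and> w \<in> C then pd w (F v) else if v = w then 1 else 0)"
  define N where "N a = (\<chi> v w. pev (M $ v $ w) a)" for a
  have det_N: "pev (det M) a = det (N a)" for a
    by (simp add: pev_det N_def)
  have "N a0 = mat 1"
    using F by (auto simp: N_def M_def mat_def vec_eq_iff jacobian_unit_def pev_simps)
  then have D: "pev (det M) a0 \<noteq> 0"
    by (simp add: det_N)
  have key: "\<exists>F'. jacobian_unit V F' C a \<and>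
      (\<forall>f\<in>ideal_of V. (\<forall>c\<in>C. pev (pd c f) a = 0) \<longrightarrow> (\<forall>w. pev (pd w f) a = 0))"
    if a: "a \<in> V" and Da: "pev (det M) a \<noteq> 0" for a
  proof -
    have "invertible (N a)"
      using Da by (simp add: det_N invertible_det_nz)
    then obtain N' where N': "N' ** N a = mat 1"
      by (auto simp: invertible_def)
    define F' where "F' c = (\<Sum>c'\<in>C. Const (N' $ c $ c') * F c')" for c
    have "pev (pd w (F' c)) a = (if w = c then 1 else 0)" if "c \<in> C" "w \<in> C" for c w
    proof -
      have "pev (pd w (F' c)) a = (\<Sum>c'\<in>C. N' $ c $ c' * pev (pd w (F c')) a)"
        by (simp add: F'_def pd_sum pd_Const_mult pev_simps)
      also have "\<dots> = (\<Sum>c'\<in>UNIV. N' $ c $ c' * N a $ c' $ w)"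
        by (rule sum.mono_neutral_cong_left) (use that in \<open>auto simp: N_def M_def pev_simps\<close>)
      also have "\<dots> = (N' ** N a) $ c $ w"
        by (simp add: matrix_matrix_mult_def)
      finally show ?thesis
        by (auto simp: N' mat_def)
    qed
    moreover have "F' c \<in> ideal_of V" if "c \<in> C" for c
      unfolding F'_def using F by (intro I) (auto simp: jacobian_unit_def)
    ultimately have F': "jacobian_unit V F' C a"
      by (auto simp: jacobian_unit_def)
    have "pev (pd w f) a = 0"
      if f: "f \<in> ideal_of V" "\<forall>c\<in>C. pev (pd c f) a = 0" for f w
    proof (rule ccontr)
      assume nz: "pev (pd w f) a \<noteq> 0"
      with f have w: "w \<notin> C" by auto
      \<comment> \<open>A vanishing polynomial that is not determined by \<open>C\<close> would allow to enlarge \<open>C\<close> by \<open>w\<close>.\<close>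
      define h where "h = Const (inverse (pev (pd w f) a)) * f"
      define F'' where "F'' c = (if c = w then h else F' c - Const (pev (pd w (F' c)) a) * h)" for c
      have h: "h \<in> ideal_of V"
        unfolding h_def by (intro I f)
      have "pev (pd c h) a = (if c = w then 1 else 0)" if "c \<in> insert w C" for c
        using f that nz by (auto simp: h_def pd_Const_mult pev_simps)
      then have "jacobian_unit V F'' (insert w C) a"
        using F' h w
        by (auto simp: jacobian_unit_def F''_def pd_diff pd_Const_mult pev_simps intro!: I(6) I(3))
      from C_max[OF a this] w show False by simp
    qed
    with F' show ?thesis by blast
  qed
  show ?thesis
  proof (rule that[of a0 "det M" "- C"])
    show "a0 \<in> V" "pev (det M) a0 \<noteq> 0" by fact+
  next
    fix a b
    assume a: "a \<in> V" "pev (det M) a \<noteq> 0" and b: "b \<in> - C"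
    obtain F' where F': "jacobian_unit V F' C a"
      and inj: "\<And>f w. f \<in> ideal_of V \<Longrightarrow> \<forall>c\<in>C. pev (pd c f) a = 0 \<Longrightarrow> pev (pd w f) a = 0"
      using key[OF a] by blast
    \<comment> \<open>The tangent vector over the coordinate direction \<open>b\<close>, solved from the linear equations \<open>dF' c = 0\<close>.\<close>
    define x where "x v = (if v \<in> C then - pev (pd b (F' v)) a else if v = b then 1 else 0)" for v
    have "diff_at f a x = 0" if f: "f \<in> ideal_of V" for f
    proof -
      define h where "h = f - (\<Sum>c\<in>C. Const (pev (pd c f) a) * F' c)"
      have "h \<in> ideal_of V"
        unfolding h_def using F' by (intro I f) (auto simp: jacobian_unit_def)
      moreover have "pev (pd c h) a = 0" if "c \<in> C" for c
      proof -
        have "(\<Sum>c'\<in>C. pev (pd c' f) a * pev (pd c (F' c')) a) = (\<Sum>c'\<in>C. if c' = c then pev (pd c f) a else 0)"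
          using F' that by (intro sum.cong) (auto simp: jacobian_unit_def)
        then show ?thesis using that
          by (simp add: h_def pd_diff pd_sum pd_Const_mult pev_simps)
      qed
      ultimately have "pev (pd b h) a = 0" using inj by blast
      then have "pev (pd b f) a = (\<Sum>c\<in>C. pev (pd c f) a * pev (pd b (F' c)) a)"
        by (simp add: h_def pd_diff pd_sum pd_Const_mult pev_simps)
      moreover have "diff_at f a x = (\<Sum>v\<in>C. pev (pd v f) a * x v) + (\<Sum>v\<in>-C. pev (pd v f) a * x v)"
        unfolding differential_def
        by (subst sum.union_disjoint[symmetric]) auto
      moreover have "(\<Sum>v\<in>-C. pev (pd v f) a * x v) = (\<Sum>v\<in>-C. if v = b then pev (pd b f) a else 0)"
        by (intro sum.cong) (auto simp: x_def)
      moreover have "(\<Sum>v\<in>C. pev (pd v f) a * x v) = - (\<Sum>v\<in>C. pev (pd v f) a * pev (pd b (F' v)) a)"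
        by (simp add: x_def sum_negf)
      ultimately show ?thesis using b by simp
    qed
    then have "x \<in> tangent V a" by (simp add: tangent_def)
    moreover have "\<forall>b'\<in>-C. x b' = (if b' = b then 1 else 0)" by (simp add: x_def)
    ultimately show "\<exists>x\<in>tangent V a. \<forall>b'\<in>-C. x b' = (if b' = b then 1 else 0)" by blast
  next
    fix a c
    assume a: "a \<in> V" "pev (det M) a \<noteq> 0" and c: "c \<notin> - C"
    obtain F' where "jacobian_unit V F' C a"
      using key[OF a] by blast
    with c show "\<exists>f\<in>ideal_of V. \<forall>v. v \<notin> - C \<longrightarrow> pev (pd v f) a = (if v = c then 1 else 0)"
      by (intro bexI[of _ "F' c"]) (auto simp: jacobian_unit_def)
  qed
qed

section \<open>Independence of monomials over q-th powers\<close>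

text \<open>The exponents of the monomials in the variables from \<open>B\<close> that are reduced modulo \<open>q\<close>-th powers of
  the variables.\<close>

definition Exps :: "nat \<Rightarrow> 'v set \<Rightarrow> ('v \<Rightarrow> nat) set" where
  "Exps q B = {u. (\<forall>v\<in>B. u v < q) \<and> (\<forall>v. v \<notin> B \<longrightarrow> u v = 0)}"

definition mon :: "('v::finite \<Rightarrow> nat) \<Rightarrow> ('v \<Rightarrow> 'r::comm_ring_1) \<Rightarrow> 'r" where
  "mon u a = (\<Prod>v\<in>UNIV. a v ^ u v)"

lemma finite_Exps: "finite (Exps q B :: ('v::finite \<Rightarrow> nat) set)"
proof (rule finite_subset)
  show "Exps q B \<subseteq> (\<Pi>\<^sub>E v\<in>UNIV. {..q})"
    by (auto simp: Exps_def PiE_def Pi_def) (metis less_imp_le_nat le0)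
qed (simp add: finite_PiE)

lemma Exps_less: "0 < q \<Longrightarrow> u \<in> Exps q B \<Longrightarrow> u v < q"
  by (cases "v \<in> B") (auto simp: Exps_def)

lemma peval_mon: "ring_map \<phi> \<Longrightarrow> peval \<phi> (mon u Var) a = mon u a"
  by (simp add: mon_def peval_prod peval_power peval_Var)

lemma mon_add: "mon (\<lambda>v. u v + w v) a = mon u a * mon w a"
  by (simp add: mon_def power_add prod.distrib)

lemma mon_scale: "mon (\<lambda>v. n * u v) a = mon u a ^ n"
  by (simp add: mon_def prod_power_distrib mult.commute flip: power_mult)

lemma mon_split: "mon u a = a b ^ u b * (\<Prod>v\<in>-{b}. a v ^ u v)"
  unfolding mon_def by (subst prod.remove[of _ b]) (auto simp: Compl_eq_Diff_UNIV)

lemma freshmans_dream_diff: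
  fixes x y :: "'r::comm_ring_1"
  assumes "prime CHAR('r)"
  shows "(x - y) ^ (CHAR('r) ^ s) = x ^ (CHAR('r) ^ s) - y ^ (CHAR('r) ^ s)"
  using freshmans_dream'[OF assms refl, of "x - y" y s] by (simp add: algebra_simps)

lemma of_nat_power_CHAR:
  assumes "prime CHAR('r::comm_ring_1)"
  shows "(of_nat n :: 'r) ^ CHAR('r) = of_nat n"
proof (induction n)
  case 0
  then show ?case using assms prime_gt_0_nat by (simp add: zero_power)
next
  case (Suc n)
  then show ?case using freshmans_dream[OF assms refl, of "of_nat n" "1"] by (simp add: add.commute)
qed

lemma diff_at_power: "diff_at (f ^ n) a x = of_nat n * pev f a ^ (n - 1) * diff_at f a x"
proof (induction n)
  case 0
  have "diff_at (Const 1) a x = 0" by (simp add: diff_at_simps)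
  then show ?case by (simp add: ring_map_one[OF ring_map_Const])
next
  case (Suc n)
  then show ?case by (cases n) (auto simp: diff_at_simps pev_simps algebra_simps)
qed

lemma diff_at_sum: "diff_at (sum h A) a x = (\<Sum>i\<in>A. diff_at (h i) a x)"
  by (simp add: differential_def pd_sum pev_simps sum_distrib_right) (rule sum.swap)

lemma diff_at_mon:
  assumes "\<And>v. v \<noteq> b \<Longrightarrow> u v \<noteq> 0 \<Longrightarrow> x v = 0" and "x b = 1"
  shows "diff_at (mon u Var) a x = of_nat (u b) * mon (u(b := u b - 1)) a"
proof -
  have "diff_at (\<Prod>v\<in>A. Var v ^ u v) a x = 0" if "b \<notin> A" for A
    using that
  proof (induction A rule: infinite_finite_induct)
    case (insert v A)
    then show ?case using assms(1)[of v] by (cases "u v = 0") (auto simp: diff_at_simps pev_simps diff_at_power)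
  qed (use diff_at_power[of 1 0 a x] in auto)
  from this[of "- {b}"] show ?thesis
    using assms(2) unfolding mon_split[of _ _ b]
    by (simp add: diff_at_simps pev_simps diff_at_power)
qed

text \<open>Derivations kill \<open>p\<close>-th powers. Hence differentiating a relation along the tangent vector dual to
  the coordinate \<open>b\<close> is formal differentiation by \<open>b\<close> of a polynomial with \<open>p\<close>-th powers as
  coefficients, and the exponents below \<open>p\<close> that come out as factors are invertible. An induction on
  the degree shows that all coefficients of a relation vanish. Multiplying the relation by \<open>D\<close> makes
  it hold on all of \<open>V\<close>, so that tangent vectors may be applied to it.\<close>

lemma independence_exponent_p:
  fixes V :: "('v::finite \<Rightarrow> 'k::field) set"
  assumes p: "p = CHAR('k)" "prime p"
    and dual: "\<And>a b. a \<in> V \<Longrightarrow> pev D a \<noteq> 0 \<Longrightarrow> b \<in> B \<Longrightarrow>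
       \<exists>x\<in>tangent V a. \<forall>b'\<in>B. x b' = (if b' = b then 1 else 0)"
    and rel: "\<And>a. a \<in> V \<Longrightarrow> pev D a \<noteq> 0 \<Longrightarrow> (\<Sum>u\<in>Exps p B. pev (f u) a ^ p * mon u a) = 0"
    and "u \<in> Exps p B" "a \<in> V" "pev D a \<noteq> 0"
  shows "pev (f u) a = 0"
proof -
  have *: "\<And>f u a. (\<And>a. a \<in> V \<Longrightarrow> pev D a \<noteq> 0 \<Longrightarrow> (\<Sum>u\<in>Exps p B. pev (f u) a ^ p * mon u a) = 0) \<Longrightarrow>
     (\<And>u a. u \<in> Exps p B \<Longrightarrow> n < (\<Sum>v\<in>UNIV. u v) \<Longrightarrow> a \<in> V \<Longrightarrow> pev D a \<noteq> 0 \<Longrightarrow> pev (f u) a = 0) \<Longrightarrow>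
     u \<in> Exps p B \<Longrightarrow> a \<in> V \<Longrightarrow> pev D a \<noteq> 0 \<Longrightarrow> pev (f u) a = 0" for n
  proof (induction n)
    case (0 f u a)
    have z: "pev (f u) a = 0" if "u \<in> Exps p B" "u \<noteq> (\<lambda>v. 0)" for u
      using that by (intro "0"(2)) (use "0"(4,5) in \<open>auto simp: fun_eq_iff intro: sum_pos2\<close>)
    have "(\<Sum>u\<in>Exps p B. pev (f u) a ^ p * mon u a)
        = (\<Sum>u\<in>Exps p B. if u = (\<lambda>v. 0) then pev (f (\<lambda>v. 0)) a ^ p else 0)"
      by (rule sum.cong) (use z p in \<open>auto simp: mon_def zero_power prime_gt_0_nat\<close>)
    also have "\<dots> = pev (f (\<lambda>v. 0)) a ^ p"
      using p by (subst sum.delta[OF finite_Exps]) (auto simp: Exps_def prime_gt_0_nat)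
    finally have "pev (f (\<lambda>v. 0)) a = 0"
      using "0"(1)[OF "0"(4,5)] by simp
    with z "0"(3) show ?case by (cases "u = (\<lambda>v. 0)") auto
  next
    case (Suc n f u a)
    have z: "pev (f u) a = 0" if u: "u \<in> Exps p B" "b \<in> B" "0 < u b" and a: "a \<in> V" "pev D a \<noteq> 0" for u a b
    proof -
      \<comment> \<open>The coefficients of the derivative by \<open>b\<close>. The integer \<open>u b + 1\<close> is its own \<open>p\<close>-th power in \<open>k\<close>,
        so that they are again \<open>p\<close>-th powers.\<close>
      define g where "g u = (if u b + 1 < p then Const (of_nat (u b + 1)) * f (u(b := u b + 1)) else 0)" for u
      have "(\<Sum>u\<in>Exps p B. pev (g u) a ^ p * mon u a) = 0" if a: "a \<in> V" "pev D a \<noteq> 0" for a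
      proof -
        define F where "F = (\<Sum>u\<in>Exps p B. f u ^ p * mon u Var)"
        have F: "pev F y = (\<Sum>u\<in>Exps p B. pev (f u) y ^ p * mon u y)" for y
          by (simp add: F_def pev_simps peval_mon[OF ring_map_id])
        obtain x where x: "x \<in> tangent V a" "\<And>b'. b' \<in> B \<Longrightarrow> x b' = (if b' = b then 1 else 0)"
          using dual[OF a u(2)] by blast
        have "D * F \<in> ideal_of V"
          using Suc.prems(1) by (auto simp: ideal_of_def pev_simps F)
        with x have "diff_at (D * F) a x = 0"
          by (auto simp: tangent_def)
        moreover have "pev F a = 0"
          using Suc.prems(1)[OF a] by (simp add: F)
        ultimately have "0 = diff_at F a x"
          using a by (simp add: diff_at_simps)
        also have "\<dots> = (\<Sum>u\<in>Exps p B. pev (f u) a ^ p * (of_nat (u b) * mon (u(b := u b - 1)) a))"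
          unfolding F_def diff_at_sum
        proof (rule sum.cong[OF refl])
          fix u assume "u \<in> Exps p B"
          then have "diff_at (mon u Var) a x = of_nat (u b) * mon (u(b := u b - 1)) a"
          proof (intro diff_at_mon)
            show "x v = 0" if "v \<noteq> b" "u v \<noteq> 0" for v
              using x(2)[of v] that \<open>u \<in> Exps p B\<close> by (cases "v \<in> B") (auto simp: Exps_def)
            show "x b = 1" using x(2)[OF u(2)] by simp
          qed
          then show "diff_at (f u ^ p * mon u Var) a x
              = pev (f u) a ^ p * (of_nat (u b) * mon (u(b := u b - 1)) a)"
            by (simp add: diff_at_simps diff_at_power pev_simps p)
        qed
        also have "\<dots> = (\<Sum>u\<in>{u\<in>Exps p B. 0 < u b}. pev (f u) a ^ p * (of_nat (u b) * mon (u(b := u b - 1)) a))"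
          by (rule sum.mono_neutral_right) (auto simp: finite_Exps)
        also have "\<dots> = (\<Sum>u\<in>{u\<in>Exps p B. u b + 1 < p}. pev (f (u(b := u b + 1))) a ^ p * (of_nat (u b + 1) * mon u a))"
          by (rule sum.reindex_bij_witness[where i = "\<lambda>u. u(b := u b + 1)" and j = "\<lambda>u. u(b := u b - 1)"])
             (use u(2) in \<open>auto simp: Exps_def\<close>)
        also have "\<dots> = (\<Sum>u\<in>{u\<in>Exps p B. u b + 1 < p}. pev (g u) a ^ p * mon u a)"
          by (rule sum.cong) (use of_nat_power_CHAR[where ?'r = 'k] p in
              \<open>auto simp: g_def pev_simps power_mult_distrib simp del: of_nat_Suc of_nat_add\<close>)
        also have "\<dots> = (\<Sum>u\<in>Exps p B. pev (g u) a ^ p * mon u a)"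
          by (rule sum.mono_neutral_left)
             (use p in \<open>auto simp: finite_Exps g_def peval_zero zero_power prime_gt_0_nat\<close>)
        finally show ?thesis by simp
      qed
      moreover have "pev (g w) a = 0" if "w \<in> Exps p B" "n < (\<Sum>v\<in>UNIV. w v)" "a \<in> V" "pev D a \<noteq> 0" for w a
      proof (cases "w b + 1 < p")
        case True
        have "(\<Sum>v\<in>UNIV. (w(b := w b + 1)) v) = Suc (\<Sum>v\<in>UNIV. w v)"
          by (simp add: sum.remove[of UNIV b])
        moreover have "w(b := w b + 1) \<in> Exps p B"
          using True that(1) u(2) by (auto simp: Exps_def)
        ultimately have "pev (f (w(b := w b + 1))) a = 0"
          using that by (intro Suc.prems(2)) (simp_all only: less_Suc_eq_le Suc_less_eq not_False_eq_True)
        then show ?thesis by (simp add: g_def pev_simps)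
      qed (simp add: g_def peval_zero)
      ultimately have IH: "pev (g w) a = 0" if "w \<in> Exps p B" for w
        using Suc.IH[of g w a] that a by blast
      let ?w = "u(b := u b - 1)"
      have "?w \<in> Exps p B" "?w b + 1 < p" using u by (auto simp: Exps_def)
      with IH[of ?w] have "of_nat (u b) * pev (f u) a = 0"
        using u(3) by (simp add: g_def pev_simps del: of_nat_Suc)
      moreover have "(of_nat (u b) :: 'k) \<noteq> 0"
        using u p by (auto simp: of_nat_eq_0_iff_char_dvd Exps_def dest: nat_dvd_not_less)
      ultimately show ?thesis by simp
    qed
    show ?case
    proof (rule Suc.IH[OF Suc.prems(1)])
      show "pev (f u) a = 0"
        if u: "u \<in> Exps p B" "n < (\<Sum>v\<in>UNIV. u v)" and a: "a \<in> V" "pev D a \<noteq> 0" for u a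
      proof -
        obtain b where "u b \<noteq> 0"
          using u(2) by (metis not_less_zero sum.neutral)
        with u(1) show ?thesis by (intro z[OF u(1) _ _ a]) (auto simp: Exps_def)
      qed
    qed (use Suc.prems in auto)
  qed
  show ?thesis
  proof (rule *)
    show "pev (f u) a = 0" if u: "u \<in> Exps p B" "CARD('v) * p < (\<Sum>v\<in>UNIV. u v)" for u a
    proof -
      have "u v \<le> p" for v using u(1) by (cases "v \<in> B") (auto simp: Exps_def less_imp_le)
      then have "(\<Sum>v\<in>UNIV. u v) \<le> CARD('v) * p"
        using sum_bounded_above[of UNIV u p] by simp
      with u(2) show ?thesis by simp
    qed
  qed (use assms in auto)
qed

text \<open>For \<open>q = p\<^sup>s\<close> write the exponents as \<open>u + p w\<close> with \<open>u < p\<close> and \<open>w < p\<^bsup>s-1\<^esup>\<close>. A relation over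
  \<open>q\<close>-th powers becomes a relation between the monomials of exponents \<open>u\<close> whose coefficients are
  \<open>p\<close>-th powers of sums over \<open>w\<close>. These sums vanish as functions, because a function whose \<open>p\<close>-th
  power is zero is zero.\<close>

lemma independence_exponent:
  fixes V :: "('v::finite \<Rightarrow> 'k::field) set"
  assumes p: "p = CHAR('k)" "prime p"
    and dual: "\<And>a b. a \<in> V \<Longrightarrow> pev D a \<noteq> 0 \<Longrightarrow> b \<in> B \<Longrightarrow>
       \<exists>x\<in>tangent V a. \<forall>b'\<in>B. x b' = (if b' = b then 1 else 0)"
    and rel: "\<And>a. a \<in> V \<Longrightarrow> pev D a \<noteq> 0 \<Longrightarrow> (\<Sum>u\<in>Exps (p ^ s) B. pev (f u) a ^ (p ^ s) * mon u a) = 0"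
    and "u \<in> Exps (p ^ s) B" "a \<in> V" "pev D a \<noteq> 0"
  shows "pev (f u) a = 0"
  using rel assms(5-7)
proof (induction s arbitrary: f u a)
  case 0
  have "Exps 1 B = {\<lambda>v. 0}" by (auto simp: Exps_def fun_eq_iff)
  with 0 show ?case by (auto simp: mon_def)
next
  case (Suc s)
  define q where "q = p ^ s"
  have p0: "0 < p" "0 < q" using p by (auto simp: prime_gt_0_nat q_def)
  define g where "g u' = (\<Sum>w\<in>Exps q B. f (\<lambda>v. u' v + p * w v) ^ q * mon w Var)" for u'
  have g: "pev (g u') y = (\<Sum>w\<in>Exps q B. pev (f (\<lambda>v. u' v + p * w v)) y ^ q * mon w y)" for u' y
    by (simp add: g_def pev_simps peval_mon[OF ring_map_id])
  have add_mult_less: "i + p * j < p * q" if "i < p" "j < q" for i j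
  proof -
    have "i + p * j < p * Suc j" using that by simp
    also have "\<dots> \<le> p * q" using that by (intro mult_le_mono2) simp
    finally show ?thesis .
  qed
  have reindex: "(\<Sum>u\<in>Exps (p * q) B. h u) = (\<Sum>(u', w)\<in>Exps p B \<times> Exps q B. h (\<lambda>v. u' v + p * w v))"
    for h :: "('v \<Rightarrow> nat) \<Rightarrow> 'k"
  proof (rule sum.reindex_bij_witness[where
        j = "\<lambda>u. (\<lambda>v. u v mod p, \<lambda>v. u v div p)" and i = "\<lambda>(u', w) v. u' v + p * w v"])
    fix u assume "u \<in> Exps (p * q) B"
    then show "(\<lambda>v. u v mod p, \<lambda>v. u v div p) \<in> Exps p B \<times> Exps q B"
      using p0 by (auto simp: Exps_def less_mult_imp_div_less mult.commute)
  next
    fix z assume z: "z \<in> Exps p B \<times> Exps q B"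
    obtain u' w where uw: "z = (u', w)" "u' \<in> Exps p B" "w \<in> Exps q B" using z by (cases z) auto
    have u'p: "u' v < p" for v using Exps_less[OF p0(1) uw(2)] .
    from uw(1) u'p show "(\<lambda>v. (case z of (u', w) \<Rightarrow> \<lambda>v. u' v + p * w v) v mod p,
          \<lambda>v. (case z of (u', w) \<Rightarrow> \<lambda>v. u' v + p * w v) v div p) = z"
      using p0 by (simp add: fun_eq_iff)
    show "(case z of (u', w) \<Rightarrow> \<lambda>v. u' v + p * w v) \<in> Exps (p * q) B"
      using uw by (auto simp: Exps_def intro: add_mult_less)
  qed auto
  have "(\<Sum>u'\<in>Exps p B. pev (g u') y ^ p * mon u' y) = 0" if y: "y \<in> V" "pev D y \<noteq> 0" for y
  proof -
    have "pev (g u') y ^ p * mon u' y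
        = (\<Sum>w\<in>Exps q B. pev (f (\<lambda>v. u' v + p * w v)) y ^ (p * q) * mon (\<lambda>v. u' v + p * w v) y)" for u'
      
    proof -
      have "(x ^ q * mon w y) ^ p * mon u' y = x ^ (p * q) * mon (\<lambda>v. u' v + p * w v) y" for x and w :: "'v \<Rightarrow> nat"
        unfolding mon_add mon_scale power_mult_distrib mult.commute[of p q] power_mult[of _ q p]
        by (simp add: mult_ac)
      moreover have "(\<Sum>w\<in>Exps q B. pev (f (\<lambda>v. u' v + p * w v)) y ^ q * mon w y) ^ p
          = (\<Sum>w\<in>Exps q B. (pev (f (\<lambda>v. u' v + p * w v)) y ^ q * mon w y) ^ p)"
        unfolding p(1) by (rule freshmans_dream_sum) (use p in auto)
      ultimately show ?thesis
        by (simp only: g sum_distrib_right)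
    qed
    then have "(\<Sum>u'\<in>Exps p B. pev (g u') y ^ p * mon u' y)
        = (\<Sum>u\<in>Exps (p * q) B. pev (f u) y ^ (p * q) * mon u y)"
      by (simp add: reindex sum.cartesian_product)
    then show ?thesis using Suc.prems(1)[OF y] by (simp add: q_def)
  qed
  then have gz: "pev (g u') y = 0" if "u' \<in> Exps p B" "y \<in> V" "pev D y \<noteq> 0" for u' y
    using that dual independence_exponent_p[OF p, of V D B g u' y] by blast
  let ?u = "\<lambda>v. u v mod p" and ?w = "\<lambda>v. u v div p"
  have "?u \<in> Exps p B" and w: "?w \<in> Exps q B"
    using Suc.prems(2) p0 by (auto simp: Exps_def q_def less_mult_imp_div_less mult.commute)
  have "(\<Sum>w\<in>Exps q B. pev (f (\<lambda>v. ?u v + p * w v)) y ^ q * mon w y) = 0" if "y \<in> V" "pev D y \<noteq> 0" for y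
    using gz[OF \<open>?u \<in> Exps p B\<close> that] by (simp add: g)
  from Suc.IH[of "\<lambda>w. f (\<lambda>v. ?u v + p * w v)", folded q_def, OF this w Suc.prems(3,4)]
  show ?case by simp
qed

text \<open>Specialization of independence at a generic point. A relation over the \<open>q\<close>-th powers among the
  functions \<open>m u\<close>, \<open>u \<in> X \<union> W\<close>, whose coefficients outside of the independent set \<open>X\<close> vanish at the
  point \<open>x\<close>, has all coefficients zero at \<open>x\<close>. This can only be expected on an open part of \<open>V\<close>.
  The proof moves the elements \<open>w\<close> of \<open>W\<close> one at a time: either \<open>w\<close> may be added to the independent
  set, or a relation expresses \<open>w\<close> by \<open>X\<close> where its coefficient at \<open>w\<close> is nonzero, and this relation
  eliminates \<open>w\<close> from all others.\<close>

lemma generic_elimination: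
  fixes V :: "('v \<Rightarrow> 'k::field) set" and m :: "'u \<Rightarrow> ('v \<Rightarrow> 'k) \<Rightarrow> 'k"
  assumes p: "prime CHAR('k)" and q: "q = CHAR('k) ^ s"
  defines "rel \<equiv> \<lambda>E X f. \<forall>y\<in>V. pev E y \<noteq> 0 \<longrightarrow> (\<Sum>u\<in>X. pev (f u) y ^ q * m u y) = 0"
  defines "indep \<equiv> \<lambda>E X. \<forall>f. rel E X f \<longrightarrow> (\<forall>u\<in>X. \<forall>y\<in>V. pev E y \<noteq> 0 \<longrightarrow> pev (f u) y = 0)"
  assumes "finite W" "finite X" "X \<inter> W = {}" "\<exists>y\<in>V. pev E y \<noteq> 0" "indep E X"
  shows "\<exists>E'. (\<exists>y\<in>V. pev E' y \<noteq> 0) \<and> (\<forall>y\<in>V. pev E' y \<noteq> 0 \<longrightarrow> pev E y \<noteq> 0) \<and>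
     (\<forall>x\<in>V. pev E' x \<noteq> 0 \<longrightarrow> (\<forall>f. rel E' (X \<union> W) f \<longrightarrow> (\<forall>u\<in>W. pev (f u) x = 0) \<longrightarrow> (\<forall>u\<in>X. pev (f u) x = 0)))"
  using assms(5-)
proof (induction W arbitrary: X E rule: finite_induct)
  case empty
  then have "indep E X" by (simp only: empty_iff)
  then have "\<forall>x\<in>V. pev E x \<noteq> 0 \<longrightarrow> (\<forall>f. rel E (X \<union> {}) f \<longrightarrow> (\<forall>u\<in>{}. pev (f u) x = 0) \<longrightarrow> (\<forall>u\<in>X. pev (f u) x = 0))"
    unfolding indep_def Un_empty_right by blast
  with empty.prems(3) show ?case by blast
next
  case (insert w W)
  show ?case
  proof (cases "indep E (insert w X)")
    case True
    have "finite (insert w X)" "insert w X \<inter> W = {}"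
      using insert.prems(1,2) insert.hyps by auto
    from insert.IH[OF this insert.prems(3) True]
    obtain E' where "(\<exists>y\<in>V. pev E' y \<noteq> 0) \<and> (\<forall>y\<in>V. pev E' y \<noteq> 0 \<longrightarrow> pev E y \<noteq> 0) \<and>
      (\<forall>x\<in>V. pev E' x \<noteq> 0 \<longrightarrow> (\<forall>f. rel E' (insert w X \<union> W) f \<longrightarrow> (\<forall>u\<in>W. pev (f u) x = 0)
        \<longrightarrow> (\<forall>u\<in>insert w X. pev (f u) x = 0)))"
      by (rule exE)
    note E' = this[THEN conjunct1] this[THEN conjunct2, THEN conjunct1] this[THEN conjunct2, THEN conjunct2]
    have "insert w X \<union> W = X \<union> insert w W" by auto
    then have "\<forall>x\<in>V. pev E' x \<noteq> 0 \<longrightarrow> (\<forall>f. rel E' (X \<union> insert w W) f \<longrightarrow> (\<forall>u\<in>insert w W. pev (f u) x = 0)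
        \<longrightarrow> (\<forall>u\<in>X. pev (f u) x = 0))"
      using E'(3) by (simp only: ball_simps simp_thms) blast
    with E'(1,2) show ?thesis by blast
  next
    case False
    have q0: "0 < q" using p q by (simp add: prime_gt_0_nat)
    have w: "w \<notin> X" using insert.prems(2) by auto
    from False obtain f where f: "rel E (insert w X) f"
      "\<not> (\<forall>u\<in>insert w X. \<forall>y\<in>V. pev E y \<noteq> 0 \<longrightarrow> pev (f u) y = 0)"
      unfolding indep_def by blast
    have "\<exists>y\<in>V. pev E y \<noteq> 0 \<and> pev (f w) y \<noteq> 0"
    proof (rule ccontr)
      assume *: "\<not> ?thesis"
      have "(\<Sum>u\<in>X. pev (f u) y ^ q * m u y) = 0" if y: "y \<in> V" "pev E y \<noteq> 0" for y
      proof -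
        have "pev (f w) y = 0" using * y by blast
        moreover have "pev (f w) y ^ q * m w y + (\<Sum>u\<in>X. pev (f u) y ^ q * m u y) = 0"
          using f(1) insert.prems(1) w y by (simp add: rel_def)
        ultimately show ?thesis using q0 by (simp add: zero_power)
      qed
      then have "rel E X f" by (simp add: rel_def)
      then have "\<forall>u\<in>X. \<forall>y\<in>V. pev E y \<noteq> 0 \<longrightarrow> pev (f u) y = 0"
        using insert.prems(4) unfolding indep_def by blast
      with * f(2) show False by blast
    qed
    moreover define E1 where "E1 = E * f w"
    ultimately have E1: "\<exists>y\<in>V. pev E1 y \<noteq> 0"
      by (auto simp: pev_simps)
    have "indep E1 X"
      unfolding indep_def
    proof (intro allI impI ballI)
      fix g u y
      assume g: "rel E1 X g" and u: "u \<in> X" and y: "y \<in> V" "pev E1 y \<noteq> 0"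
      have "(\<Sum>u\<in>X. pev (E1 * g u) z ^ q * m u z) = pev E1 z ^ q * (\<Sum>u\<in>X. pev (g u) z ^ q * m u z)" for z
        by (simp add: pev_simps power_mult_distrib sum_distrib_left mult_ac)
      then have "rel E X (\<lambda>u. E1 * g u)"
        using g q0 by (auto simp: rel_def zero_power)
      moreover have "pev E y \<noteq> 0" using y(2) by (auto simp: E1_def pev_simps)
      ultimately have "pev (E1 * g u) y = 0"
        using insert.prems(4) u y(1) unfolding indep_def by blast
      then show "pev (g u) y = 0" using y by (simp add: pev_simps)
    qed
    have "X \<inter> W = {}"
      using insert.prems(2) by auto
    from insert.IH[OF insert.prems(1) this E1 \<open>indep E1 X\<close>]
    obtain E' where "(\<exists>y\<in>V. pev E' y \<noteq> 0) \<and> (\<forall>y\<in>V. pev E' y \<noteq> 0 \<longrightarrow> pev E1 y \<noteq> 0) \<and>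
      (\<forall>x\<in>V. pev E' x \<noteq> 0 \<longrightarrow> (\<forall>f. rel E' (X \<union> W) f \<longrightarrow> (\<forall>u\<in>W. pev (f u) x = 0)
        \<longrightarrow> (\<forall>u\<in>X. pev (f u) x = 0)))"
      by (rule exE)
    note E' = this[THEN conjunct1] this[THEN conjunct2, THEN conjunct1] this[THEN conjunct2, THEN conjunct2]
    have linear_relation: "t = 0"
      if "hX = F * gX - G * fX" "hW = F * gW" "G * mw + gX + gW = 0" "F * mw + fX = 0" "t = hX + hW"
      for t hX hW F G gX gW fX mw :: 'k
    proof -
      have "t = F * (G * mw + gX + gW) - G * (F * mw + fX)"
        unfolding that(5) unfolding that(1,2) by (simp add: algebra_simps)
      then show ?thesis unfolding that(3,4) by simp
    qed
    show ?thesis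
    proof (intro exI[of _ E'] conjI ballI impI allI)
      show "\<exists>y\<in>V. pev E' y \<noteq> 0" "\<And>y. y \<in> V \<Longrightarrow> pev E' y \<noteq> 0 \<Longrightarrow> pev E y \<noteq> 0"
        using E' by (auto simp: E1_def pev_simps)
      fix x g u
      assume x: "x \<in> V" "pev E' x \<noteq> 0" and g: "rel E' (X \<union> insert w W) g"
        "\<forall>u\<in>insert w W. pev (g u) x = 0" and u: "u \<in> X"
      \<comment> \<open>The combination of the relations \<open>f\<close> and \<open>g\<close> in which the terms at \<open>w\<close> cancel.\<close>
      define h where "h u = (if u \<in> X then f w * g u - g w * f u else f w * g u)" for u
      have "(\<Sum>u\<in>X \<union> W. pev (h u) y ^ q * m u y) = 0" if y: "y \<in> V" "pev E' y \<noteq> 0" for y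
      proof -
        have "(\<Sum>u\<in>X. pev (h u) y ^ q * m u y)
            = (\<Sum>u\<in>X. pev (f w) y ^ q * (pev (g u) y ^ q * m u y) - pev (g w) y ^ q * (pev (f u) y ^ q * m u y))"
          by (rule sum.cong)
             (auto simp: h_def pev_simps q freshmans_dream_diff[OF p] power_mult_distrib algebra_simps)
        moreover have "(\<Sum>u\<in>W. pev (h u) y ^ q * m u y) = (\<Sum>u\<in>W. pev (f w) y ^ q * (pev (g u) y ^ q * m u y))"
          by (rule sum.cong) (use insert.prems(2) in \<open>auto simp: h_def pev_simps power_mult_distrib\<close>)
        moreover have "pev (g w) y ^ q * m w y + (\<Sum>u\<in>X. pev (g u) y ^ q * m u y) + (\<Sum>u\<in>W. pev (g u) y ^ q * m u y) = 0"
        proof -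
          have "X \<union> insert w W = insert w (X \<union> W)" "w \<notin> X \<union> W" "X \<inter> W = {}"
            using insert.prems(2) insert.hyps by auto
          then show ?thesis
            using g(1) y insert.prems(1) insert.hyps
            by (simp add: rel_def sum.union_disjoint add.assoc)
        qed
        moreover have "pev (f w) y ^ q * m w y + (\<Sum>u\<in>X. pev (f u) y ^ q * m u y) = 0"
          using f(1) E'(2) y insert.prems(1) w by (auto simp: rel_def E1_def pev_simps)
        moreover have "(\<Sum>u\<in>X \<union> W. pev (h u) y ^ q * m u y) = (\<Sum>u\<in>X. pev (h u) y ^ q * m u y) + (\<Sum>u\<in>W. pev (h u) y ^ q * m u y)"
          using insert.prems insert.hyps by (intro sum.union_disjoint) auto
        ultimately show ?thesis
          unfolding sum_subtractf sum_distrib_left[symmetric]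
          by (rule linear_relation)
      qed
      then have "rel E' (X \<union> W) h" by (simp add: rel_def)
      moreover have "\<forall>u\<in>W. pev (h u) x = 0"
        using g(2) by (auto simp: h_def pev_simps)
      ultimately have "pev (h u) x = 0" using E'(3) x u by blast
      moreover have "pev (f w) x \<noteq> 0" using E'(2) x by (auto simp: E1_def pev_simps)
      ultimately show "pev (g u) x = 0"
        using u g(2) by (auto simp: h_def pev_simps)
    qed
  qed
qed

section \<open>Truncated arcs through generic points\<close>

text \<open>Reduction of exponents below \<open>q\<close>, over a coefficient set \<open>K\<close> that contains the \<open>q\<close>-th powers of
  the variables. It is applied to the set of \<open>q\<close>-th powers, and to the constants modulo the
  \<open>q\<close>-th powers of a maximal ideal.\<close>

lemma polys_in_reduced:
  fixes K :: "('v::finite, 'k::comm_ring_1) mpoly set"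
  assumes K: "\<And>c. Const c \<in> K" "\<And>x y. x \<in> K \<Longrightarrow> y \<in> K \<Longrightarrow> x + y \<in> K" "\<And>x y. x \<in> K \<Longrightarrow> y \<in> K \<Longrightarrow> x * y \<in> K"
    and Var_q: "\<And>v. v \<in> B \<Longrightarrow> Var v ^ q \<in> K" and q: "0 < q" and f: "f \<in> polys_in B"
  shows "\<exists>k. (\<forall>u. k u \<in> K) \<and> f = (\<Sum>u\<in>Exps q B. k u * mon u Var)"
  using f
proof induction
  case (Const c)
  have "(\<Sum>u\<in>Exps q B. (if u = (\<lambda>v. 0) then Const c else Const 0) * mon u Var)
      = (\<Sum>u\<in>Exps q B. if u = (\<lambda>v. 0) then Const c else 0)"
    by (intro sum.cong) (auto simp: mon_def ring_map_zero[OF ring_map_Const])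
  also have "\<dots> = Const c"
    using q by (subst sum.delta[OF finite_Exps]) (auto simp: Exps_def)
  finally show ?case
    using K(1) by (intro exI[of _ "\<lambda>u. if u = (\<lambda>v. 0) then Const c else Const 0"]) auto
next
  case (add f g)
  then obtain k l where "\<forall>u. k u \<in> K" "f = (\<Sum>u\<in>Exps q B. k u * mon u Var)"
    "\<forall>u. l u \<in> K" "g = (\<Sum>u\<in>Exps q B. l u * mon u Var)"
    by blast
  then show ?case
    by (intro exI[of _ "\<lambda>u. k u + l u"]) (auto simp: K sum.distrib distrib_right)
next
  case (mult_Var f v)
  then obtain k where k: "\<forall>u. k u \<in> K" "f = (\<Sum>u\<in>Exps q B. k u * mon u Var)"
    by blast
  \<comment> \<open>Multiplication by \<open>v\<close> rotates the exponents of \<open>v\<close>, with a factor in \<open>K\<close> when \<open>q - 1\<close> wraps around to 0.\<close>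
  define l where "l u = (if u v = 0 then Var v ^ q * k (u(v := q - 1)) else k (u(v := u v - 1)))" for u
  have "f * Var v = (\<Sum>u\<in>Exps q B. k u * mon u Var * Var v)"
    by (simp add: k sum_distrib_right)
  also have "\<dots> = (\<Sum>u\<in>Exps q B. l u * mon u Var)"
  proof (rule sum.reindex_bij_witness[where j = "\<lambda>u. u(v := if u v = q - 1 then 0 else u v + 1)"
        and i = "\<lambda>u. u(v := if u v = 0 then q - 1 else u v - 1)"])
    fix u assume u: "u \<in> Exps q B"
    then have uv: "u v < q" by (rule Exps_less[OF q])
    show "u(v := if u v = q - 1 then 0 else u v + 1) \<in> Exps q B"
      "u(v := if u v = 0 then q - 1 else u v - 1) \<in> Exps q B"
      using u uv q mult_Var.hyps by (auto simp: Exps_def)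
    show "l (u(v := if u v = q - 1 then 0 else u v + 1)) * mon (u(v := if u v = q - 1 then 0 else u v + 1)) Var
        = k u * mon u Var * Var v"
    proof (cases "u v = q - 1")
      case True
      then have "u(v := q - 1) = u" by auto
      moreover have "(Var v :: ('v, 'k) mpoly) ^ q = Var v ^ u v * Var v"
      proof -
        have "q = Suc (u v)" using True q by simp
        then show ?thesis by (simp only: power_Suc2)
      qed
      ultimately show ?thesis
        using True by (simp add: l_def mon_split[of _ _ v] mult_ac)
    qed (simp add: l_def mon_split[of _ _ v] mult_ac)
  qed (use q in \<open>auto dest: Exps_less[OF q, where v = v]\<close>)
  finally show ?case
    using k K Var_q mult_Var.hyps by (intro exI[of _ l]) (auto simp: l_def)
qed

text \<open>The constants are \<open>q\<close>-th powers because the field contains all \<open>q\<close>-th roots.\<close>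

lemma mpoly_as_q_power_combination:
  fixes h :: "('v::finite, 'k::alg_closed_field) mpoly"
  assumes p: "prime CHAR('k)" and q: "q = CHAR('k) ^ s"
  shows "\<exists>b. h = (\<Sum>u\<in>Exps q UNIV. b u ^ q * mon u Var)"
proof -
  have q0: "0 < q" using p q by (simp add: prime_gt_0_nat)
  have "\<exists>k. (\<forall>u. k u \<in> range (\<lambda>b. b ^ q)) \<and> h = (\<Sum>u\<in>Exps q UNIV. k u * mon u Var)"
  proof (rule polys_in_reduced)
    show "Const c \<in> range (\<lambda>b. b ^ q)" for c :: 'k
    proof -
      obtain r where "r ^ q = c" using nth_root_exists[OF q0] by blast
      then have "Const c = Const r ^ q" by (simp add: ring_map_power[OF ring_map_Const, symmetric])
      then show ?thesis by blast
    qed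
    have add: "(b + c) ^ q = b ^ q + c ^ q" for b c :: "('v, 'k) mpoly"
      using freshmans_dream'[where ?'a = "('v, 'k) mpoly", OF _ refl, of b c s] by (simp add: CHAR_mpoly p q)
    show "x + y \<in> range (\<lambda>b. b ^ q)" if "x \<in> range (\<lambda>b. b ^ q)" "y \<in> range (\<lambda>b. b ^ q)"
      for x y :: "('v, 'k) mpoly"
    proof -
      from that obtain b c where "x = b ^ q" "y = c ^ q" by blast
      then have "x + y = (b + c) ^ q" by (simp only: add)
      then show ?thesis by blast
    qed
    show "x * y \<in> range (\<lambda>b. b ^ q)" if "x \<in> range (\<lambda>b. b ^ q)" "y \<in> range (\<lambda>b. b ^ q)"
      for x y :: "('v, 'k) mpoly"
    proof -
      from that obtain b c where "x = b ^ q" "y = c ^ q" by blast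
      then have "x * y = (b * c) ^ q" by (simp only: power_mult_distrib)
      then show ?thesis by blast
    qed
  qed (auto simp: q0 polys_in_UNIV)
  then obtain k where k: "\<forall>u. k u \<in> range (\<lambda>b. b ^ q)" "h = (\<Sum>u\<in>Exps q UNIV. k u * mon u Var)"
    by blast
  from k(1) have "\<forall>u. \<exists>b. k u = b ^ q" by blast
  then obtain b where "\<forall>u. k u = b u ^ q" by metis
  with k(2) show ?thesis by auto
qed

primrec ideal_pow :: "('v \<Rightarrow> 'r::comm_ring_1) \<Rightarrow> nat \<Rightarrow> 'r set" where
  "ideal_pow z 0 = UNIV"
| "ideal_pow z (Suc n) = {\<Sum>v\<in>UNIV. z v * h v | h. \<forall>v. h v \<in> ideal_pow z n}"

lemma is_ideal_ideal_pow: "is_ideal (ideal_pow z n)"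
proof (induction n)
  case 0
  then show ?case by (simp add: is_ideal_def)
next
  case (Suc n)
  note I = is_idealD[OF Suc]
  have "0 \<in> ideal_pow z (Suc n)"
    using I(1) by (auto intro!: exI[of _ "\<lambda>v. 0"])
  moreover have "x + y \<in> ideal_pow z (Suc n)" if "x \<in> ideal_pow z (Suc n)" "y \<in> ideal_pow z (Suc n)" for x y
  proof -
    from that obtain g h where "\<forall>v. g v \<in> ideal_pow z n" "x = (\<Sum>v\<in>UNIV. z v * g v)"
      "\<forall>v. h v \<in> ideal_pow z n" "y = (\<Sum>v\<in>UNIV. z v * h v)"
      by auto
    then show ?thesis
      by (auto intro!: exI[of _ "\<lambda>v. g v + h v"] I simp: distrib_left sum.distrib)
  qed
  moreover have "r * x \<in> ideal_pow z (Suc n)" if "x \<in> ideal_pow z (Suc n)" for x r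
  proof -
    from that obtain g where "\<forall>v. g v \<in> ideal_pow z n" "x = (\<Sum>v\<in>UNIV. z v * g v)"
      by auto
    then have "r * x = (\<Sum>v\<in>UNIV. z v * (r * g v))" "\<forall>v. r * g v \<in> ideal_pow z n"
      by (auto simp: sum_distrib_left mult_ac intro: I(3,4))
    then show ?thesis by auto
  qed
  ultimately show ?case by (simp only: is_ideal_def) blast
qed

lemma ideal_pow_mult: "x \<in> ideal_pow z m \<Longrightarrow> y \<in> ideal_pow z n \<Longrightarrow> x * y \<in> ideal_pow z (m + n)"
proof (induction m arbitrary: x)
  case 0
  then show ?case using is_ideal_mult_left[OF is_ideal_ideal_pow] by auto
next
  case (Suc m)
  then obtain g where "\<forall>v. g v \<in> ideal_pow z m" "x = (\<Sum>v\<in>UNIV. z v * g v)"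
    by auto
  then have "x * y = (\<Sum>v\<in>UNIV. z v * (g v * y))" "\<forall>v. g v * y \<in> ideal_pow z (m + n)"
    using Suc by (simp_all add: sum_distrib_right mult.assoc)
  then show ?case by auto
qed

lemma ideal_pow_generator: "z (v :: 'v::finite) \<in> ideal_pow z 1"
proof -
  have "z v = (\<Sum>w\<in>UNIV. z w * (if w = v then 1 else 0))"
    by (subst sum.cong[OF refl, of _ _ "\<lambda>w. if w = v then z v else 0"]) auto
  then show ?thesis by (auto intro!: exI[of _ "\<lambda>w. if w = v then 1 else 0"])
qed

lemma ideal_pow_antimono: "m \<le> n \<Longrightarrow> ideal_pow z n \<subseteq> ideal_pow z m"
proof (induction m arbitrary: n)
  case (Suc m)
  then obtain n' where "n = Suc n'" "m \<le> n'" by (cases n) auto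
  with Suc.IH show ?case by fastforce
qed simp

text \<open>By the pigeonhole principle a monomial of degree at least \<open>n q\<close> in \<open>n\<close> variables contains the
  \<open>q\<close>-th power of a variable.\<close>

lemma ideal_pow_subset_powers:
  fixes z :: "'v::finite \<Rightarrow> 'r::comm_ring_1"
  assumes Q: "is_ideal Q" "\<And>v. z v ^ q \<in> Q" and q: "0 < q"
  shows "ideal_pow z (CARD('v) * q) \<subseteq> Q"
proof -
  have "mon u z * h \<in> Q" if "CARD('v) * q \<le> sum u UNIV + n" "h \<in> ideal_pow z n" for u n h
    using that
  proof (induction n arbitrary: u h)
    case 0
    have "\<exists>v. q \<le> u v"
    proof (rule ccontr)
      assume "\<not> ?thesis"
      then have "sum u UNIV < (\<Sum>v\<in>(UNIV :: 'v set). q)"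
        by (intro sum_strict_mono) (auto simp: not_le)
      with 0 show False by simp
    qed
    then obtain v where "q \<le> u v" by blast
    then have "z v ^ u v = z v ^ q * z v ^ (u v - q)"
      by (simp flip: power_add)
    then have "mon u z * h = z v ^ q * (z v ^ (u v - q) * (\<Prod>w\<in>-{v}. z w ^ u w) * h)"
      by (simp add: mon_split[of _ _ v] mult_ac)
    then show ?case using is_ideal_mult_right[OF Q(1) Q(2)] by simp
  next
    case (Suc n)
    then obtain g where g: "\<forall>v. g v \<in> ideal_pow z n" "h = (\<Sum>v\<in>UNIV. z v * g v)"
      by auto
    have "mon u z * (z v * g v) \<in> Q" for v
    proof -
      have "sum (u(v := u v + 1)) UNIV = Suc (sum u UNIV)"
        by (simp add: sum.remove[of UNIV v])
      then have "mon (u(v := u v + 1)) z * g v \<in> Q"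
        using Suc.prems(1) g(1) by (intro Suc.IH) auto
      moreover have "mon u z * (z v * g v) = mon (u(v := u v + 1)) z * g v"
        by (simp add: mon_split[of _ _ v] mult_ac)
      ultimately show ?thesis by simp
    qed
    then show ?case
      unfolding g(2) sum_distrib_left by (intro is_ideal_sum[OF Q(1)])
  qed
  from this[of "\<lambda>v. 0"] show ?thesis by (auto simp: mon_def)
qed

text \<open>Nakayama's lemma for subrings: if a subring \<open>S\<close> contains the constants and the generators of a
  maximal ideal up to terms of second order, then it contains everything up to terms of arbitrarily high
  order, and these lie in \<open>Q\<close>.\<close>

lemma nakayama:
  fixes z :: "'v::finite \<Rightarrow> 'r::comm_ring_1"
  assumes S: "0 \<in> S" "\<And>x y. x \<in> S \<Longrightarrow> y \<in> S \<Longrightarrow> x + y \<in> S" "\<And>x y. x \<in> S \<Longrightarrow> y \<in> S \<Longrightarrow> x * y \<in> S"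
    and Q: "is_ideal Q" "Q \<subseteq> S" "\<And>v. z v ^ q \<in> Q" "0 < q"
    and const: "\<And>f. \<exists>s\<in>S. f - s \<in> ideal_pow z 1"
    and lin: "\<And>v. \<exists>s\<in>S. z v - s \<in> ideal_pow z 2"
  shows "f \<in> S"
proof -
  note I = is_idealD[OF is_ideal_ideal_pow]
  have sum_S: "(\<And>i. i \<in> A \<Longrightarrow> g i \<in> S) \<Longrightarrow> sum g A \<in> S" for g and A :: "'v set"
    by (induction A rule: infinite_finite_induct) (auto intro: S)
  from lin obtain l where l: "\<And>v. l v \<in> S" "\<And>v. z v - l v \<in> ideal_pow z 2" by metis
  have l1: "l v \<in> ideal_pow z 1" for v
    using I(6)[OF ideal_pow_generator[of z v], of "z v - l v"] l(2)[of v] ideal_pow_antimono[of 1 2 z] by auto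
  have approx: "\<exists>s\<in>S \<inter> ideal_pow z n. h - s \<in> ideal_pow z (Suc n)" if "h \<in> ideal_pow z n" for n h
    using that
  proof (induction n arbitrary: h)
    case 0
    then show ?case using const[of h] by (simp only: ideal_pow.simps(1) One_nat_def Int_UNIV_right)
  next
    case (Suc n)
    then obtain g where g: "\<forall>v. g v \<in> ideal_pow z n" "h = (\<Sum>v\<in>UNIV. z v * g v)"
      by auto
    from g(1) Suc.IH have "\<forall>v. \<exists>s. s \<in> S \<inter> ideal_pow z n \<and> g v - s \<in> ideal_pow z (Suc n)" by blast
    then obtain s where s: "\<And>v. s v \<in> S" "\<And>v. s v \<in> ideal_pow z n" "\<And>v. g v - s v \<in> ideal_pow z (Suc n)"
      by (metis IntE)
    define t where "t = (\<Sum>v\<in>UNIV. l v * s v)"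
    have "t \<in> S" unfolding t_def by (intro sum_S S l s)
    moreover have "t \<in> ideal_pow z (Suc n)"
      unfolding t_def using ideal_pow_mult[OF l1 s(2)] by (intro I(7)) simp
    moreover have "h - t \<in> ideal_pow z (Suc (Suc n))"
    proof -
      have "h - t = (\<Sum>v\<in>UNIV. (z v - l v) * g v + l v * (g v - s v))"
        by (simp add: g(2) t_def sum_subtractf[symmetric] algebra_simps)
      moreover have "(z v - l v) * g v \<in> ideal_pow z (Suc (Suc n))" for v
        using ideal_pow_mult[OF l(2)[of v], of "g v" n] g(1) by (simp del: ideal_pow.simps)
      moreover have "l v * (g v - s v) \<in> ideal_pow z (Suc (Suc n))" for v
        using ideal_pow_mult[OF l1 s(3), of v v] by (simp del: ideal_pow.simps)
      ultimately show ?thesis by (simp only:) (intro I(7) I(2))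
    qed
    ultimately show ?case by blast
  qed
  have "\<exists>s\<in>S. f - s \<in> ideal_pow z n" for n
  proof (induction n)
    case 0
    then show ?case using S(1) by auto
  next
    case (Suc n)
    then obtain s where s: "s \<in> S" "f - s \<in> ideal_pow z n" by blast
    with approx obtain t where "t \<in> S" "f - s - t \<in> ideal_pow z (Suc n)" by blast
    with s show ?case using S(2)[of s t] by (intro bexI[of _ "s + t"]) (simp_all add: diff_diff_add)
  qed
  then obtain s where "s \<in> S" "f - s \<in> ideal_pow z (CARD('v) * q)" by blast
  with ideal_pow_subset_powers[of Q z q] Q have "f - s \<in> S" by blast
  from S(2)[OF this \<open>s \<in> S\<close>] show ?thesis by simp
qed

lemma pev_t_const: "pev_t f (\<lambda>v. [:a v:]) = [:pev f a:]"
  using ring_map_comp_peval[OF ring_map_const_poly, of "\<lambda>c. c" f a] by simp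

lemma pev_t_first_order:
  fixes f :: "('v::finite, 'k::comm_ring_1) mpoly"
  shows "[:0, 1:]^2 dvd pev_t f (\<lambda>v. [:a v, x v:]) - [:pev f a, diff_at f a x:]"
proof -
  let ?t = "[:0, 1:] :: 'k poly"
  have sq: "(?t * b) * (?t * c) = ?t^2 * (b * c)" for b c
    by (simp only: power2_eq_square mult_ac)
  have "pev_t f (\<lambda>v. [:a v:] + ?t * [:x v:]) - pev_t f (\<lambda>v. [:a v:])
      - differential (\<lambda>c. [:c:]) f (\<lambda>v. [:a v:]) (\<lambda>v. ?t * [:x v:]) \<in> {r. ?t^2 dvd r}"
    by (rule taylor_mod_ideal[OF ring_map_const_poly is_ideal_multiples])
       (simp only: sq mem_Collect_eq dvd_triv_left)
  moreover have "differential (\<lambda>c. [:c:]) f (\<lambda>v. [:a v:]) (\<lambda>v. ?t * [:x v:]) = ?t * [:diff_at f a x:]"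
    unfolding differential_linear_mult
    by (simp add: differential_def pev_t_const ring_map_sum[OF ring_map_const_poly] mult.commute)
  moreover have "[:pev f a, diff_at f a x:] = [:pev f a:] + ?t * [:diff_at f a x:]"
    by simp
  moreover have "(\<lambda>v. [:a v:] + ?t * [:x v:]) = (\<lambda>v. [:a v, x v:])"
    by simp
  ultimately show ?thesis
    by (simp only: pev_t_const mem_Collect_eq diff_diff_add)
qed

lemma polys_in_peval_Const:
  assumes "\<And>v. P v \<in> polys_in B"
  shows "peval Const f P \<in> polys_in B"
  by (induction f rule: mpoly_induct)
     (auto simp: peval_Const peval_add peval_mult_Var ring_map_Const intro: polys_in.intros polys_in_mult assms)

lemma is_ideal_sum_ideals:
  assumes I: "is_ideal I" and Q: "is_ideal Q"
  shows "is_ideal {i + n | i n. i \<in> I \<and> n \<in> Q}" (is "is_ideal ?J")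
  unfolding is_ideal_def
proof (intro conjI ballI allI)
  show "0 \<in> ?J"
    using is_ideal_0[OF I] is_ideal_0[OF Q] by (intro CollectI exI[of _ 0]) simp
next
  fix x y assume "x \<in> ?J" "y \<in> ?J"
  then obtain i n i' n' where "x = i + n" "y = i' + n'" "i \<in> I" "i' \<in> I" "n \<in> Q" "n' \<in> Q"
    by blast
  then show "x + y \<in> ?J"
    by (intro CollectI exI[of _ "i + i'"] exI[of _ "n + n'"])
       (simp add: is_ideal_add[OF I] is_ideal_add[OF Q])
next
  fix x r assume "x \<in> ?J"
  then obtain i n where "x = i + n" "i \<in> I" "n \<in> Q"
    by blast
  then show "r * x \<in> ?J"
    by (intro CollectI exI[of _ "r * i"] exI[of _ "r * n"])
       (simp add: is_ideal_mult_left[OF I] is_ideal_mult_left[OF Q] distrib_left)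
qed

definition power_ideal :: "('v::finite \<Rightarrow> 'r::comm_ring_1) \<Rightarrow> nat \<Rightarrow> 'r set" where
  "power_ideal z q = range (\<lambda>h. \<Sum>v\<in>UNIV. z v ^ q * h v)"

lemma power_idealI: "x = (\<Sum>v\<in>UNIV. z v ^ q * h v) \<Longrightarrow> x \<in> power_ideal z q"
  unfolding power_ideal_def by (rule range_eqI)

lemma power_idealE:
  assumes "x \<in> power_ideal z q"
  obtains h where "x = (\<Sum>v\<in>UNIV. z v ^ q * h v)"
  using assms unfolding power_ideal_def by (rule rangeE)

lemma is_ideal_power_ideal: "is_ideal (power_ideal z q)"
  unfolding is_ideal_def
proof (intro conjI ballI allI)
  show "0 \<in> power_ideal z q"
    by (rule power_idealI[of _ _ _ "\<lambda>v. 0"]) simp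
next
  fix x y assume "x \<in> power_ideal z q" "y \<in> power_ideal z q"
  then obtain g h where "x = (\<Sum>v\<in>UNIV. z v ^ q * g v)" "y = (\<Sum>v\<in>UNIV. z v ^ q * h v)"
    by (elim power_idealE)
  then show "x + y \<in> power_ideal z q"
    by (intro power_idealI[of _ _ _ "\<lambda>v. g v + h v"]) (simp add: distrib_left sum.distrib)
next
  fix x r assume "x \<in> power_ideal z q"
  then obtain g where "x = (\<Sum>v\<in>UNIV. z v ^ q * g v)"
    by (rule power_idealE)
  then show "r * x \<in> power_ideal z q"
    by (intro power_idealI[of _ _ _ "\<lambda>v. r * g v"]) (simp add: sum_distrib_left mult_ac)
qed

lemma power_ideal_generator: "z (v :: 'v::finite) ^ q \<in> power_ideal z q"
proof -
  have "z v ^ q = (\<Sum>w\<in>UNIV. z w ^ q * (if w = v then 1 else 0))"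
    by (subst sum.cong[OF refl, of _ _ "\<lambda>w. if w = v then z v ^ q else 0"]) auto
  then show ?thesis
    by (rule power_idealI)
qed

text \<open>The point \<open>a\<close> is generic in the sense of \<open>generic_elimination\<close>, applied to the reduced monomials in
  all variables, with those in the coordinates \<open>B\<close> as the independent set. With \<open>J\<close> the ideal of \<open>V\<close>
  plus the \<open>q\<close>-th powers at \<open>a\<close>, every variable \<open>v\<close> is congruent modulo \<open>J\<close> to a polynomial \<open>P v\<close> in the
  coordinates. The arc is \<open>P\<close> evaluated on the line \<open>a + t x\<close>. A polynomial \<open>f\<close> that vanishes on \<open>V\<close>
  becomes a polynomial \<open>f(P)\<close> in the coordinates that lies in \<open>J\<close>; by independence it lies
  in the ideal of the \<open>q\<close>-th powers of \<open>z\<^sub>v = v - a v\<close>, which are divisible by \<open>t\<^sup>q\<close> on the line.\<close>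

theorem generic_arcs:
  fixes V :: "('v::finite \<Rightarrow> 'k::alg_closed_field) set"
  assumes char: "CHAR('k) > 0" and "V \<noteq> {}"
  shows "\<exists>a\<in>V. \<forall>x\<in>tangent V a. \<exists>\<gamma>. (\<forall>v. [:0, 1:]^2 dvd \<gamma> v - [:a v, x v:]) \<and>
    (\<forall>f\<in>ideal_of V. [:0, 1:]^N dvd pev_t f \<gamma>)"
proof -
  define p where "p = CHAR('k)"
  have p: "prime p" using char by (simp add: p_def prime_CHAR_semidom)
  \<comment> \<open>Large enough for \<open>q \<ge> N\<close>, and positive so that \<open>q \<ge> 2\<close> and the first-order terms of arcs are not affected.\<close>
  define s where "s = N + 1"
  define q where "q = p ^ s"
  have q0: "0 < q" using p by (simp add: q_def prime_gt_0_nat)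
  have "p ^ 1 \<le> q"
    unfolding q_def s_def using p by (intro power_increasing) (auto simp: prime_gt_0_nat Suc_le_eq)
  then have q2: "2 \<le> q" using prime_ge_2_nat[OF p] by simp
  have "N < 2 ^ N" by (rule less_exp)
  also have "\<dots> \<le> p ^ N" using prime_ge_2_nat[OF p] by (intro power_mono) auto
  also have "\<dots> \<le> q" unfolding q_def s_def using p by (intro power_increasing) (auto simp: prime_gt_0_nat Suc_le_eq)
  finally have qN: "N \<le> q" by simp
  note freshman_k = freshmans_dream_sum'[of q s, where ?'a = 'k, folded p_def, OF p q_def]
  have pc: "prime CHAR('k)" "q = CHAR('k) ^ s" using p by (auto simp: p_def q_def)
  have freshman_mpoly: "(x + y) ^ q = x ^ q + y ^ q" for x y :: "('v, 'k) mpoly"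
    using freshmans_dream'[where ?'a = "('v, 'k) mpoly", OF _ refl, of x y s] by (simp add: CHAR_mpoly pc)
  obtain B D a0 where a0: "a0 \<in> V" "pev D a0 \<noteq> 0"
    and dual: "\<And>a b. a \<in> V \<Longrightarrow> pev D a \<noteq> 0 \<Longrightarrow> b \<in> B \<Longrightarrow>
       \<exists>x\<in>tangent V a. \<forall>b'\<in>B. x b' = (if b' = b then 1 else 0)"
    and conormal: "\<And>a c. a \<in> V \<Longrightarrow> pev D a \<noteq> 0 \<Longrightarrow> c \<notin> B \<Longrightarrow>
       \<exists>f\<in>ideal_of V. \<forall>v. v \<notin> B \<longrightarrow> pev (pd v f) a = (if v = c then 1 else 0)"
    by (rule generic_chart[OF \<open>V \<noteq> {}\<close>]) (rule that, assumption+)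
  define X :: "('v \<Rightarrow> nat) set" where "X = Exps q B"
  define W :: "('v \<Rightarrow> nat) set" where "W = Exps q UNIV - X"
  have XW: "X \<union> W = Exps q UNIV"
    using q0 by (auto simp: X_def W_def Exps_def)
  have fin: "finite X" "finite W" by (auto simp: X_def W_def finite_Exps)
  have indep: "\<forall>f. (\<forall>y\<in>V. pev D y \<noteq> 0 \<longrightarrow> (\<Sum>u\<in>X. pev (f u) y ^ q * mon u y) = 0) \<longrightarrow>
      (\<forall>u\<in>X. \<forall>y\<in>V. pev D y \<noteq> 0 \<longrightarrow> pev (f u) y = 0)"
  proof (intro allI impI ballI)
    fix f u y
    assume "\<forall>y\<in>V. pev D y \<noteq> 0 \<longrightarrow> (\<Sum>u\<in>X. pev (f u) y ^ q * mon u y) = 0" "u \<in> X" "y \<in> V" "pev D y \<noteq> 0"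
    then show "pev (f u) y = 0"
      using independence_exponent[OF p_def p, where V = V and D = D and B = B and s = s and f = f and u = u and a = y] dual
      unfolding X_def q_def by blast
  qed
  have ex: "\<exists>y\<in>V. pev D y \<noteq> 0" using a0 by blast
  have disj: "X \<inter> W = {}" by (auto simp: W_def)
  obtain E where "(\<exists>y\<in>V. pev E y \<noteq> 0) \<and> (\<forall>y\<in>V. pev E y \<noteq> 0 \<longrightarrow> pev D y \<noteq> 0) \<and>
     (\<forall>x\<in>V. pev E x \<noteq> 0 \<longrightarrow> (\<forall>f. (\<forall>y\<in>V. pev E y \<noteq> 0 \<longrightarrow> (\<Sum>u\<in>X \<union> W. pev (f u) y ^ q * mon u y) = 0) \<longrightarrow>
       (\<forall>u\<in>W. pev (f u) x = 0) \<longrightarrow> (\<forall>u\<in>X. pev (f u) x = 0)))"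
    using generic_elimination[OF pc fin(2,1) disj ex indep] by (rule exE)
  note E = this[THEN conjunct1] this[THEN conjunct2, THEN conjunct1] this[THEN conjunct2, THEN conjunct2]
  from E(1) obtain a where a: "a \<in> V" "pev E a \<noteq> 0" by blast
  with E(2) have Da: "pev D a \<noteq> 0" by blast
  define z where "z v = Var v - Const (a v)" for v
  have pev_z: "pev (z v) y = y v - a v" for v y
    by (simp add: z_def pev_simps)
  define I where "I = ideal_of V"
  define Q where "Q = power_ideal z q"
  define J where "J = {i + n | i n. i \<in> I \<and> n \<in> Q}"
  have ideals: "is_ideal I" "is_ideal Q" "is_ideal J"
    by (auto simp: I_def Q_def J_def is_ideal_ideal_of is_ideal_power_ideal is_ideal_sum_ideals)
  note JI = is_idealD[OF ideals(3)]
  have I_J: "I \<subseteq> J" and Q_J: "Q \<subseteq> J"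
    using is_ideal_0[OF ideals(1)] is_ideal_0[OF ideals(2)] by (force simp: J_def)+

  \<comment> \<open>Independence modulo \<open>J\<close>: an element of \<open>J\<close> gives a relation on \<open>V\<close> over \<open>q\<close>-th powers, in which
    the contribution of the \<open>q\<close>-th powers at \<open>a\<close> has coefficients vanishing at \<open>a\<close>.\<close>
  have free: "c u = 0" if J: "(\<Sum>u\<in>X. Const (c u) * mon u Var) \<in> J" and u: "u \<in> X" for c u
  proof -
    obtain i n where i: "i \<in> I" and n: "n \<in> Q" and c: "(\<Sum>u\<in>X. Const (c u) * mon u Var) = i + n"
      using J by (auto simp: J_def)
    obtain h where h: "- n = (\<Sum>v\<in>UNIV. z v ^ q * h v)"
      using is_ideal_minus[OF ideals(2) n] unfolding Q_def by (rule power_idealE)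
    have "\<forall>v. \<exists>b. h v = (\<Sum>u\<in>Exps q UNIV. b u ^ q * mon u Var)"
      using mpoly_as_q_power_combination[OF pc] by blast
    then have "\<exists>b. \<forall>v. h v = (\<Sum>u\<in>Exps q UNIV. b v u ^ q * mon u Var)"
      by (rule choice)
    then obtain b where b: "\<And>v. h v = (\<Sum>u\<in>Exps q UNIV. b v u ^ q * mon u Var)"
      by blast
    have "\<exists>r. \<forall>u. r u ^ q = c u" using nth_root_exists[OF q0] by (intro choice allI)
    then obtain r where r: "\<And>u. r u ^ q = c u" by blast
    define f where "f u = Const (if u \<in> X then r u else 0) + (\<Sum>v\<in>UNIV. z v * b v u)" for u
    have "(\<Sum>u\<in>X \<union> W. pev (f u) y ^ q * mon u y) = 0" if y: "y \<in> V" for y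
    proof -
      have "pev (f u) y ^ q = (if u \<in> X then c u else 0) + (\<Sum>v\<in>UNIV. (y v - a v) ^ q * pev (b v u) y ^ q)" for u
        using q0 freshmans_dream'[OF pc]
        by (simp add: f_def pev_simps pev_z freshman_k power_mult_distrib r zero_power)
      then have "(\<Sum>u\<in>X \<union> W. pev (f u) y ^ q * mon u y)
          = (\<Sum>u\<in>X \<union> W. (if u \<in> X then c u else 0) * mon u y)
            + (\<Sum>u\<in>X \<union> W. \<Sum>v\<in>UNIV. (y v - a v) ^ q * pev (b v u) y ^ q * mon u y)"
        by (simp only: distrib_right sum.distrib sum_distrib_right)
      also have "(\<Sum>u\<in>X \<union> W. (if u \<in> X then c u else 0) * mon u y) = (\<Sum>u\<in>X. c u * mon u y)"
        by (rule sum.mono_neutral_cong_right) (use fin in auto)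
      also have "\<dots> = pev (i + n) y"
        unfolding c[symmetric] by (simp add: pev_simps peval_mon[OF ring_map_id])
      also have "(\<Sum>u\<in>X \<union> W. \<Sum>v\<in>UNIV. (y v - a v) ^ q * pev (b v u) y ^ q * mon u y) = pev (- n) y"
        unfolding h b XW
        by (subst sum.swap) (simp add: pev_simps pev_z peval_mon[OF ring_map_id] sum_distrib_left mult_ac)
      also have "pev (i + n) y + pev (- n) y = 0"
        using i y by (simp add: pev_simps I_def ideal_of_def)
      finally show ?thesis .
    qed
    moreover have "pev (f u) a = 0" if "u \<in> W" for u
      using that by (simp add: f_def W_def pev_simps pev_z)
    ultimately have "pev (f u) a = 0"
      using E(3) a u by blast
    then have "r u = 0" using u by (simp add: f_def pev_simps pev_z)
    with r[of u] q0 show ?thesis by (simp add: zero_power)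
  qed

  have Const_a: "peval Const f (\<lambda>v. Const (a v)) = (Const (pev f a) :: ('v, 'k) mpoly)" for f :: "('v, 'k) mpoly"
    by (simp add: ring_map_comp_peval[OF ring_map_Const])
  have Var_eq: "Var = (\<lambda>v. Const (a v) + z v)"
    by (simp add: z_def)
  \<comment> \<open>Generation: the polynomials in the coordinates together with \<open>J\<close> exhaust all polynomials.\<close>
  define S where "S = {P + j | P j. P \<in> polys_in B \<and> j \<in> J}"
  have polys_S: "P \<in> S" if "P \<in> polys_in B" for P
    using that JI(1) by (force simp: S_def)
  have J_S: "J \<subseteq> S"
    using polys_in.Const[of 0 B] by (force simp: S_def ring_map_zero[OF ring_map_Const])
  have S_add: "x + y \<in> S" if "x \<in> S" "y \<in> S" for x y
  proof -
    from that obtain P j P' j' where "x = P + j" "y = P' + j'" "P \<in> polys_in B" "P' \<in> polys_in B" "j \<in> J" "j' \<in> J"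
      by (auto simp: S_def)
    then show ?thesis unfolding S_def
      by (intro CollectI exI[of _ "P + P'"] exI[of _ "j + j'"]) (auto intro: polys_in.add JI(2))
  qed
  have S_mult: "x * y \<in> S" if "x \<in> S" "y \<in> S" for x y
  proof -
    from that obtain P j P' j' where "x = P + j" "y = P' + j'" "P \<in> polys_in B" "P' \<in> polys_in B" "j \<in> J" "j' \<in> J"
      by (auto simp: S_def)
    moreover from this have "P * j' + j * P' + j * j' \<in> J" by (intro JI(2-4))
    ultimately show ?thesis unfolding S_def
      by (intro CollectI exI[of _ "P * P'"] exI[of _ "P * j' + j * P' + j * j'"])
         (auto intro: polys_in_mult simp: algebra_simps)
  qed
  have S_sum: "sum g A \<in> S" if "\<And>b. b \<in> A \<Longrightarrow> g b \<in> S" for g and A :: "'v set"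
    using that by (induction A rule: infinite_finite_induct) (use J_S JI(1) in \<open>auto intro: S_add\<close>)
  have Const_S: "Const c \<in> S" for c
    by (intro polys_S polys_in.Const)
  have z_B: "z b \<in> S" if "b \<in> B" for b
    using S_add[OF polys_S[OF polys_in_Var[OF that]] Const_S[of "- a b"]]
    by (simp add: z_def ring_map_minus[OF ring_map_Const])
  have all_S: "f \<in> S" for f
  proof (rule nakayama[where z = z and Q = Q and q = q])
    show "0 \<in> S" using J_S JI(1) by blast
    show "is_ideal Q" "Q \<subseteq> S" "0 < q" using ideals Q_J J_S q0 by auto
    show "z v ^ q \<in> Q" for v unfolding Q_def by (rule power_ideal_generator)
    show "\<exists>s\<in>S. f - s \<in> ideal_pow z 1" for f
    proof -
      have "peval Const f Var - peval Const f (\<lambda>v. Const (a v)) \<in> ideal_pow z 1"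
        by (intro peval_cong_mod_ideal[OF ring_map_Const is_ideal_ideal_pow])
           (use ideal_pow_generator[of z] in \<open>simp only: z_def\<close>)
      then show ?thesis
        using Const_S by (auto simp only: peval_Const_Var Const_a)
    qed
    show "\<exists>s\<in>S. z c - s \<in> ideal_pow z 2" for c
    proof (cases "c \<in> B")
      case True
      then show ?thesis using z_B is_ideal_0[OF is_ideal_ideal_pow, of z 2] by force
    next
      case False
      obtain f where f: "f \<in> ideal_of V" "\<And>v. v \<notin> B \<Longrightarrow> pev (pd v f) a = (if v = c then 1 else 0)"
        using conormal[OF a(1) Da False] by blast
      \<comment> \<open>Taylor expansion of \<open>f\<close> at \<open>a\<close> expresses \<open>z c\<close> by \<open>f\<close> and the \<open>z b\<close> up to second order.\<close>
      define l where "l = (\<Sum>b\<in>B. Const (- pev (pd b f) a) * z b)"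
      have "l \<in> S"
        unfolding l_def by (intro S_sum S_mult Const_S z_B)
      then have fl: "f + l \<in> S" using f(1) I_J J_S by (intro S_add) (auto simp: I_def)
      have "z v * z w \<in> ideal_pow z 2" for v w
        using ideal_pow_mult[OF ideal_pow_generator ideal_pow_generator, of z v w] by (simp add: numeral_2_eq_2)
      then have taylor: "peval Const f (\<lambda>v. Const (a v) + z v) - peval Const f (\<lambda>v. Const (a v))
          - differential Const f (\<lambda>v. Const (a v)) z \<in> ideal_pow z 2"
        by (intro taylor_mod_ideal ring_map_Const is_ideal_ideal_pow)
      have "differential Const f (\<lambda>v. Const (a v)) z
          = (\<Sum>v\<in>B. Const (pev (pd v f) a) * z v) + (\<Sum>v\<in>-B. Const (pev (pd v f) a) * z v)"
        unfolding differential_def Const_a by (subst sum.union_disjoint[symmetric]) auto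
      also have "(\<Sum>v\<in>-B. Const (pev (pd v f) a) * z v) = (\<Sum>v\<in>-B. if v = c then z c else 0)"
        by (intro sum.cong) (auto simp: f ring_mapD[OF ring_map_Const])
      also have "\<dots> = z c" using False by simp
      also have "(\<Sum>v\<in>B. Const (pev (pd v f) a) * z v) = - l"
        by (simp add: l_def sum_negf[symmetric] ring_map_minus[OF ring_map_Const])
      finally have "differential Const f (\<lambda>v. Const (a v)) z = z c - l" by simp
      moreover have "(Const (pev f a) :: ('v, 'k) mpoly) = 0"
        using f(1) a(1) by (simp add: ideal_of_def ring_map_zero[OF ring_map_Const])
      ultimately have "f - (z c - l) \<in> ideal_pow z 2"
        using taylor by (simp only: Var_eq[symmetric] peval_Const_Var Const_a diff_zero)
      from is_ideal_minus[OF is_ideal_ideal_pow this] have "z c - (f + l) \<in> ideal_pow z 2"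
        by (simp add: algebra_simps)
      with fl show ?thesis by blast
    qed
  qed (use S_add S_mult in auto)
  then have "\<forall>v. \<exists>P j. Var v = P + j \<and> P \<in> polys_in B \<and> j \<in> J"
    by (auto simp: S_def)
  then obtain P where P: "\<And>v. P v \<in> polys_in B" and P_J: "\<And>v. Var v - P v \<in> J"
    by (metis add_diff_cancel_left')

  \<comment> \<open>Comparison of both: modulo \<open>Q\<close> a polynomial in the coordinates is a combination of reduced
    monomials with constant coefficients, and these vanish if it lies in \<open>J\<close>.\<close>
  have polys_J: "h \<in> Q" if h: "h \<in> polys_in B" "h \<in> J" for h
  proof -
    define K where "K = {Const c + n | c n. n \<in> Q}"
    have "\<exists>k. (\<forall>u. k u \<in> K) \<and> h = (\<Sum>u\<in>Exps q B. k u * mon u Var)"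
    proof (rule polys_in_reduced)
      show "Const c \<in> K" for c using is_ideal_0[OF ideals(2)] by (force simp: K_def)
      show "x + y \<in> K" if "x \<in> K" "y \<in> K" for x y
      proof -
        from that obtain c n c' n' where "x = Const c + n" "y = Const c' + n'" "n \<in> Q" "n' \<in> Q"
          by (auto simp: K_def)
        then show ?thesis unfolding K_def
          by (intro CollectI exI[of _ "c + c'"] exI[of _ "n + n'"])
             (auto intro: is_ideal_add[OF ideals(2)] simp: ring_map_add[OF ring_map_Const])
      qed
      show "x * y \<in> K" if "x \<in> K" "y \<in> K" for x y
      proof -
        from that obtain c n c' n' where "x = Const c + n" "y = Const c' + n'" "n \<in> Q" "n' \<in> Q"
          by (auto simp: K_def)
        moreover from this have "Const c * n' + n * Const c' + n * n' \<in> Q"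
          by (intro is_idealD(2-4)[OF ideals(2)])
        ultimately show ?thesis unfolding K_def
          by (intro CollectI exI[of _ "c * c'"] exI[of _ "Const c * n' + n * Const c' + n * n'"])
             (auto simp: ring_map_mult[OF ring_map_Const] algebra_simps)
      qed
      show "Var v ^ q \<in> K" for v
      proof -
        have "Var v ^ q = Const (a v ^ q) + z v ^ q"
          using freshman_mpoly[of "Const (a v)" "z v"] by (simp add: z_def ring_map_power[OF ring_map_Const])
        then show ?thesis
          using power_ideal_generator[of z v q] by (auto simp: K_def Q_def)
      qed
    qed (use q0 h in auto)
    then obtain k where k: "\<And>u. k u \<in> K" and hk: "h = (\<Sum>u\<in>X. k u * mon u Var)"
      by (auto simp: X_def)
    from k have "\<forall>u. \<exists>c n. n \<in> Q \<and> k u = Const c + n" by (force simp: K_def)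
    then obtain c n where cn: "\<And>u. n u \<in> Q" "\<And>u. k u = Const (c u) + n u" by metis
    have nQ: "(\<Sum>u\<in>X. n u * mon u Var) \<in> Q"
      by (intro is_ideal_sum[OF ideals(2)] is_ideal_mult_right[OF ideals(2)] cn)
    have h_eq: "h = (\<Sum>u\<in>X. Const (c u) * mon u Var) + (\<Sum>u\<in>X. n u * mon u Var)"
      by (simp add: hk cn distrib_right sum.distrib)
    then have "(\<Sum>u\<in>X. Const (c u) * mon u Var) \<in> J"
      using JI(6)[OF h(2), of "\<Sum>u\<in>X. n u * mon u Var"] nQ Q_J by auto
    then have "c u = 0" if "u \<in> X" for u
      using free that by blast
    then have "(\<Sum>u\<in>X. Const (c u) * mon u Var) = 0"
      by (simp add: ring_map_zero[OF ring_map_Const])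
    with nQ h_eq show ?thesis by simp
  qed

  show ?thesis
  proof (intro bexI[of _ a] ballI)
    fix x assume x: "x \<in> tangent V a"
    define \<eta> where "\<eta> = (\<lambda>v. [:a v, x v:])"
    define \<gamma> where "\<gamma> = (\<lambda>v. pev_t (P v) \<eta>)"
    have Q_t: "[:0, 1:]^q dvd pev_t n \<eta>" if n: "n \<in> Q" for n
    proof -
      obtain h where h: "n = (\<Sum>v\<in>UNIV. z v ^ q * h v)"
        using n unfolding Q_def by (rule power_idealE)
      have "pev_t (z v) \<eta> = [:0, 1:] * [:x v:]" for v
        by (simp add: z_def peval_diff peval_Var peval_Const ring_map_const_poly \<eta>_def)
      then show ?thesis
        unfolding h by (auto simp only: peval_sum[OF ring_map_const_poly] peval_mult[OF ring_map_const_poly]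
            peval_power[OF ring_map_const_poly] power_mult_distrib mult.assoc intro!: dvd_sum dvd_triv_left)
    qed
    have I_t: "[:0, 1:]^2 dvd pev_t i \<eta>" if "i \<in> I" for i
      using pev_t_first_order[of i a x] that a(1) x
      by (simp add: I_def ideal_of_def tangent_def \<eta>_def)
    have "[:0, 1:]^2 dvd \<gamma> v - \<eta> v" for v
    proof -
      obtain i n where "i \<in> I" "n \<in> Q" and in_eq: "Var v - P v = i + n"
        using P_J[of v] by (auto simp: J_def)
      then have "[:0, 1:]^2 dvd pev_t (i + n) \<eta>"
        using I_t dvd_trans[OF le_imp_power_dvd[OF q2] Q_t]
        by (simp add: peval_add[OF ring_map_const_poly])
      then have "[:0, 1:]^2 dvd - pev_t (Var v - P v) \<eta>"
        by (simp only: in_eq dvd_minus_iff)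
      then show ?thesis
        by (simp add: peval_diff peval_Var ring_map_const_poly \<gamma>_def)
    qed
    moreover have "[:0, 1:]^N dvd pev_t f \<gamma>" if f: "f \<in> ideal_of V" for f
    proof -
      have "peval Const f P - peval Const f Var \<in> J"
      proof (intro peval_cong_mod_ideal[OF ring_map_Const ideals(3)])
        show "P v - Var v \<in> J" for v using JI(5)[OF P_J[of v]] by (simp only: minus_diff_eq)
      qed
      then have "peval Const f P - f \<in> J" by (simp only: peval_Const_Var)
      moreover have "f \<in> J" using f I_J by (auto simp: I_def)
      ultimately have "peval Const f P - f + f \<in> J" by (rule JI(2))
      then have "peval Const f P \<in> J" by simp
      then have "peval Const f P \<in> Q"
        by (intro polys_J polys_in_peval_Const P)
      then have "[:0, 1:]^q dvd pev_t (peval Const f P) \<eta>" by (rule Q_t)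
      then have "[:0, 1:]^q dvd pev_t f \<gamma>"
        unfolding peval_subst[OF ring_map_const_poly] \<gamma>_def .
      then show ?thesis by (rule dvd_trans[OF le_imp_power_dvd[OF qN]])
    qed
    ultimately show "\<exists>\<gamma>. (\<forall>v. [:0, 1:]^2 dvd \<gamma> v - [:a v, x v:]) \<and>
        (\<forall>f\<in>ideal_of V. [:0, 1:]^N dvd pev_t f \<gamma>)"
      by (intro exI[of _ \<gamma>]) (auto simp: \<eta>_def)
  qed (fact a(1))
qed

section \<open>Polynomial matrices modulo powers of t\<close>

lemma t_power_eq_monom: "[:0, 1:] ^ n = (monom 1 n :: 'k::comm_ring_1 poly)"
  by (simp add: monom_altdef)

lemma monom_1_dvd_iff_coeff: "monom 1 n dvd (p :: 'k::field poly) \<longleftrightarrow> (\<forall>i<n. coeff p i = 0)"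
  by (rule monom_1_dvd_iff')

lemma monom_1_dvd_mono: "m \<le> n \<Longrightarrow> monom 1 m dvd (monom 1 n :: 'k::field poly)"
  by (simp add: monom_1_dvd_iff_coeff)

definition mcong :: "nat \<Rightarrow> 'k::field poly^'n^'n \<Rightarrow> 'k poly^'n^'n \<Rightarrow> bool" where
  "mcong k A B \<longleftrightarrow> (\<forall>i j. monom 1 k dvd A $ i $ j - B $ i $ j)"

lemma mcong_refl: "mcong k A A"
  by (simp add: mcong_def)

lemma mcong_sym: "mcong k A B \<Longrightarrow> mcong k B A"
  unfolding mcong_def using dvd_diff_commute by blast

lemma mcong_trans [trans]:
  assumes "mcong k A B" "mcong k B C"
  shows "mcong k A C"
  unfolding mcong_def
proof (intro allI)
  fix i j
  have "monom 1 k dvd (A $ i $ j - B $ i $ j) + (B $ i $ j - C $ i $ j)"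
    by (rule dvd_add) (use assms in \<open>simp_all add: mcong_def\<close>)
  then show "monom 1 k dvd A $ i $ j - C $ i $ j" by simp
qed

lemma mcong_mono: "mcong n A B \<Longrightarrow> m \<le> n \<Longrightarrow> mcong m A B"
  unfolding mcong_def using monom_1_dvd_mono dvd_trans by blast

lemma mcong_add: "mcong k A B \<Longrightarrow> mcong k A' B' \<Longrightarrow> mcong k (A + A') (B + B')"
  unfolding mcong_def by (simp add: add_diff_add dvd_add)

lemma mcong_diff:
  assumes "mcong k A B" "mcong k A' B'"
  shows "mcong k (A - A') (B - B')"
  unfolding mcong_def
proof (intro allI)
  fix i j
  have "monom 1 k dvd (A $ i $ j - B $ i $ j) - (A' $ i $ j - B' $ i $ j)"
    by (rule dvd_diff) (use assms in \<open>simp_all add: mcong_def\<close>)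
  then show "monom 1 k dvd (A - A') $ i $ j - (B - B') $ i $ j" by (simp add: algebra_simps)
qed

lemma matrix_diff_ldistrib: "A ** (B - C) = A ** B - A ** (C :: 'r::comm_ring_1^'p^'n)"
  by (simp add: matrix_matrix_mult_def vec_eq_iff sum_subtractf right_diff_distrib)

lemma matrix_diff_rdistrib: "(B - C) ** A = B ** A - C ** (A :: 'r::comm_ring_1^'p^'n)"
  by (simp add: matrix_matrix_mult_def vec_eq_iff sum_subtractf left_diff_distrib)

lemma mcong_mult:
  assumes "mcong k A B" "mcong k A' B'"
  shows "mcong k (A ** A') (B ** B')"
proof -
  have "mcong k (A ** A') (A ** B')"
    using assms(2) unfolding mcong_def
    by (auto simp: matrix_matrix_mult_def sum_subtractf[symmetric] right_diff_distrib[symmetric]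
        intro!: dvd_sum dvd_mult)
  also have "mcong k (A ** B') (B ** B')"
    using assms(1) unfolding mcong_def
    by (auto simp: matrix_matrix_mult_def sum_subtractf[symmetric] left_diff_distrib[symmetric]
        intro!: dvd_sum dvd_mult2)
  finally show ?thesis .
qed

lemma mcong_mult_left: "mcong k A' B' \<Longrightarrow> mcong k (A ** A') (A ** B')"
  by (rule mcong_mult[OF mcong_refl])

lemma mcong_mult_right: "mcong k A B \<Longrightarrow> mcong k (A ** A') (B ** A')"
  by (rule mcong_mult[OF _ mcong_refl])

definition mapm :: "('a \<Rightarrow> 'b) \<Rightarrow> 'a^'n^'n \<Rightarrow> 'b^'n^'n" where
  "mapm h A = (\<chi> i j. h (A $ i $ j))"

lemma mapm_mult: "ring_map h \<Longrightarrow> mapm h (A ** B) = mapm h A ** mapm h B"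
  by (simp add: mapm_def matrix_matrix_mult_def vec_eq_iff ring_mapD)

lemma mapm_mat_1: "ring_map h \<Longrightarrow> mapm h (mat 1) = mat 1"
  by (simp add: mapm_def mat_def vec_eq_iff ring_mapD)

lemma mapm_add: "ring_map h \<Longrightarrow> mapm h (A + B) = mapm h A + mapm h B"
  by (simp add: mapm_def vec_eq_iff ring_mapD)

lemma mapm_diff: "ring_map h \<Longrightarrow> mapm h (A - B) = mapm h A - mapm h B"
  by (simp add: mapm_def vec_eq_iff ring_mapD)

abbreviation const_mat :: "'k::field^'n^'n \<Rightarrow> 'k poly^'n^'n" where
  "const_mat \<equiv> mapm (\<lambda>c. [:c:])"

definition t_times :: "nat \<Rightarrow> 'k::field poly^'n^'n \<Rightarrow> 'k poly^'n^'n" where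
  "t_times k = mscale (monom 1 k)"

lemma t_times_mult: "t_times k A ** B = t_times k (A ** B)" "A ** t_times k B = t_times k (A ** B)"
  by (simp_all add: t_times_def mscale_def matrix_matrix_mult_def vec_eq_iff sum_distrib_left mult_ac)

lemma t_times_add: "t_times k (A + B) = t_times k A + t_times k B"
  by (simp add: t_times_def mscale_def vec_eq_iff distrib_left)

lemma t_times_diff: "t_times k (A - B) = t_times k A - t_times k B"
  by (simp add: t_times_def mscale_def vec_eq_iff right_diff_distrib)

lemma t_times_t_times: "t_times k (t_times l A) = t_times (k + l) A"
  by (simp add: t_times_def mscale_def vec_eq_iff mult_monom flip: mult.assoc)

lemma monom_1_add: "monom 1 (k + l) = (monom 1 k * monom 1 l :: 'k::comm_semiring_1 poly)"
  by (simp add: mult_monom)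

lemma mcong_t_times: "mcong l A B \<Longrightarrow> mcong (k + l) (t_times k A) (t_times k B)"
  unfolding mcong_def t_times_def mscale_def
  by (simp add: right_diff_distrib[symmetric] monom_1_add mult_dvd_mono)

lemma mcong_t_times_0: "mcong k (t_times k A) 0"
  by (simp add: mcong_def t_times_def mscale_def)

lemma mcong_iff_t_times: "mcong k A B \<longleftrightarrow> (\<exists>C. A = B + t_times k C)"
proof
  assume "mcong k A B"
  then have "\<exists>c. A $ i $ j - B $ i $ j = monom 1 k * c" for i j
    by (auto simp: mcong_def dvd_def)
  then obtain c where "\<And>i j. A $ i $ j - B $ i $ j = monom 1 k * c i j" by metis
  then show "\<exists>C. A = B + t_times k C"
    by (intro exI[of _ "\<chi> i j. c i j"]) (simp add: vec_eq_iff t_times_def mscale_def eq_diff_eq' diff_eq_eq add.commute)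
qed (auto simp: mcong_def t_times_def mscale_def)

section \<open>Matrices as points of affine space\<close>

definition entries :: "'r^'n^'n \<Rightarrow> 'n \<times> 'n \<Rightarrow> 'r" where
  "entries A = (\<lambda>v. A $ fst v $ snd v)"

lemma eval_at_eq_peval: "eval_at \<phi> f A = peval \<phi> f (entries A)"
  by (simp add: eval_at_def peval_def entries_def)

lemma vanishing_ideal_eq: "vanishing_ideal G = ideal_of (entries ` G)"
  by (simp add: vanishing_ideal_def ideal_of_def eval_at_eq_peval)

lemma entries_mapm: "entries (mapm h A) = (\<lambda>v. h (entries A v))"
  by (simp add: entries_def mapm_def)

lemma entries_surj: "\<exists>A. entries A = a"
  by (intro exI[of _ "\<chi> i j. a (i, j)"]) (simp add: entries_def)

lemma entries_add: "entries (A + B) = (\<lambda>v. entries A v + entries B v)"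
  by (simp add: entries_def)

lemma entries_diff: "entries (A - B) = (\<lambda>v. entries A v - entries B v)"
  by (simp add: entries_def)

lemma differential_chain:
  assumes \<phi>: "ring_map \<phi>"
  shows "differential \<phi> (peval Const f P) a x = differential \<phi> f (\<lambda>v. peval \<phi> (P v) a) (\<lambda>v. differential \<phi> (P v) a x)"
  by (induction f rule: mpoly_induct)
     (simp_all add: peval_Const peval_add peval_mult_Var peval_subst peval_Var ring_map_Const \<phi>
       differential_Const[OF \<phi>] differential_add[OF \<phi>] differential_mult[OF \<phi>] differential_Var[OF \<phi>])

definition Var_mat :: "('n \<times> 'n, 'k::comm_ring_1) mpoly^'n^'n" where
  "Var_mat = (\<chi> i j. Var (i, j))"

text \<open>The pullbacks of a polynomial function under left and right translation by \<open>g\<close>.\<close>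

definition lsubst :: "'k::field^'n^'n \<Rightarrow> ('n \<times> 'n, 'k) mpoly \<Rightarrow> ('n \<times> 'n, 'k) mpoly" where
  "lsubst g f = peval Const f (entries (mapm Const g ** Var_mat))"

definition rsubst :: "'k::field^'n^'n \<Rightarrow> ('n \<times> 'n, 'k) mpoly \<Rightarrow> ('n \<times> 'n, 'k) mpoly" where
  "rsubst g f = peval Const f (entries (Var_mat ** mapm Const g))"

lemma peval_entries_lmult:
  "ring_map \<phi> \<Longrightarrow> peval \<phi> (entries (mapm Const g ** Var_mat) v) (entries A) = entries (mapm \<phi> g ** A) v"
  by (simp add: entries_def matrix_matrix_mult_def mapm_def Var_mat_def peval_sum peval_mult peval_Const peval_Var)

lemma peval_entries_rmult:
  "ring_map \<phi> \<Longrightarrow> peval \<phi> (entries (Var_mat ** mapm Const g) v) (entries A) = entries (A ** mapm \<phi> g) v"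
  by (simp add: entries_def matrix_matrix_mult_def mapm_def Var_mat_def peval_sum peval_mult peval_Const peval_Var)

lemma peval_lsubst: "ring_map \<phi> \<Longrightarrow> peval \<phi> (lsubst g f) (entries A) = peval \<phi> f (entries (mapm \<phi> g ** A))"
  by (simp add: lsubst_def peval_subst peval_entries_lmult)

lemma peval_rsubst: "ring_map \<phi> \<Longrightarrow> peval \<phi> (rsubst g f) (entries A) = peval \<phi> f (entries (A ** mapm \<phi> g))"
  by (simp add: rsubst_def peval_subst peval_entries_rmult)

lemma mapm_id: "mapm (\<lambda>c. c) A = A"
  by (simp add: mapm_def vec_eq_iff)

lemma diff_at_lsubst: "diff_at (lsubst g f) (entries A) (entries V) = diff_at f (entries (g ** A)) (entries (g ** V))"
proof -
  have "diff_at (entries (mapm Const g ** Var_mat) v) (entries A) (entries V) = entries (g ** V) v" for v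
    by (simp add: entries_def matrix_matrix_mult_def mapm_def Var_mat_def diff_at_sum diff_at_simps pev_simps)
  then show ?thesis
    by (simp add: lsubst_def differential_chain[OF ring_map_id] peval_entries_lmult[OF ring_map_id] mapm_id)
qed

lemma diff_at_rsubst: "diff_at (rsubst g f) (entries A) (entries V) = diff_at f (entries (A ** g)) (entries (V ** g))"
proof -
  have "diff_at (entries (Var_mat ** mapm Const g) v) (entries A) (entries V) = entries (V ** g) v" for v
    by (simp add: entries_def matrix_matrix_mult_def mapm_def Var_mat_def diff_at_sum diff_at_simps pev_simps mult.commute)
  then show ?thesis
    by (simp add: rsubst_def differential_chain[OF ring_map_id] peval_entries_rmult[OF ring_map_id] mapm_id)
qed

section \<open>Points of matrix groups over truncated polynomial rings\<close>

text \<open>Polynomial matrices whose class modulo \<open>t\<^sup>N\<close> satisfies the equations of \<open>G\<close>. They are not reduced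
  modulo \<open>t\<^sup>N\<close>, so that ordinary matrix multiplication can be used.\<close>

definition jets :: "nat \<Rightarrow> ('k::field^'n^'n) set \<Rightarrow> ('k poly^'n^'n) set" where
  "jets N G = {A. \<forall>f\<in>vanishing_ideal G. monom 1 N dvd pev_t f (entries A)}"

lemma jets_cong:
  assumes "A \<in> jets N G" "mcong N B A"
  shows "B \<in> jets N G"
  unfolding jets_def
proof (intro CollectI ballI)
  fix f assume "f \<in> vanishing_ideal G"
  then have "monom 1 N dvd pev_t f (entries A)" using assms(1) by (simp add: jets_def)
  moreover have "pev_t f (entries B) - pev_t f (entries A) \<in> {p. monom 1 N dvd p}"
    using assms(2) by (intro peval_cong_mod_ideal[OF ring_map_const_poly is_ideal_multiples])
      (simp add: mcong_def entries_def)
  ultimately show "monom 1 N dvd pev_t f (entries B)"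
    by (simp add: dvd_diff_left_iff)
qed

lemma ring_map_map_poly: "ring_map h \<Longrightarrow> ring_map (map_poly h)"
  unfolding ring_map_def[of "map_poly h"]
  by (auto simp: poly_eq_iff coeff_map_poly coeff_mult ring_map_zero ring_map_add ring_map_sum ring_map_mult ring_map_one)

lemma subgroup_GL:
  assumes "subgroup G GL"
  shows subgroup_GL_one: "mat 1 \<in> G"
    and subgroup_GL_mult: "\<And>g h. g \<in> G \<Longrightarrow> h \<in> G \<Longrightarrow> g ** h \<in> G"
    and subgroup_GL_inverse: "\<And>g. g \<in> G \<Longrightarrow> \<exists>h\<in>G. h ** g = mat 1"
proof -
  interpret subgroup G GL by fact
  show "mat 1 \<in> G" using one_closed by (simp add: GL_def units_of_def Mat_def)
  show "\<And>g h. g \<in> G \<Longrightarrow> h \<in> G \<Longrightarrow> g ** h \<in> G"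
    using m_closed by (simp add: GL_def units_of_def Mat_def)
  fix g assume g: "g \<in> G"
  interpret Mat: monoid "Mat :: ('a^'b^'b) monoid"
    by standard (simp_all add: Mat_def matrix_mul_assoc)
  have "group (GL :: ('a^'b^'b) monoid)"
    unfolding GL_def by (rule Mat.units_group)
  then have "inv\<^bsub>GL\<^esub> g \<otimes>\<^bsub>GL\<^esub> g = \<one>\<^bsub>GL\<^esub>"
    using g subset by (intro group.l_inv) auto
  with m_inv_closed[OF g] show "\<exists>h\<in>G. h ** g = mat 1"
    by (intro bexI[of _ "inv\<^bsub>GL\<^esub> g"]) (simp_all add: GL_def units_of_def Mat_def)
qed

lemma lsubst_vanishing:
  assumes "subgroup G GL" "g \<in> G" "f \<in> vanishing_ideal G"
  shows "lsubst g f \<in> vanishing_ideal G"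
  using assms subgroup_GL_mult[OF assms(1,2)]
  by (auto simp: vanishing_ideal_eq ideal_of_def peval_lsubst[OF ring_map_id] mapm_id)

lemma rsubst_vanishing:
  assumes "subgroup G GL" "g \<in> G" "f \<in> vanishing_ideal G"
  shows "rsubst g f \<in> vanishing_ideal G"
  using assms subgroup_GL_mult[OF assms(1) _ assms(2)]
  by (auto simp: vanishing_ideal_eq ideal_of_def peval_rsubst[OF ring_map_id] mapm_id)

section \<open>The monoid of matrices over the truncated polynomial ring\<close>

definition reduce :: "nat \<Rightarrow> 'k::field poly^'n^'n \<Rightarrow> 'k poly^'n^'n" where
  "reduce m = mapm (\<lambda>p. p mod monom 1 (Suc m))"

lemma mcong_reduce: "mcong (Suc m) (reduce m A) A"
  by (simp add: mcong_def reduce_def mapm_def mod_eq_dvd_iff[symmetric])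

lemma reduce_eq_iff: "reduce m A = reduce m B \<longleftrightarrow> mcong (Suc m) A B"
  by (simp add: mcong_def reduce_def mapm_def vec_eq_iff mod_eq_dvd_iff)

lemma TMat_mult: "A \<otimes>\<^bsub>TMat m\<^esub> B = reduce m (A ** B)"
  by (simp add: TMat_def reduce_def mapm_def)

lemma TMat_one: "\<one>\<^bsub>TMat m\<^esub> = mat 1"
  by (simp add: TMat_def)

lemma carrier_TMat_iff: "A \<in> carrier (TMat m) \<longleftrightarrow> reduce m A = A"
proof -
  have "degree p \<le> m \<longleftrightarrow> p mod monom 1 (Suc m) = p" for p :: "'a poly"
  proof
    assume "degree p \<le> m"
    then show "p mod monom 1 (Suc m) = p"
      by (intro mod_poly_less) (simp add: degree_monom_eq)
  next
    assume "p mod monom 1 (Suc m) = p"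
    moreover have "monom (1 :: 'a) (Suc m) \<noteq> 0" by simp
    ultimately show "degree p \<le> m"
      using degree_mod_less[of "monom 1 (Suc m)" p] by (auto simp: degree_monom_eq)
  qed
  then show ?thesis
    by (simp add: TMat_def reduce_def mapm_def vec_eq_iff)
qed

lemma reduce_reduce: "reduce m (reduce m A) = reduce m A"
  using mcong_reduce by (simp add: reduce_eq_iff)

lemma reduce_mat_1: "reduce m (mat 1) = mat 1"
proof -
  have "(mat 1 :: 'a poly^'b^'b) \<in> carrier (TMat m)"
    by (simp add: TMat_def mat_def)
  then show ?thesis by (simp only: carrier_TMat_iff)
qed

lemma monoid_TMat: "monoid (TMat m :: ('k::field poly^'n^'n) monoid)"
proof
  fix A B C :: "'k poly^'n^'n"
  assume "A \<in> carrier (TMat m)" "B \<in> carrier (TMat m)" "C \<in> carrier (TMat m)"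
  have "mcong (Suc m) (reduce m (A ** B) ** C) (A ** B ** C)"
    by (intro mcong_mult_right mcong_reduce)
  moreover have "mcong (Suc m) (A ** reduce m (B ** C)) (A ** (B ** C))"
    by (intro mcong_mult_left mcong_reduce)
  ultimately have "mcong (Suc m) (reduce m (A ** B) ** C) (A ** reduce m (B ** C))"
    by (metis matrix_mul_assoc mcong_sym mcong_trans)
  then show "A \<otimes>\<^bsub>TMat m\<^esub> B \<otimes>\<^bsub>TMat m\<^esub> C = A \<otimes>\<^bsub>TMat m\<^esub> (B \<otimes>\<^bsub>TMat m\<^esub> C)"
    by (simp add: TMat_mult reduce_eq_iff)
qed (simp_all add: TMat_mult TMat_one carrier_TMat_iff reduce_reduce reduce_mat_1)

text \<open>Successive approximation: if \<open>A B = 1 + t\<^sup>k E\<close>, then \<open>B - t\<^sup>k E\<close> is an inverse to one more order.\<close>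

lemma right_inverse_mod_t:
  assumes "mcong 1 A (mat 1)"
  shows "\<exists>B. mcong k (A ** B) (mat 1)"
proof (induction k)
  case 0
  then show ?case by (simp add: mcong_def)
next
  case (Suc k)
  then obtain B E where E: "A ** B = mat 1 + t_times k E"
    by (auto simp: mcong_iff_t_times)
  have "A ** (B - t_times k E) = mat 1 + t_times k (E - A ** E)"
    by (simp add: matrix_diff_ldistrib E t_times_mult t_times_diff)
  moreover have "mcong (k + 1) (t_times k (E - A ** E)) (t_times k 0)"
  proof (intro mcong_t_times)
    have "mcong 1 (E - A ** E) (E - mat 1 ** E)"
      by (intro mcong_diff mcong_refl mcong_mult_right assms)
    then show "mcong 1 (E - A ** E) 0" by simp
  qed
  ultimately have "mcong (Suc k) (A ** (B - t_times k E)) (mat 1 + t_times k 0)"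
    by (simp add: mcong_add mcong_refl)
  then show ?case by (auto simp: t_times_def mscale_def vec_eq_iff mcong_def)
qed

lemma left_inverse_mod_t:
  assumes "mcong 1 A (mat 1)"
  shows "\<exists>B. mcong k (B ** A) (mat 1)"
proof (induction k)
  case 0
  then show ?case by (simp add: mcong_def)
next
  case (Suc k)
  then obtain B E where E: "B ** A = mat 1 + t_times k E"
    by (auto simp: mcong_iff_t_times)
  have "(B - t_times k E) ** A = mat 1 + t_times k (E - E ** A)"
    by (simp add: matrix_diff_rdistrib E t_times_mult t_times_diff)
  moreover have "mcong (k + 1) (t_times k (E - E ** A)) (t_times k 0)"
  proof (intro mcong_t_times)
    have "mcong 1 (E - E ** A) (E - E ** mat 1)"
      by (intro mcong_diff mcong_refl mcong_mult_left assms)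
    then show "mcong 1 (E - E ** A) 0" by simp
  qed
  ultimately have "mcong (Suc k) ((B - t_times k E) ** A) (mat 1 + t_times k 0)"
    by (simp add: mcong_add mcong_refl)
  then show ?case by (auto simp: t_times_def mscale_def vec_eq_iff mcong_def)
qed

lemma reduce_in_Units_TMat:
  assumes "mcong 1 A (mat 1)"
  shows "reduce m A \<in> Units (TMat m)"
proof -
  interpret monoid "TMat m :: ('a poly^'b^'b) monoid" by (rule monoid_TMat)
  obtain B C where "mcong (Suc m) (A ** B) (mat 1)" "mcong (Suc m) (C ** A) (mat 1)"
    using right_inverse_mod_t[OF assms] left_inverse_mod_t[OF assms] by blast
  then have "mcong (Suc m) (reduce m A ** reduce m B) (mat 1)" "mcong (Suc m) (reduce m C ** reduce m A) (mat 1)"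
    by (meson mcong_mult mcong_reduce mcong_trans)+
  then have inv: "reduce m A \<otimes>\<^bsub>TMat m\<^esub> reduce m B = \<one>\<^bsub>TMat m\<^esub>" "reduce m C \<otimes>\<^bsub>TMat m\<^esub> reduce m A = \<one>\<^bsub>TMat m\<^esub>"
    by (metis TMat_mult TMat_one reduce_eq_iff reduce_mat_1)+
  have carr: "reduce m A \<in> carrier (TMat m)" "reduce m B \<in> carrier (TMat m)" "reduce m C \<in> carrier (TMat m)"
    by (simp_all add: carrier_TMat_iff reduce_reduce)
  have "reduce m C = reduce m B"
    by (metis inv carr m_assoc l_one r_one)
  with inv carr show ?thesis
    unfolding Units_def by auto
qed

lemma trunc_current_group_iff:
  "A \<in> trunc_current_group m G \<longleftrightarrow> A \<in> Units (TMat m) \<and> A \<in> jets (Suc m) G"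
  by (simp add: trunc_current_group_def jets_def eval_at_eq_peval mod_eq_0_iff_dvd)

lemma tensor_t_eq: "x \<otimes>t i = t_times i (const_mat x)"
  by (simp add: tensor_t_def t_times_def mscale_def mapm_def vec_eq_iff monom_altdef smult_monom_mult)

section \<open>The Lie algebra and arcs in the group\<close>

lemma Lie_iff:
  assumes "mat 1 \<in> G"
  shows "x \<in> Lie G \<longleftrightarrow> (\<forall>f\<in>vanishing_ideal G. diff_at f (entries (mat 1)) (entries x) = 0)"
proof -
  let ?A = "mat 1 \<otimes>t 0 + x \<otimes>t 1 :: 'a poly^'b^'b"
  have entries: "entries ?A = (\<lambda>v. [:entries (mat 1) v, entries x v:])"
    by (simp add: entries_def tensor_t_def monom_0 monom_altdef)
  have "mcong 1 ?A (mat 1)"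
    by (auto simp: mcong_def tensor_t_def monom_1_dvd_iff_coeff mat_def)
  then have "reduce 1 ?A \<in> Units (TMat 1)" by (rule reduce_in_Units_TMat)
  moreover have "reduce 1 ?A = ?A"
  proof -
    have "degree (monom a 0 + monom b 1) \<le> 1" for a b :: 'a
      by (intro degree_add_le) (simp_all add: degree_monom_le[THEN order_trans])
    then have "?A \<in> carrier (TMat 1)"
      by (simp add: TMat_def tensor_t_def)
    then show ?thesis by (simp only: carrier_TMat_iff)
  qed
  ultimately have "x \<in> Lie G \<longleftrightarrow> ?A \<in> jets 2 G"
    by (simp add: Lie_def trunc_current_group_iff numeral_2_eq_2)
  also have "\<dots> \<longleftrightarrow> (\<forall>f\<in>vanishing_ideal G. diff_at f (entries (mat 1)) (entries x) = 0)"
    unfolding jets_def mem_Collect_eq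
  proof (rule ball_cong[OF refl])
    fix f assume f: "f \<in> vanishing_ideal G"
    let ?p = "pev_t f (entries ?A)" and ?q = "[:pev f (entries (mat 1)), diff_at f (entries (mat 1)) (entries x):]"
    have "monom 1 2 dvd ?p - ?q"
      unfolding entries using pev_t_first_order by (simp only: t_power_eq_monom)
    then have "monom 1 2 dvd ?p \<longleftrightarrow> monom 1 2 dvd ?q"
      by (metis diff_add_cancel dvd_add_right_iff)
    also have "pev f (entries (mat 1)) = 0"
      using f assms by (auto simp: vanishing_ideal_eq ideal_of_def)
    then have "monom 1 2 dvd ?q \<longleftrightarrow> diff_at f (entries (mat 1)) (entries x) = 0"
      by (auto simp: monom_1_dvd_iff_coeff numeral_2_eq_2 less_Suc_eq)
    finally show "monom 1 2 dvd ?p \<longleftrightarrow> diff_at f (entries (mat 1)) (entries x) = 0" .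
  qed
  finally show ?thesis .
qed

text \<open>The vector field \<open>A \<mapsto> A y\<close> is tangent to \<open>G\<close>: for \<open>f\<close> vanishing on \<open>G\<close>, the derivative of \<open>f\<close> along it
  is a polynomial function, and its value at a point \<open>g\<close> of \<open>G\<close> is the derivative along \<open>y\<close> at the identity of
  a translate of \<open>f\<close>, hence zero. As a polynomial that vanishes on \<open>G\<close>, it also vanishes at the points of
  \<open>G\<close> over \<open>k[t]/(t\<^sup>N)\<close>.\<close>

lemma invariant_field_left:
  assumes G: "subgroup G GL" and y: "y \<in> Lie G" and f: "f \<in> vanishing_ideal G" and A: "A \<in> jets N G"
  shows "monom 1 N dvd differential (\<lambda>c. [:c:]) f (entries A) (entries (A ** const_mat y))"
proof -
  define h where "h = (\<Sum>v\<in>UNIV. pd v f * entries (Var_mat ** mapm Const y) v)"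
  have h: "peval \<phi> h (entries B) = differential \<phi> f (entries B) (entries (B ** mapm \<phi> y))" if "ring_map \<phi>" for \<phi> :: "'a \<Rightarrow> 'r::comm_ring_1" and B
    by (simp add: h_def differential_def peval_sum peval_mult that peval_entries_rmult)
  have "h \<in> vanishing_ideal G"
  proof -
    have "pev h (entries g) = 0" if g: "g \<in> G" for g
    proof -
      have "pev h (entries g) = diff_at f (entries g) (entries (g ** y))"
        using h[OF ring_map_id] by (simp add: mapm_id)
      also have "\<dots> = diff_at (lsubst g f) (entries (mat 1)) (entries y)"
        by (simp add: diff_at_lsubst)
      also have "\<dots> = 0"
        using y lsubst_vanishing[OF G g f] by (simp add: Lie_iff[OF subgroup_GL_one[OF G]])
      finally show ?thesis .
    qed
    then show ?thesis by (auto simp: vanishing_ideal_eq ideal_of_def)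
  qed
  with A have "monom 1 N dvd pev_t h (entries A)" by (simp add: jets_def)
  then show ?thesis by (simp only: h[OF ring_map_const_poly])
qed

lemma invariant_field_right:
  assumes G: "subgroup G GL" and y: "y \<in> Lie G" and f: "f \<in> vanishing_ideal G" and A: "A \<in> jets N G"
  shows "monom 1 N dvd differential (\<lambda>c. [:c:]) f (entries A) (entries (const_mat y ** A))"
proof -
  define h where "h = (\<Sum>v\<in>UNIV. pd v f * entries (mapm Const y ** Var_mat) v)"
  have h: "peval \<phi> h (entries B) = differential \<phi> f (entries B) (entries (mapm \<phi> y ** B))" if "ring_map \<phi>" for \<phi> :: "'a \<Rightarrow> 'r::comm_ring_1" and B
    by (simp add: h_def differential_def peval_sum peval_mult that peval_entries_lmult)
  have "h \<in> vanishing_ideal G"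
  proof -
    have "pev h (entries g) = 0" if g: "g \<in> G" for g
    proof -
      have "pev h (entries g) = diff_at f (entries g) (entries (y ** g))"
        using h[OF ring_map_id] by (simp add: mapm_id)
      also have "\<dots> = diff_at (rsubst g f) (entries (mat 1)) (entries y)"
        by (simp add: diff_at_rsubst)
      also have "\<dots> = 0"
        using y rsubst_vanishing[OF G g f] by (simp add: Lie_iff[OF subgroup_GL_one[OF G]])
      finally show ?thesis .
    qed
    then show ?thesis by (auto simp: vanishing_ideal_eq ideal_of_def)
  qed
  with A have "monom 1 N dvd pev_t h (entries A)" by (simp add: jets_def)
  then show ?thesis by (simp only: h[OF ring_map_const_poly])
qed

lemma ring_map_poly: "ring_map (\<lambda>p. poly p x)"
  by (simp add: ring_map_def)

text \<open>The product of two points of \<open>G\<close> over \<open>k[t]/(t\<^sup>N)\<close> is a point of \<open>G\<close>, although the vanishing ideal is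
  defined by the \<open>k\<close>-points of \<open>G\<close>. For fixed \<open>B\<close> expand \<open>f(C B)\<close> as a polynomial \<open>L\<close> in \<open>t\<close> whose coefficients
  are polynomials in the entries of \<open>C\<close>. For \<open>C\<close> in \<open>G\<close> the translate of \<open>f\<close> by \<open>C\<close> vanishes on \<open>G\<close>, so the
  coefficients below \<open>t\<^sup>N\<close> vanish on \<open>G\<close>, and may then be evaluated at \<open>C = A\<close>.\<close>

lemma jets_mult:
  fixes G :: "('k::field^'n^'n) set"
  assumes G: "subgroup G GL" and A: "A \<in> jets N G" and B: "B \<in> jets N G"
  shows "A ** B \<in> jets N G"
  unfolding jets_def
proof (intro CollectI ballI)
  fix f assume f: "f \<in> vanishing_ideal G"
  let ?V = "mapm (\<lambda>c. [:c:]) Var_mat :: ('n \<times> 'n, 'k) mpoly poly^'n^'n"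
  define L where "L = peval (\<lambda>c. [:Const c:]) f (entries (?V ** mapm (map_poly Const) B))"
  \<comment> \<open>The evaluation of the coefficients of \<open>L\<close> at \<open>C\<close>, a ring homomorphism that fixes \<open>t\<close>.\<close>
  define H where "H C l = poly (map_poly (\<lambda>h. pev_t h (entries C)) l) [:0, 1:]" for C :: "'k poly^'n^'n" and l
  have ring_H: "ring_map (H C)" for C
    unfolding H_def by (intro ring_map_compose[OF ring_map_poly] ring_map_map_poly ring_map_peval ring_map_const_poly)
  have H_const: "H C [:h:] = pev_t h (entries C)" for C h
    by (simp add: H_def map_poly_pCons peval_zero)
  have H_map_Const: "H C (map_poly Const b) = b" for C b
  proof (induction b)
    case 0
    then show ?case by (simp add: ring_map_zero[OF ring_H])
  next
    case (pCons c b)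
    have "map_poly Const (pCons c b) = [:Const c:] + [:0, 1:] * (map_poly Const b :: ('n \<times> 'n, 'k) mpoly poly)"
      by (simp add: map_poly_pCons ring_map_zero[OF ring_map_Const])
    moreover have "H C [:0, 1:] = [:0, 1:]"
      by (simp add: H_def map_poly_pCons peval_zero peval_one[OF ring_map_const_poly])
    ultimately have "H C (map_poly Const (pCons c b)) = [:c:] + [:0, 1:] * b"
      by (simp only: ring_map_add[OF ring_H] ring_map_mult[OF ring_H] H_const pCons peval_Const[OF ring_map_const_poly])
    then show ?case by simp
  qed
  have H_L: "H C L = pev_t f (entries (C ** B))" for C
  proof -
    have "mapm (H C) (?V ** mapm (map_poly Const) B) = C ** B"
      unfolding mapm_mult[OF ring_H]
      by (simp add: mapm_def H_const H_map_Const Var_mat_def peval_Var[OF ring_map_const_poly] entries_def)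
    moreover have "H C L = pev_t f (entries (mapm (H C) (?V ** mapm (map_poly Const) B)))"
      unfolding L_def ring_map_comp_peval[OF ring_H] entries_mapm
      by (simp add: H_const peval_Const[OF ring_map_const_poly])
    ultimately show ?thesis by simp
  qed
  have "coeff L i \<in> vanishing_ideal G" if "i < N" for i
  proof -
    have "pev (coeff L i) (entries g) = 0" if g: "g \<in> G" for g
    proof -
      have "poly (map_poly (\<lambda>h. [:u h:]) l) [:0, 1:] = map_poly u l" if "u 0 = 0"
        for u :: "('n \<times> 'n, 'k) mpoly \<Rightarrow> 'k" and l
        using that by (induction l) (simp_all add: map_poly_pCons)
      then have "H (const_mat g) L = map_poly (\<lambda>h. pev h (entries g)) L"
        by (simp add: H_def entries_mapm pev_t_const peval_zero)
      moreover have "monom 1 N dvd H (const_mat g) L"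
      proof -
        have "lsubst g f \<in> vanishing_ideal G" by (rule lsubst_vanishing[OF G g f])
        then show ?thesis
          using B by (simp add: H_L jets_def peval_lsubst[OF ring_map_const_poly, symmetric])
      qed
      ultimately show ?thesis
        using \<open>i < N\<close> by (auto simp: monom_1_dvd_iff_coeff coeff_map_poly peval_zero)
    qed
    then show ?thesis by (auto simp: vanishing_ideal_eq ideal_of_def)
  qed
  then have small: "monom 1 N dvd pev_t (coeff L i) (entries A)" if "i < N" for i
    using A that by (auto simp: jets_def)
  have "H A L = (\<Sum>i\<le>degree (map_poly (\<lambda>h. pev_t h (entries A)) L). pev_t (coeff L i) (entries A) * monom 1 i)"
    by (simp add: H_def poly_altdef coeff_map_poly peval_zero t_power_eq_monom)
  moreover have "monom 1 N dvd pev_t (coeff L i) (entries A) * monom 1 i" for i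
    using small[of i] monom_1_dvd_mono[of N i] by (cases "i < N") (auto intro: dvd_mult dvd_mult2)
  ultimately have "monom 1 N dvd H A L"
    by (simp add: dvd_sum)
  then show "monom 1 N dvd pev_t f (entries (A ** B))" by (simp only: H_L)
qed

text \<open>Smoothness of \<open>G\<close> at the identity, by left translation from a generic point \<open>g\<close>: the tangent
  space at \<open>g\<close> contains \<open>g y\<close>.\<close>

theorem jet_with_given_tangent:
  fixes G :: "('k::alg_closed_field^'n^'n) set"
  assumes char: "CHAR('k) > 0" and G: "subgroup G GL" and y: "y \<in> Lie G"
  shows "\<exists>A\<in>jets N G. mcong 2 A (mat 1 + t_times 1 (const_mat y))"
proof -
  have "entries ` G \<noteq> {}" using subgroup_GL_one[OF G] by blast
  from generic_arcs[OF char this, of N] obtain g where g: "g \<in> G"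
    and arcs: "\<And>x. x \<in> tangent (entries ` G) (entries g) \<Longrightarrow>
      \<exists>\<gamma>. (\<forall>v. [:0, 1:]^2 dvd \<gamma> v - [:entries g v, x v:]) \<and> (\<forall>f\<in>ideal_of (entries ` G). [:0, 1:]^N dvd pev_t f \<gamma>)"
    by blast
  have "entries (g ** y) \<in> tangent (entries ` G) (entries g)"
  proof -
    have "diff_at f (entries g) (entries (g ** y)) = 0" if "f \<in> vanishing_ideal G" for f
    proof -
      have "diff_at f (entries g) (entries (g ** y)) = diff_at (lsubst g f) (entries (mat 1)) (entries y)"
        by (simp add: diff_at_lsubst)
      also have "\<dots> = 0"
        using y lsubst_vanishing[OF G g that] by (simp add: Lie_iff[OF subgroup_GL_one[OF G]])
      finally show ?thesis .
    qed
    then show ?thesis by (simp add: tangent_def vanishing_ideal_eq)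
  qed
  from arcs[OF this] obtain \<gamma> where \<gamma>:
    "\<And>v. monom 1 2 dvd \<gamma> v - [:entries g v, entries (g ** y) v:]"
    "\<And>f. f \<in> vanishing_ideal G \<Longrightarrow> monom 1 N dvd pev_t f \<gamma>"
    by (auto simp: vanishing_ideal_eq t_power_eq_monom)
  obtain C where C: "entries C = \<gamma>" using entries_surj by blast
  have "mcong 2 C (const_mat g + t_times 1 (const_mat (g ** y)))"
    unfolding mcong_def
  proof (intro allI)
    fix i j
    have "(const_mat g + t_times 1 (const_mat (g ** y))) $ i $ j = [:entries g (i, j), entries (g ** y) (i, j):]"
      by (simp add: mapm_def t_times_def mscale_def entries_def monom_altdef)
    moreover have "C $ i $ j = \<gamma> (i, j)" by (simp add: C[symmetric] entries_def)
    ultimately show "monom 1 2 dvd C $ i $ j - (const_mat g + t_times 1 (const_mat (g ** y))) $ i $ j"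
      using \<gamma>(1)[of "(i, j)"] by simp
  qed
  moreover obtain g' where g': "g' \<in> G" "g' ** g = mat 1"
    using subgroup_GL_inverse[OF G g] by blast
  ultimately have "mcong 2 (const_mat g' ** C) (const_mat g' ** (const_mat g + t_times 1 (const_mat (g ** y))))"
    by (intro mcong_mult_left)
  also have "const_mat g' ** (const_mat g + t_times 1 (const_mat (g ** y))) = const_mat (g' ** g) + t_times 1 (const_mat (g' ** g ** y))"
    by (simp add: matrix_add_ldistrib t_times_mult matrix_mul_assoc flip: mapm_mult[OF ring_map_const_poly])
  also have "\<dots> = mat 1 + t_times 1 (const_mat y)"
    by (simp add: g' mapm_mat_1[OF ring_map_const_poly])
  finally have "mcong 2 (const_mat g' ** C) (mat 1 + t_times 1 (const_mat y))" .
  moreover have "const_mat g' ** C \<in> jets N G"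
    using \<gamma>(2) lsubst_vanishing[OF G g'(1)]
    by (simp add: jets_def peval_lsubst[OF ring_map_const_poly, symmetric] C)
  ultimately show ?thesis by blast
qed

lemma ring_map_pcompose: "ring_map (\<lambda>p. pcompose p q)"
  by (simp add: ring_map_def pcompose_add pcompose_mult pcompose_1)

text \<open>The arc \<open>1 + y t + \<dots>\<close> is reparametrized by \<open>t \<mapsto> t\<^sup>k\<close>.\<close>

corollary jet_with_given_leading_term:
  fixes G :: "('k::alg_closed_field^'n^'n) set"
  assumes char: "CHAR('k) > 0" and G: "subgroup G GL" and y: "y \<in> Lie G" and k: "0 < k"
  shows "\<exists>A\<in>jets N G. mcong (Suc k) A (mat 1 + t_times k (const_mat y))"
proof -
  obtain A where A: "A \<in> jets N G" "mcong 2 A (mat 1 + t_times 1 (const_mat y))"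
    using jet_with_given_tangent[OF char G y] by blast
  define \<sigma> where "\<sigma> p = pcompose p (monom 1 k)" for p :: "'k poly"
  have ring: "ring_map \<sigma>" unfolding \<sigma>_def by (rule ring_map_pcompose)
  have \<sigma>_const: "\<sigma> [:c:] = [:c:]" for c by (simp add: \<sigma>_def)
  have \<sigma>_monom: "\<sigma> (monom 1 n) = monom 1 (k * n)" for n
    by (simp add: \<sigma>_def t_power_eq_monom[symmetric] ring_map_power[OF ring_map_pcompose] power_mult pcompose_pCons)
  have dvd: "monom 1 (k * n) dvd \<sigma> p" if "monom 1 n dvd p" for n p
    using that by (auto simp: dvd_def ring_map_mult[OF ring] \<sigma>_monom)
  have "mapm \<sigma> A \<in> jets N G"
    unfolding jets_def
  proof (intro CollectI ballI)
    fix f assume "f \<in> vanishing_ideal G"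
    then have "monom 1 (k * N) dvd \<sigma> (pev_t f (entries A))"
      using A(1) by (intro dvd) (simp add: jets_def)
    moreover have "N \<le> k * N" using k by simp
    ultimately have "monom 1 N dvd \<sigma> (pev_t f (entries A))"
      using monom_1_dvd_mono dvd_trans by blast
    then show "monom 1 N dvd pev_t f (entries (mapm \<sigma> A))"
      by (simp add: ring_map_comp_peval[OF ring] \<sigma>_const entries_mapm)
  qed
  moreover have "mcong (Suc k) (mapm \<sigma> A) (mat 1 + t_times k (const_mat y))"
  proof -
    have "mapm \<sigma> (t_times 1 (const_mat y)) = t_times k (const_mat y)"
      by (simp only: mapm_def t_times_def mscale_def vec_lambda_beta ring_map_mult[OF ring] \<sigma>_const \<sigma>_monom mult_1_right)
    then have "mapm \<sigma> (mat 1 + t_times 1 (const_mat y)) = mat 1 + t_times k (const_mat y)"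
      by (simp add: mapm_add[OF ring] mapm_mat_1[OF ring])
    moreover have "mcong (k * 2) (mapm \<sigma> A) (mapm \<sigma> (mat 1 + t_times 1 (const_mat y)))"
      using A(2) dvd unfolding mcong_def
      by (simp add: mapm_def ring_map_diff[OF ring, symmetric])
    ultimately show ?thesis using k by (auto intro: mcong_mono)
  qed
  ultimately show ?thesis by blast
qed

section \<open>The adjoint representation in characteristic p\<close>

lemma monoid_Mat: "monoid (Mat :: ('r::comm_ring_1^'n^'n) monoid)"
  by standard (simp_all add: Mat_def matrix_mul_assoc)

lemma Mat_simps [simp]: "\<one>\<^bsub>Mat\<^esub> = mat 1" "A \<otimes>\<^bsub>Mat\<^esub> B = A ** B"
  by (simp_all add: Mat_def)

lemma matrix_add_rdistrib: "(B + C) ** A = B ** A + C ** (A :: 'r::comm_ring_1^'p^'n)"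
  by (simp add: matrix_matrix_mult_def vec_eq_iff sum.distrib distrib_right)

abbreviation mat_pow :: "'r::comm_ring_1^'n^'n \<Rightarrow> nat \<Rightarrow> 'r^'n^'n" where
  "mat_pow x n \<equiv> x [^]\<^bsub>Mat\<^esub> n"

lemma mat_pow_0: "mat_pow x 0 = mat 1"
  by (simp add: Mat_def nat_pow_def)

lemma mat_pow_Suc: "mat_pow x (Suc n) = mat_pow x n ** x"
  by (simp add: Mat_def nat_pow_def)

lemma mat_pow_Suc2: "mat_pow x (Suc n) = x ** mat_pow x n"
  using monoid.nat_pow_Suc2[OF monoid_Mat, of x n] by (simp add: Mat_def)

lemma mat_pow_mult: "mat_pow (mat_pow x m) n = mat_pow x (m * n)"
  using monoid.nat_pow_pow[OF monoid_Mat, of x m n] by (simp add: Mat_def)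

lemma mat_pow_commute:
  assumes "x ** w = w ** x"
  shows "mat_pow x n ** w = w ** mat_pow x n"
proof (induction n)
  case (Suc n)
  have "mat_pow x (Suc n) ** w = mat_pow x n ** (x ** w)"
    by (simp add: mat_pow_Suc matrix_mul_assoc)
  also have "\<dots> = (mat_pow x n ** w) ** x"
    by (simp add: assms matrix_mul_assoc)
  finally show ?case by (simp add: Suc mat_pow_Suc matrix_mul_assoc)
qed (simp add: mat_pow_0)

lemma mapm_mat_pow: "ring_map h \<Longrightarrow> mapm h (mat_pow x n) = mat_pow (mapm h x) n"
  by (induction n) (simp_all add: mat_pow_0 mat_pow_Suc mapm_mult mapm_mat_1)

lemma mscale_mult: "mscale c A ** B = mscale c (A ** B)" "A ** mscale c B = mscale c (A ** (B :: 'r::comm_ring_1^'n^'n))"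
  by (simp_all add: mscale_def matrix_matrix_mult_def vec_eq_iff sum_distrib_left mult_ac)

lemma mscale_linear:
  fixes A B :: "'r::comm_ring_1^'n^'n"
  shows "mscale c (A + B) = mscale c A + mscale c B" "mscale c (A - B) = mscale c A - mscale c B"
    "mscale (c + d) A = mscale c A + mscale d A" "mscale 0 A = 0" "mscale 1 A = A"
  by (simp_all add: mscale_def vec_eq_iff algebra_simps)

lemma matrix_sum_distrib:
  fixes B :: "'r::comm_ring_1^'n^'n"
  shows "(\<Sum>i\<in>S. A i) ** B = (\<Sum>i\<in>S. A i ** B)" "B ** (\<Sum>i\<in>S. A i) = (\<Sum>i\<in>S. B ** A i)"
  by (induction S rule: infinite_finite_induct) (auto simp: matrix_add_ldistrib matrix_add_rdistrib)

definition ad :: "'r::comm_ring_1^'n^'n \<Rightarrow> 'r^'n^'n \<Rightarrow> 'r^'n^'n" where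
  "ad x v = x ** v - v ** x"

text \<open>The binomial theorem for left multiplication \<open>ad x + (right multiplication)\<close>, a sum of commuting
  operators. In this form it has no signs.\<close>

lemma mat_pow_mult_eq_sum_ad:
  "mat_pow x n ** v = (\<Sum>j\<le>n. mscale (of_nat (n choose j)) ((ad x ^^ j) v ** mat_pow x (n - j)))"
proof (induction n)
  case 0
  then show ?case by (simp add: mat_pow_0 mscale_linear)
next
  case (Suc n)
  define T where "T j = (ad x ^^ j) v ** mat_pow x (Suc n - j)" for j
  have step: "x ** ((ad x ^^ j) v ** mat_pow x (n - j)) = T (Suc j) + T j" if "j \<le> n" for j
  proof -
    have "x ** (ad x ^^ j) v = (ad x ^^ Suc j) v + (ad x ^^ j) v ** x"
      by (simp add: ad_def)
    then have "x ** ((ad x ^^ j) v ** mat_pow x (n - j))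
        = (ad x ^^ Suc j) v ** mat_pow x (n - j) + (ad x ^^ j) v ** (x ** mat_pow x (n - j))"
      by (simp add: matrix_mul_assoc matrix_add_rdistrib)
    also have "x ** mat_pow x (n - j) = mat_pow x (Suc n - j)"
      using that by (simp only: Suc_diff_le mat_pow_Suc2)
    finally show ?thesis by (simp add: T_def)
  qed
  have "mat_pow x (Suc n) ** v = x ** (mat_pow x n ** v)"
    by (simp only: mat_pow_Suc2 matrix_mul_assoc)
  also have "\<dots> = (\<Sum>j\<le>n. mscale (of_nat (n choose j)) (T (Suc j) + T j))"
    unfolding Suc matrix_sum_distrib mscale_mult by (rule sum.cong) (simp_all add: step)
  also have "\<dots> = (\<Sum>j\<le>n. mscale (of_nat (n choose j)) (T (Suc j))) + (\<Sum>j\<le>n. mscale (of_nat (n choose j)) (T j))"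
    by (simp add: mscale_linear sum.distrib)
  also have "(\<Sum>j\<le>n. mscale (of_nat (n choose j)) (T j)) = (\<Sum>j\<le>Suc n. mscale (of_nat (n choose j)) (T j))"
    by (simp add: binomial_eq_0 mscale_linear)
  also have "\<dots> = T 0 + (\<Sum>j\<le>n. mscale (of_nat (n choose Suc j)) (T (Suc j)))"
    by (subst sum.atMost_Suc_shift) (simp add: mscale_linear)
  also have "(\<Sum>j\<le>n. mscale (of_nat (n choose j)) (T (Suc j))) + (T 0 + (\<Sum>j\<le>n. mscale (of_nat (n choose Suc j)) (T (Suc j))))
      = T 0 + (\<Sum>j\<le>n. mscale (of_nat (Suc n choose Suc j)) (T (Suc j)))"
    by (simp add: mscale_linear sum.distrib add_ac)
  also have "\<dots> = (\<Sum>j\<le>Suc n. mscale (of_nat (Suc n choose j)) (T j))"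
    by (subst sum.atMost_Suc_shift) (simp add: mscale_linear)
  finally show ?case by (simp add: T_def)
qed

lemma ad_mat_pow_char:
  fixes x :: "'k::field^'n^'n"
  assumes p: "p = CHAR('k)" "prime p"
  shows "ad (mat_pow x p) v = (ad x ^^ p) v"
proof -
  define T where "T j = mscale (of_nat (p choose j)) ((ad x ^^ j) v ** mat_pow x (p - j))" for j
  have "T j = 0" if "j \<noteq> 0" "j \<noteq> p" "j \<le> p" for j
  proof -
    have "p dvd p choose j" using that p(2) by (intro dvd_choose_prime) auto
    then have "of_nat (p choose j) = (0 :: 'k)" using p by (simp add: of_nat_eq_0_iff_char_dvd)
    then show ?thesis by (simp add: T_def mscale_linear)
  qed
  moreover have "mat_pow x p ** v = (\<Sum>j\<le>p. T j)"
    unfolding T_def by (rule mat_pow_mult_eq_sum_ad)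
  moreover have "(\<Sum>j\<le>p. T j) = (\<Sum>j\<in>{0, p}. T j)"
    using calculation(1) by (intro sum.mono_neutral_right) auto
  moreover have "0 \<noteq> p" using p(2) by (auto simp: prime_nat_iff)
  ultimately have "mat_pow x p ** v = T 0 + T p" by simp
  then show ?thesis
    by (simp add: T_def mscale_linear mat_pow_0 ad_def)
qed

lemma ad_mat_pow_char_power:
  fixes x :: "'k::field^'n^'n"
  assumes p: "p = CHAR('k)" "prime p"
  shows "ad (mat_pow x (p ^ i)) = ad x ^^ (p ^ i)"
proof (induction i)
  case 0
  have "mat_pow x 1 = x" using mat_pow_Suc[of x 0] by (simp add: mat_pow_0)
  then show ?case by simp
next
  case (Suc i)
  have "ad (mat_pow x (p ^ Suc i)) = ad (mat_pow (mat_pow x (p ^ i)) p)"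
    by (simp add: mat_pow_mult mult.commute)
  also have "\<dots> = ad (mat_pow x (p ^ i)) ^^ p"
    by (rule ext) (rule ad_mat_pow_char[OF p])
  also have "\<dots> = ad x ^^ (p ^ Suc i)"
    by (simp add: Suc funpow_mult mult.commute)
  finally show ?case .
qed

lemma ad_linear:
  "ad x (u + v) = ad x u + ad x v" "ad x (u - v) = ad x u - ad x v" "ad x (mscale c v) = mscale c (ad x v)"
  "ad x 0 = 0" "ad x (\<Sum>i\<in>S. f i) = (\<Sum>i\<in>S. ad x (f i))"
proof -
  show add: "ad x (u + v) = ad x u + ad x v" for u v
    by (simp add: ad_def matrix_add_ldistrib matrix_add_rdistrib)
  show "ad x (u - v) = ad x u - ad x v"
    by (simp add: ad_def matrix_diff_ldistrib matrix_diff_rdistrib)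
  show "ad x (mscale c v) = mscale c (ad x v)"
    by (simp add: ad_def mscale_mult mscale_linear)
  show zero: "ad x 0 = 0" by (simp add: ad_def)
  show "ad x (\<Sum>i\<in>S. f i) = (\<Sum>i\<in>S. ad x (f i))"
    by (induction S rule: infinite_finite_induct) (simp_all add: add zero)
qed

text \<open>The equation for \<open>x\<close> gives \<open>ad x = \<Sum> a\<^sub>i (ad x)\<^bsup>p^i\<^esup>\<close>, so \<open>ad x\<close> agrees with the
  composition of \<open>ad x\<close>, \<open>ad x\<close> and the operator \<open>\<Sum> a\<^sub>i (ad x)\<^bsup>p^i-2\<^esup>\<close>. Thus every \<open>v\<close> is
  \<open>ad x\<close> of something plus an element of the kernel. As a polynomial in \<open>ad x\<close>, the operator \<open>y\<close>
  preserves every subspace stable under \<open>ad x\<close>.\<close>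

lemma ad_decomposition:
  fixes x :: "'k::field^'n^'n"
  assumes p: "p = CHAR('k)" "prime p"
    and S: "\<And>i. i \<in> S \<Longrightarrow> 0 < i" and x: "x = (\<Sum>i\<in>S. mscale (a i) (mat_pow x (p ^ i)))"
  defines "y \<equiv> \<lambda>v. \<Sum>i\<in>S. mscale (a i) ((ad x ^^ (p ^ i - 2)) v)"
  shows "ad x (v - ad x (y v)) = 0"
proof -
  have "ad x (ad x (y v)) = (\<Sum>i\<in>S. mscale (a i) ((ad x ^^ (p ^ i)) v))"
    unfolding y_def ad_linear
  proof (rule sum.cong[OF refl])
    fix i assume "i \<in> S"
    then have "p ^ 1 \<le> p ^ i"
      using S[of i] p(2) by (intro power_increasing) (auto simp: prime_gt_0_nat Suc_le_eq)
    then have "p ^ i = Suc (Suc (p ^ i - 2))"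
      using prime_ge_2_nat[OF p(2)] by simp
    then have "ad x ^^ (p ^ i) = ad x ^^ Suc (Suc (p ^ i - 2))" by simp
    then show "mscale (a i) (ad x (ad x ((ad x ^^ (p ^ i - 2)) v))) = mscale (a i) ((ad x ^^ (p ^ i)) v)"
      by simp
  qed
  also have "\<dots> = (\<Sum>i\<in>S. mscale (a i) (ad (mat_pow x (p ^ i)) v))"
    by (simp add: ad_mat_pow_char_power[OF p])
  also have "\<dots> = ad (\<Sum>i\<in>S. mscale (a i) (mat_pow x (p ^ i))) v"
    by (simp add: ad_def matrix_sum_distrib mscale_mult mscale_linear sum_subtractf)
  also have "\<dots> = ad x v" by (simp only: x[symmetric])
  finally show ?thesis by (simp add: ad_linear)
qed

section \<open>The Lie algebra as a Lie subalgebra\<close>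

lemma Lie_add: "mat 1 \<in> G \<Longrightarrow> x \<in> Lie G \<Longrightarrow> y \<in> Lie G \<Longrightarrow> x + y \<in> Lie G"
  by (simp add: Lie_iff entries_add differential_linear_add)

lemma entries_mscale: "entries (mscale c x) = (\<lambda>v. c * entries x v)"
  by (simp add: entries_def mscale_def)

lemma Lie_mscale: "mat 1 \<in> G \<Longrightarrow> x \<in> Lie G \<Longrightarrow> mscale c x \<in> Lie G"
  by (simp add: Lie_iff entries_mscale differential_linear_mult)

lemma Lie_zero: "mat 1 \<in> G \<Longrightarrow> 0 \<in> Lie G"
  by (simp add: Lie_iff differential_def entries_def)

lemma Lie_sum: "mat 1 \<in> G \<Longrightarrow> (\<And>i. i \<in> S \<Longrightarrow> x i \<in> Lie G) \<Longrightarrow> sum x S \<in> Lie G"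
  by (induction S rule: infinite_finite_induct) (auto intro: Lie_zero Lie_add)

abbreviation const_term :: "'k::field poly^'n^'n \<Rightarrow> 'k^'n^'n" where
  "const_term \<equiv> mapm (\<lambda>p. poly p 0)"

lemma const_term_cong: "mcong 1 A B \<Longrightarrow> const_term A = const_term B"
  by (simp add: mcong_def mapm_def vec_eq_iff monom_1_dvd_iff_coeff poly_0_coeff_0)

lemma const_term_const_mat: "const_term (const_mat x) = x"
  by (simp add: mapm_def vec_eq_iff)

lemma mcong_const_term: "mcong 1 A (const_mat (const_term A))"
  by (simp add: mcong_def mapm_def monom_1_dvd_iff_coeff poly_0_coeff_0)

lemma differential_t_times:
  "differential \<phi> f a (entries (t_times k E)) = monom 1 k * differential \<phi> f a (entries E)"
  by (simp add: t_times_def entries_mscale differential_linear_mult)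

text \<open>A vector \<open>t\<^sup>k E\<close> at a point near the identity that is tangent to \<open>G\<close> modulo \<open>t\<^bsup>k+1\<^esup>\<close> has its leading
  coefficient tangent at the identity. Both the bracket and the error terms of the successive
  conjugation are recognized as elements of the Lie algebra in this way.\<close>

lemma leading_term_in_Lie:
  assumes G: "mat 1 \<in> G" and A: "mcong 1 A (mat 1)"
    and dvd: "\<And>f. f \<in> vanishing_ideal G \<Longrightarrow>
      monom 1 (Suc k) dvd differential (\<lambda>c. [:c:]) f (entries A) (entries (t_times k E))"
  shows "const_term E \<in> Lie G"
  unfolding Lie_iff[OF G]
proof
  fix f assume "f \<in> vanishing_ideal G"
  from dvd[OF this] have "monom 1 k * monom 1 1 dvd monom 1 k * differential (\<lambda>c. [:c:]) f (entries A) (entries E)"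
    by (simp add: differential_t_times mult_monom)
  then have "monom 1 1 dvd differential (\<lambda>c. [:c:]) f (entries A) (entries E)"
    by simp
  then have "poly (differential (\<lambda>c. [:c:]) f (entries A) (entries E)) 0 = 0"
    by (simp add: monom_1_dvd_iff_coeff poly_0_coeff_0)
  moreover have "poly (differential (\<lambda>c. [:c:]) f (entries A) (entries E)) 0
      = diff_at f (entries (const_term A)) (entries (const_term E))"
    by (simp add: differential_def poly_sum entries_mapm ring_map_comp_peval[OF ring_map_poly])
  moreover have "const_term A = mat 1"
    using const_term_cong[OF A] by (simp add: mapm_mat_1[OF ring_map_poly])
  ultimately show "diff_at f (entries (mat 1)) (entries (const_term E)) = 0" by simp
qed

lemma differential_linear_diff:
  "differential \<phi> f a (\<lambda>v. x v - y v) = differential \<phi> f a x - differential \<phi> f a y"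
  by (simp add: differential_def right_diff_distrib sum_subtractf)

text \<open>The difference of the invariant vector fields \<open>A y\<close> and \<open>y A\<close> at \<open>A = 1 + t x\<close> is
  \<open>t [x, y]\<close>.\<close>

lemma Lie_bracket:
  assumes G: "subgroup G GL" and x: "x \<in> Lie G" and y: "y \<in> Lie G"
  shows "ad x y \<in> Lie G"
proof -
  let ?A = "mat 1 \<otimes>t 0 + x \<otimes>t 1"
  have A: "?A \<in> jets 2 G"
    using x by (simp add: Lie_def trunc_current_group_iff numeral_2_eq_2)
  have A_eq: "?A = mat 1 + t_times 1 (const_mat x)"
    by (simp add: tensor_t_eq mapm_mat_1[OF ring_map_const_poly]) (simp add: t_times_def mscale_def vec_eq_iff)
  have "const_term (const_mat (ad x y)) \<in> Lie G"
  proof (rule leading_term_in_Lie[OF subgroup_GL_one[OF G], where A = ?A and k = 1])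
    show "mcong 1 ?A (mat 1)"
      unfolding A_eq mcong_iff_t_times by blast
    fix f assume f: "f \<in> vanishing_ideal G"
    have "t_times 1 (const_mat (ad x y)) = ?A ** const_mat y - const_mat y ** ?A"
      unfolding A_eq
      by (simp add: ad_def matrix_add_ldistrib matrix_add_rdistrib t_times_mult t_times_diff
          mapm_mult[OF ring_map_const_poly] mapm_diff[OF ring_map_const_poly])
    then have "entries (t_times 1 (const_mat (ad x y)))
        = (\<lambda>v. entries (?A ** const_mat y) v - entries (const_mat y ** ?A) v)"
      by (simp only: entries_diff)
    then show "monom 1 (Suc 1) dvd differential (\<lambda>c. [:c:]) f (entries ?A) (entries (t_times 1 (const_mat (ad x y))))"
      using dvd_diff[OF invariant_field_left[OF G y f A] invariant_field_right[OF G y f A]]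
      by (simp only: differential_linear_diff Suc_1)
  qed
  then show ?thesis by (simp only: const_term_const_mat)
qed

section \<open>Conjugation of semisimple elements\<close>

lemma mcong_mat_pow: "mcong k A B \<Longrightarrow> mcong k (mat_pow A n) (mat_pow B n)"
  by (induction n) (simp_all add: mat_pow_0 mat_pow_Suc mcong_refl mcong_mult)

lemma p_map_cong:
  fixes X :: "'k::field poly^'n^'n"
  shows "mcong (Suc m) ((p_map m ^^ i) X) (mat_pow X (CHAR('k) ^ i))"
proof -
  have "mcong (Suc m) (Y [^]\<^bsub>TMat m\<^esub> n) (mat_pow Y n)" for Y :: "'k poly^'n^'n" and n :: nat
  proof (induction n)
    case 0
    then show ?case by (simp add: nat_pow_def TMat_def Mat_def mcong_refl)
  next
    case (Suc n)
    have "Y [^]\<^bsub>TMat m\<^esub> Suc n = reduce m ((Y [^]\<^bsub>TMat m\<^esub> n) ** Y)"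
      by (simp add: nat_pow_def TMat_mult)
    also have "mcong (Suc m) \<dots> ((Y [^]\<^bsub>TMat m\<^esub> n) ** Y)" by (rule mcong_reduce)
    also have "mcong (Suc m) \<dots> (mat_pow Y n ** Y)" by (intro mcong_mult_right Suc)
    finally show ?case by (simp add: mat_pow_Suc)
  qed
  then have step: "mcong (Suc m) (p_map m Y) (mat_pow Y CHAR('k))" for Y :: "'k poly^'n^'n"
    by (simp add: p_map_def)
  show ?thesis
  proof (induction i)
    case 0
    have "mat_pow X 1 = X" using mat_pow_Suc[of X 0] by (simp add: mat_pow_0)
    then show ?case by (simp add: mcong_refl)
  next
    case (Suc i)
    have "mcong (Suc m) (p_map m ((p_map m ^^ i) X)) (mat_pow ((p_map m ^^ i) X) CHAR('k))"
      by (rule step)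
    also have "mcong (Suc m) \<dots> (mat_pow (mat_pow X (CHAR('k) ^ i)) CHAR('k))"
      by (rule mcong_mat_pow[OF Suc])
    finally show ?case by (simp add: mat_pow_mult mult.commute)
  qed
qed

lemma restricted_semisimple_tscaleE:
  assumes "restricted_semisimple tscale (p_map m) x"
  obtains S a where "finite S" "\<And>i. i \<in> S \<Longrightarrow> 0 < i" "x = (\<Sum>i\<in>S. tscale (a i) ((p_map m ^^ i) x))"
proof -
  have "{(p_map m ^^ i) x |i. 0 < i} = (\<lambda>i. (p_map m ^^ i) x) ` {0<..}" by auto
  with assms obtain t r where t: "finite t" "t \<subseteq> (\<lambda>i. (p_map m ^^ i) x) ` {0<..}" "x = (\<Sum>b\<in>t. tscale (r b) b)"
    unfolding restricted_semisimple_def module.span_explicit[OF module_tscale] by auto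
  obtain S where "S \<subseteq> {0<..}" "finite S" "t = (\<lambda>i. (p_map m ^^ i) x) ` S" "inj_on (\<lambda>i. (p_map m ^^ i) x) S"
    using subset_image_inj[of t "\<lambda>i. (p_map m ^^ i) x" "{0<..}"] t(1,2) by (metis finite_image_iff)
  with t(3) show ?thesis
    by (intro that[of S "\<lambda>i. r ((p_map m ^^ i) x)"]) (auto simp: sum.reindex)
qed

lemma mcong_sum: "(\<And>i. i \<in> S \<Longrightarrow> mcong k (A i) (B i)) \<Longrightarrow> mcong k (sum A S) (sum B S)"
  by (induction S rule: infinite_finite_induct) (auto simp: mcong_refl mcong_add)

lemma mcong_tscale: "mcong k A B \<Longrightarrow> mcong k (tscale c A) (tscale c B)"
  unfolding mcong_def tscale_def mscale_def by (simp add: smult_diff_right[symmetric] dvd_smult)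

lemma tscale_mult: "tscale c A ** B = tscale c (A ** B)" "A ** tscale c B = tscale c (A ** B)"
  by (simp_all add: tscale_def mscale_mult)

lemma const_mat_mscale: "const_mat (mscale c x) = tscale c (const_mat x)"
  by (simp add: mapm_def tscale_def mscale_def mult.commute)

lemma const_mat_sum: "const_mat (sum f S) = (\<Sum>i\<in>S. const_mat (f i))"
  by (induction S rule: infinite_finite_induct)
     (simp_all add: mapm_add[OF ring_map_const_poly], simp_all add: mapm_def vec_eq_iff)

lemma const_term_tscale: "const_term (tscale c A) = mscale c (const_term A)"
  by (simp add: mapm_def tscale_def mscale_def)

lemma const_term_sum: "const_term (sum f S) = (\<Sum>i\<in>S. const_term (f i))"
  by (induction S rule: infinite_finite_induct)
     (simp_all add: mapm_add[OF ring_map_poly], simp_all add: mapm_def vec_eq_iff)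

text \<open>For commuting \<open>x\<close> and \<open>w\<close> the derivative of the power map is the usual one, so it vanishes for
  exponents divisible by \<open>p\<close>.\<close>

lemma mat_pow_first_order:
  assumes "x ** w = w ** x" "0 < k"
  shows "mcong (Suc k) (mat_pow (const_mat x + t_times k (const_mat w)) n)
    (const_mat (mat_pow x n) + t_times k (const_mat (mscale (of_nat n) (w ** mat_pow x (n - 1)))))"
proof (induction n)
  case 0
  then show ?case
    by (simp add: mat_pow_0 mapm_mat_1[OF ring_map_const_poly] mscale_linear)
       (simp add: mcong_def mapm_def t_times_def mscale_def)
next
  case (Suc n)
  let ?M = "const_mat x + t_times k (const_mat w)"
  define u where "u = mscale (of_nat n) (w ** mat_pow x (n - 1))"
  have ux: "u ** x = mscale (of_nat n) (w ** mat_pow x n)"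
    by (cases n) (simp_all add: u_def mscale_linear mscale_mult mat_pow_Suc matrix_mul_assoc matrix_add_rdistrib)
  have "mcong (Suc k) (mat_pow ?M (Suc n)) ((const_mat (mat_pow x n) + t_times k (const_mat u)) ** ?M)"
    unfolding mat_pow_Suc u_def by (intro mcong_mult_right Suc)
  also have "(const_mat (mat_pow x n) + t_times k (const_mat u)) ** ?M
      = const_mat (mat_pow x n ** x) + t_times k (const_mat (u ** x + mat_pow x n ** w)) + t_times (k + k) (const_mat (u ** w))"
    by (simp add: matrix_add_ldistrib matrix_add_rdistrib t_times_mult t_times_add t_times_t_times
        mapm_mult[OF ring_map_const_poly] mapm_add[OF ring_map_const_poly] add_ac)
  also have "mcong (Suc k) \<dots> (const_mat (mat_pow x n ** x) + t_times k (const_mat (u ** x + mat_pow x n ** w)) + 0)"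
    using assms(2) by (intro mcong_add mcong_refl mcong_mono[OF mcong_t_times_0]) simp
  also have "u ** x + mat_pow x n ** w = mscale (of_nat (Suc n)) (w ** mat_pow x n)"
    using mat_pow_commute[OF assms(1), of n] by (simp add: ux mscale_linear)
  finally show ?case by (simp add: mat_pow_Suc)
qed

lemma intertwine_powers:
  assumes "mcong k (A ** X) (M ** A)"
  shows "mcong k (A ** mat_pow X n) (mat_pow M n ** A)"
proof (induction n)
  case 0
  then show ?case by (simp add: mat_pow_0 mcong_refl)
next
  case (Suc n)
  have "mcong k (A ** mat_pow X n ** X) (mat_pow M n ** A ** X)"
    by (intro mcong_mult_right Suc)
  also have "mat_pow M n ** A ** X = mat_pow M n ** (A ** X)" by (simp add: matrix_mul_assoc)
  also have "mcong k \<dots> (mat_pow M n ** (M ** A))"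
    by (intro mcong_mult_left assms)
  finally show ?case by (simp add: mat_pow_Suc matrix_mul_assoc)
qed

text \<open>The equation \<open>X = \<Sum> a\<^sub>i X\<^bsup>p^i\<^esup>\<close> carries over to the conjugate \<open>x + t\<^sup>k w\<close> of \<open>X\<close>, whose powers with
  exponent \<open>p\<^sup>i\<close> are those of \<open>x\<close> modulo \<open>t\<^bsup>k+1\<^esup>\<close>. Conjugacy is expressed by an intertwining matrix
  \<open>A\<close>.\<close>

lemma semisimple_no_commuting_perturbation:
  fixes x w :: "'k::field^'n^'n"
  assumes p: "p = CHAR('k)"
    and S: "\<And>i. i \<in> S \<Longrightarrow> 0 < i" and x: "x = (\<Sum>i\<in>S. mscale (a i) (mat_pow x (p ^ i)))"
    and X: "mcong (Suc k) X (\<Sum>i\<in>S. tscale (a i) (mat_pow X (p ^ i)))"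
    and w: "x ** w = w ** x" and k: "0 < k"
    and AX: "mcong (Suc k) (A ** X) ((const_mat x + t_times k (const_mat w)) ** A)"
  shows "mcong (Suc k) (A ** X) (const_mat x ** A)"
proof -
  let ?M = "const_mat x + t_times k (const_mat w)"
  have M_pow: "mcong (Suc k) (mat_pow ?M (p ^ i)) (const_mat (mat_pow x (p ^ i)))" if "i \<in> S" for i
  proof -
    have "of_nat (p ^ i) = (0 :: 'k)"
      using S[OF that] by (simp add: of_nat_eq_0_iff_char_dvd p)
    then have "t_times k (const_mat (mscale (of_nat (p ^ i)) (w ** mat_pow x (p ^ i - 1)))) = 0"
      by (simp only: mscale_linear) (simp add: mapm_def t_times_def mscale_def vec_eq_iff)
    with mat_pow_first_order[OF w k, of "p ^ i"] show ?thesis by simp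
  qed
  have "mcong (Suc k) (A ** X) (A ** (\<Sum>i\<in>S. tscale (a i) (mat_pow X (p ^ i))))"
    by (intro mcong_mult_left X)
  also have "\<dots> = (\<Sum>i\<in>S. tscale (a i) (A ** mat_pow X (p ^ i)))"
    by (simp add: matrix_sum_distrib tscale_mult)
  also have "mcong (Suc k) \<dots> (\<Sum>i\<in>S. tscale (a i) (const_mat (mat_pow x (p ^ i)) ** A))"
    by (intro mcong_sum mcong_tscale mcong_trans[OF intertwine_powers[OF AX]] mcong_mult_right M_pow)
  also have "\<dots> = const_mat (\<Sum>i\<in>S. mscale (a i) (mat_pow x (p ^ i))) ** A"
    by (simp add: const_mat_sum const_mat_mscale matrix_sum_distrib tscale_mult)
  also have "\<dots> = const_mat x ** A" by (simp only: x[symmetric])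
  finally show ?thesis .
qed

text \<open>The error term \<open>t\<^sup>k E = A X - x\<^sub>0 A\<close> is a combination of values at \<open>A\<close> of invariant vector fields, so its
  leading coefficient \<open>v\<close> lies in the Lie algebra. Its component \<open>ad x\<^sub>0 y\<close> is removed by an element \<open>D = 1 + t\<^sup>k y + \<dots>\<close> of
  the group, and its component \<open>w\<close> in the centralizer of \<open>x\<^sub>0\<close> is zero by semisimplicity.\<close>

lemma conjugation_step:
  fixes G :: "('k::alg_closed_field^'n^'n) set" and x :: "nat \<Rightarrow> 'k^'n^'n"
  assumes char: "CHAR('k) > 0" and G: "subgroup G GL"
    and x: "\<And>i. i \<le> m \<Longrightarrow> x i \<in> Lie G" and X: "X = (\<Sum>i\<le>m. x i \<otimes>t i)"
    and S: "\<And>i. i \<in> S \<Longrightarrow> 0 < i"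
    and X_ss: "mcong (Suc m) X (\<Sum>i\<in>S. tscale (a i) (mat_pow X (CHAR('k) ^ i)))"
    and x0_ss: "x 0 = (\<Sum>i\<in>S. mscale (a i) (mat_pow (x 0) (CHAR('k) ^ i)))"
    and k: "0 < k" "k \<le> m"
    and A: "A \<in> jets (Suc m) G" "mcong 1 A (mat 1)" "mcong k (A ** X) (const_mat (x 0) ** A)"
  shows "\<exists>B\<in>jets (Suc m) G. mcong 1 B (mat 1) \<and> mcong (Suc k) (B ** X) (const_mat (x 0) ** B)"
proof -
  define p where "p = CHAR('k)"
  have p: "prime p" using char by (simp add: p_def prime_CHAR_semidom)
  note one = subgroup_GL_one[OF G]
  let ?C = "const_mat (x 0)"
  obtain E where E: "A ** X = ?C ** A + t_times k E"
    using A(3) by (auto simp: mcong_iff_t_times)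
  define v where "v = const_term E"
  have v: "v \<in> Lie G"
    unfolding v_def
  proof (rule leading_term_in_Lie[OF one A(2)])
    fix f assume f: "f \<in> vanishing_ideal G"
    have "A ** X = (\<Sum>i\<le>m. t_times i (A ** const_mat (x i)))"
      by (simp add: X matrix_sum_distrib tensor_t_eq t_times_mult)
    then have "entries (A ** X) = (\<lambda>w. \<Sum>i\<le>m. entries (t_times i (A ** const_mat (x i))) w)"
      by (simp add: entries_def)
    then have "differential (\<lambda>c. [:c:]) f (entries A) (entries (A ** X))
        = (\<Sum>i\<le>m. monom 1 i * differential (\<lambda>c. [:c:]) f (entries A) (entries (A ** const_mat (x i))))"
      by (simp add: differential_linear_sum differential_t_times)
    moreover have "monom 1 (Suc m) dvd \<dots>"
      using invariant_field_left[OF G x f A(1)] by (intro dvd_sum dvd_mult) auto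
    moreover have "monom 1 (Suc m) dvd differential (\<lambda>c. [:c:]) f (entries A) (entries (?C ** A))"
      by (rule invariant_field_right[OF G x[of 0] f A(1)]) simp
    moreover have "entries (t_times k E) = (\<lambda>w. entries (A ** X) w - entries (?C ** A) w)"
      by (simp add: E entries_add)
    ultimately have "monom 1 (Suc m) dvd differential (\<lambda>c. [:c:]) f (entries A) (entries (t_times k E))"
      by (simp only: differential_linear_diff dvd_diff)
    then show "monom 1 (Suc k) dvd differential (\<lambda>c. [:c:]) f (entries A) (entries (t_times k E))"
      using monom_1_dvd_mono[of "Suc k" "Suc m"] k(2) dvd_trans by blast
  qed
  define y where "y = (\<Sum>i\<in>S. mscale (a i) ((ad (x 0) ^^ (p ^ i - 2)) v))"
  define w where "w = v - ad (x 0) y"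
  have y: "y \<in> Lie G"
  proof -
    have "(ad (x 0) ^^ n) v \<in> Lie G" for n
      using x[of 0] by (induction n) (auto intro: v Lie_bracket[OF G])
    then show ?thesis unfolding y_def by (intro Lie_sum Lie_mscale one)
  qed
  have "ad (x 0) w = 0"
    unfolding w_def y_def using ad_decomposition[OF p_def p S x0_ss[folded p_def], of v] by simp
  then have w: "x 0 ** w = w ** x 0" by (simp add: ad_def)
  obtain D where D: "D \<in> jets (Suc m) G" "mcong (Suc k) D (mat 1 + t_times k (const_mat y))"
    using jet_with_given_leading_term[OF char G y k(1)] by blast
  have D1: "mcong 1 D (mat 1)"
  proof -
    have "mcong 1 D (mat 1 + t_times k (const_mat y))" by (rule mcong_mono[OF D(2)]) simp
    also have "mcong 1 \<dots> (mat 1 + 0)"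
      using k(1) by (intro mcong_add mcong_refl mcong_mono[OF mcong_t_times_0]) simp
    finally show ?thesis by simp
  qed
  define B where "B = D ** A"
  have B1: "mcong 1 B (mat 1)"
    using mcong_mult[OF D1 A(2)] by (simp add: B_def)
  have t_mod: "mcong (Suc k) (t_times k U) (t_times k V)" if "mcong 1 U V" for U V :: "'k poly^'n^'n"
    using mcong_t_times[OF that, of k] by simp
  have "mcong (Suc k) (B ** X) ((?C + t_times k (const_mat w)) ** B)"
  proof -
    have "B ** X = D ** (?C ** A) + t_times k (D ** E)"
      by (simp add: B_def E matrix_add_ldistrib t_times_mult flip: matrix_mul_assoc)
    also have "mcong (Suc k) \<dots> ((mat 1 + t_times k (const_mat y)) ** (?C ** A) + t_times k (const_mat v))"
    proof (intro mcong_add mcong_mult_right D(2) t_mod)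
      have "mcong 1 (D ** E) (mat 1 ** const_mat v)"
        unfolding v_def by (intro mcong_mult D1 mcong_const_term)
      then show "mcong 1 (D ** E) (const_mat v)" by simp
    qed
    also have "\<dots> = ?C ** A + t_times k (const_mat (y ** x 0) ** A + const_mat v)"
      by (simp add: matrix_add_rdistrib t_times_mult t_times_add mapm_mult[OF ring_map_const_poly] matrix_mul_assoc)
    also have "mcong (Suc k) \<dots> (?C ** A + t_times k (const_mat (x 0 ** y) ** A + const_mat w ** B))"
    proof (rule mcong_add[OF mcong_refl t_mod])
      have "mcong 1 (const_mat (y ** x 0) ** A + const_mat v) (const_mat (y ** x 0) ** mat 1 + const_mat v)"
        by (intro mcong_add mcong_mult_left A mcong_refl)
      also have "\<dots> = const_mat (x 0 ** y) ** mat 1 + const_mat w ** mat 1"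
        by (simp add: w_def ad_def mapm_diff[OF ring_map_const_poly])
      also have "mcong 1 \<dots> (const_mat (x 0 ** y) ** A + const_mat w ** B)"
        by (intro mcong_add mcong_mult_left mcong_sym[OF A(2)] mcong_sym[OF B1])
      finally show "mcong 1 (const_mat (y ** x 0) ** A + const_mat v) (const_mat (x 0 ** y) ** A + const_mat w ** B)" .
    qed
    also have "\<dots> = ?C ** (mat 1 + t_times k (const_mat y)) ** A + t_times k (const_mat w) ** B"
      by (simp add: matrix_add_ldistrib matrix_add_rdistrib t_times_mult t_times_add
          mapm_mult[OF ring_map_const_poly] matrix_mul_assoc add.assoc)
    also have "mcong (Suc k) \<dots> (?C ** D ** A + t_times k (const_mat w) ** B)"
      by (intro mcong_add mcong_mult_right mcong_mult_left mcong_sym[OF D(2)] mcong_refl)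
    also have "\<dots> = (?C + t_times k (const_mat w)) ** B"
      by (simp add: B_def matrix_add_rdistrib matrix_mul_assoc)
    finally show ?thesis .
  qed
  moreover have "mcong (Suc k) X (\<Sum>i\<in>S. tscale (a i) (mat_pow X (p ^ i)))"
    unfolding p_def by (rule mcong_mono[OF X_ss]) (use k in simp)
  ultimately have "mcong (Suc k) (B ** X) (?C ** B)"
    using S x0_ss w k(1) by (intro semisimple_no_commuting_perturbation[OF p_def]) (auto simp: p_def)
  moreover have "B \<in> jets (Suc m) G"
    unfolding B_def by (rule jets_mult[OF G D(1) A(1)])
  ultimately show ?thesis using B1 by blast
qed

lemma p_map_power_tensor_t_0:
  fixes x :: "'k::field^'n^'n"
  shows "(p_map m ^^ i) (x \<otimes>t 0) = mat_pow x (CHAR('k) ^ i) \<otimes>t 0"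
proof (induction i)
  case 0
  have "mat_pow x 1 = x" using mat_pow_Suc[of x 0] by (simp add: mat_pow_0)
  then show ?case by simp
next
  case (Suc i)
  then show ?case by (simp add: p_map_tensor_t mat_pow_mult mult.commute)
qed

theorem proposition3p3:
  fixes G :: "(('k::alg_closed_field)^'n^'n) set" and m :: nat
  assumes "CHAR('k) > 0"
    and "standard_reductive G"
    and "m > 0"
    and "x \<in> trunc_current_algebra m (Lie G)"
    and "restricted_semisimple tscale (p_map m) x"
  shows "\<exists>g\<in>trunc_current_group m G.
           Ad (TMat m) g x \<in> graded_piece (Lie G) 0 \<and>
           restricted_semisimple tscale (p_map m) (Ad (TMat m) g x)"
proof -
  have G: "subgroup G GL"
    using assms(2) by (simp add: standard_reductive_def connected_reductive_def connected_alg_group_def alg_group_def)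
  note one = subgroup_GL_one[OF G]
  obtain y where x: "x = (\<Sum>i\<le>m. y i \<otimes>t i)" and y: "\<And>i. i \<le> m \<Longrightarrow> y i \<in> Lie G"
    using assms(4) by (auto simp: trunc_current_algebra_def)
  obtain S a where S: "finite S" "\<And>i. i \<in> S \<Longrightarrow> 0 < i"
    and x_eq: "x = (\<Sum>i\<in>S. tscale (a i) ((p_map m ^^ i) x))"
    using restricted_semisimple_tscaleE[OF assms(5)] by blast
  have x_ss: "mcong (Suc m) x (\<Sum>i\<in>S. tscale (a i) (mat_pow x (CHAR('k) ^ i)))"
    by (subst x_eq) (intro mcong_sum mcong_tscale p_map_cong)
  have const_x: "mcong 1 x (const_mat (y 0))"
  proof -
    have "mcong 1 (y i \<otimes>t i) (if i = 0 then const_mat (y 0) else 0)" for i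
      using mcong_mono[OF mcong_t_times_0, of 1 i "const_mat (y i)"]
      by (auto simp: tensor_t_eq t_times_def mscale_def mcong_refl)
    then have "mcong 1 x (\<Sum>i\<le>m. if i = 0 then const_mat (y 0) else 0)"
      unfolding x by (intro mcong_sum)
    then show ?thesis by simp
  qed
  have "const_term x = const_term (\<Sum>i\<in>S. tscale (a i) (mat_pow x (CHAR('k) ^ i)))"
    using mcong_mono[OF x_ss] by (intro const_term_cong) simp
  then have y0_ss: "y 0 = (\<Sum>i\<in>S. mscale (a i) (mat_pow (y 0) (CHAR('k) ^ i)))"
    using const_term_cong[OF const_x]
    by (simp add: const_term_sum const_term_tscale mapm_mat_pow[OF ring_map_poly] const_term_const_mat)
  have "\<exists>A\<in>jets (Suc m) G. mcong 1 A (mat 1) \<and> mcong (Suc k) (A ** x) (const_mat (y 0) ** A)" if "k \<le> m" for k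
    using that
  proof (induction k)
    case 0
    have "mat 1 \<in> jets (Suc m) G"
    proof -
      have "entries (mat 1 :: 'k poly^'n^'n) = (\<lambda>v. [:entries (mat 1) v:])"
        using entries_mapm[of "\<lambda>c. [:c:]" "mat 1 :: 'k^'n^'n"] by (simp add: mapm_mat_1[OF ring_map_const_poly])
      then show ?thesis
        using one by (auto simp: jets_def pev_t_const vanishing_ideal_eq ideal_of_def)
    qed
    then show ?case
      using const_x by (intro bexI[of _ "mat 1"]) (simp_all add: mcong_refl)
  next
    case (Suc k)
    then obtain A where "A \<in> jets (Suc m) G" "mcong 1 A (mat 1)" "mcong (Suc k) (A ** x) (const_mat (y 0) ** A)"
      by auto
    then show ?case
      using Suc.prems by (intro conjugation_step[OF assms(1) G y x S(2) x_ss y0_ss]) auto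
  qed
  then obtain A where A: "A \<in> jets (Suc m) G" "mcong 1 A (mat 1)" "mcong (Suc m) (A ** x) (const_mat (y 0) ** A)"
    by blast
  interpret TMat: monoid "TMat m :: ('k poly^'n^'n) monoid" by (rule monoid_TMat)
  define g where "g = reduce m A"
  have g_unit: "g \<in> Units (TMat m)"
    unfolding g_def by (rule reduce_in_Units_TMat[OF A(2)])
  moreover have "g \<in> jets (Suc m) G"
    unfolding g_def by (rule jets_cong[OF A(1) mcong_reduce])
  ultimately have "g \<in> trunc_current_group m G"
    by (simp add: trunc_current_group_iff)
  moreover have Ad: "Ad (TMat m) g x = y 0 \<otimes>t 0"
  proof -
    have y0: "y 0 \<otimes>t 0 = const_mat (y 0)"
      by (simp add: tensor_t_eq t_times_def mscale_def)
    have "y 0 \<otimes>t 0 \<in> carrier (TMat m)"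
      by (simp add: TMat_def tensor_t_def monom_0)
    have "mcong (Suc m) (g ** x) (A ** x)"
      unfolding g_def by (intro mcong_mult_right mcong_reduce)
    also note A(3)
    also have "mcong (Suc m) (const_mat (y 0) ** A) (const_mat (y 0) ** g)"
      unfolding g_def by (intro mcong_mult_left mcong_sym[OF mcong_reduce])
    finally have "g \<otimes>\<^bsub>TMat m\<^esub> x = (y 0 \<otimes>t 0) \<otimes>\<^bsub>TMat m\<^esub> g"
      by (simp add: TMat_mult reduce_eq_iff y0)
    then have "Ad (TMat m) g x = (y 0 \<otimes>t 0) \<otimes>\<^bsub>TMat m\<^esub> (g \<otimes>\<^bsub>TMat m\<^esub> inv\<^bsub>TMat m\<^esub> g)"
      using g_unit \<open>y 0 \<otimes>t 0 \<in> carrier (TMat m)\<close> by (simp add: Ad_def TMat.m_assoc TMat.Units_closed)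
    then show ?thesis
      using g_unit \<open>y 0 \<otimes>t 0 \<in> carrier (TMat m)\<close> by simp
  qed
  moreover have "y 0 \<otimes>t 0 \<in> graded_piece (Lie G) 0"
    using y[of 0] by (simp add: graded_piece_def)
  moreover have "restricted_semisimple tscale (p_map m) (y 0 \<otimes>t 0)"
  proof -
    have "y 0 \<otimes>t 0 = const_mat (\<Sum>i\<in>S. mscale (a i) (mat_pow (y 0) (CHAR('k) ^ i)))"
      using y0_ss by (simp add: tensor_t_eq t_times_def mscale_def)
    also have "\<dots> = (\<Sum>i\<in>S. tscale (a i) ((p_map m ^^ i) (y 0 \<otimes>t 0)))"
      unfolding p_map_power_tensor_t_0 const_mat_sum const_mat_mscale
      by (simp add: tensor_t_eq t_times_def mscale_def)
    also have "\<dots> \<in> module.span tscale {(p_map m ^^ i) (y 0 \<otimes>t 0) |i. 0 < i}"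
      using S(2) by (intro module.span_sum[OF module_tscale] module.span_scale[OF module_tscale]
          module.span_base[OF module_tscale]) auto
    finally show ?thesis by (simp only: restricted_semisimple_def)
  qed
  ultimately show ?thesis by (intro bexI[of _ g]) simp_all
qed

end
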